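(* Let $P\in M(m,\mathcal D_* )$ be such that $\sigma(P)$ and $\sigma_{\operatorname{ord}P-1}(P)$ are scalar matrices. Suppose $$\sum_{\nu=1}^n\gamma_\nu\frac{\partial\bar\sigma_*(P)}{\partial\xi_\nu}\not\equiv 0\quad\text{for all }\gamma=(\gamma_1,\ldots,\gamma_n)\in\mathbb N^n\setminus\{0\}.$$ Then the map $$\sigma_*:\ M(m,\widetilde{\mathcal D}_* )^P:=\{Q\in M(m,\widetilde{\mathcal D}_* )\,;\,[P,Q]=0\}\to M(m,\mathcal D_N[\xi]),\qquad Q\mapsto\sigma_*(Q)$$ is an injective algebra homomorphism. In particular, when $m=1$, $\mathcal D_*^P:=\{Q\in\mathcal D_*\,;\,[P,Q]=0\}$ is commutative.
   Context: Setting. $M$ is a connected real analytic manifold of dimension $n+n'$, and $N_1,\ldots,N_n$ are one-codimensional submanifolds normally crossing at $N=N_1\cap\cdots\cap N_n$, with $N$ connected. A coordinate system $(t,x)=(t_1,\ldots,t_n,x_1,\ldots,x_{n'})$ is fixed in which $N_i=\{t_i=0\}$; $M$ is taken to be the domain of these coordinates, so $N=\{t=0\}$ with coordinates $x$. $\mathbb N=\{0,1,2,\ldots\}$. $\mathcal A_N$ is the space of complex-valued real analytic functions on $N$, and $\mathcal A_M$ is the space of those defined on a neighborhood of $N$ in $M$ (identified if they agree near $N$). $\mathcal D_N$ is the ring of differential operators on $N$ with coefficients in $\mathcal A_N$. $\vartheta_i=t_i\partial/\partial t_i$, $\vartheta^\alpha=\vartheta_1^{\alpha_1}\cdots\vartheta_n^{\alpha_n}$,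 $\partial_x^\beta=\partial^{|\beta|}/\partial x_1^{\beta_1}\cdots\partial x_{n'}^{\beta_{n'}}$. $M(m,R)$ is the ring of $m\times m$ matrices over $R$ ($m\ge1$); $R[\xi]=R[\xi_1,\ldots,\xi_n]$. $\widetilde{\mathcal D}_*$ is the ring of differential operators (finite sums) $P=\sum_{\alpha\in\mathbb N^n,\beta\in\mathbb N^{n'}}a_{\alpha,\beta}(t,x)\vartheta^\alpha\partial_x^\beta$ with $a_{\alpha,\beta}\in\mathcal A_M$; $\mathcal D_*$ is the subring of those with $a_{\alpha,\beta}(0,x)=0$ whenever $\beta\neq0$. For such a scalar $P$: $\sigma_*(P)(x,\xi,\partial_x)=\sum_{\alpha,\beta}a_{\alpha,\beta}(0,x)\xi^\alpha\partial_x^\beta\in\mathcal D_N[\xi]$; $\sigma_k(P)(t,x,\xi,\tau)=\sum_{|\alpha|+|\beta|=k}a_{\alpha,\beta}(t,x)\xi^\alpha\tau^\beta$; $\operatorname{ord}P$ is the maximal $k$ with $\sigma_k(P)\ne0$. For a matrix $P=(P_{ij})$: $\operatorname{ord}P$ is the maximal order of its components; $\sigma_k(P)=(\sigma_k(P_{ij}))$; $\sigma(P)=\sigma_{\operatorname{ord}P}(P)$; $\sigma_*(P)=(\sigma_*(P_{ij}))\in M(m,\mathcal D_N[\xi])$; $\bar\sigma_*(P)=\sigma(P)(0,x,\xi,\partial_x)$. If $P\in M(m,\mathcal D_* )$, then $\bar\sigma_*(P)\in M(m,\mathcal A_N[\xi])$. "$\not\equiv0$" means not identically zero as a function of $(x,\xi)$.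 *)

theory Defs
  imports "HOL-Analysis.Analysis" "HOL-Algebra.Module"
begin

text \<open>
  Conventions. A coordinate system \<open>(t, x)\<close> on \<open>M\<close> identifies \<open>M\<close> with an open subset of
  \<open>real ^ 'i\<close>. The coordinates with index in \<open>T\<close> are the \<open>t\<close>-coordinates, those with index outside
  \<open>T\<close> are the \<open>x\<close>-coordinates; so \<open>n = card T\<close> and \<open>n' = card (- T)\<close>, and either may be \<open>0\<close>.
  A pair \<open>(\<alpha>, \<beta>)\<close> of multi-indices is encoded as the single function \<open>'i \<Rightarrow> nat\<close> that is
  \<open>\<alpha>\<close> on \<open>T\<close> and \<open>\<beta>\<close> off \<open>T\<close>.
\<close>

type_synonym 'i midx = "'i \<Rightarrow> nat"

definition supported :: "'i set \<Rightarrow> 'i midx \<Rightarrow> bool" where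
  "supported I \<kappa> \<longleftrightarrow> (\<forall>i. i \<notin> I \<longrightarrow> \<kappa> i = 0)"

definition deg :: "'i::finite midx \<Rightarrow> nat" where
  "deg \<kappa> = (\<Sum>i\<in>UNIV. \<kappa> i)"


section \<open>Algebras, matrices and polynomials\<close>

text \<open>
  An algebra is a \<open>module\<close> record, i.e. a ring record with a scalar multiplication; the locale
  \<open>algebra\<close> of the library is not used because it is restricted to commutative algebras.
\<close>

definition alg_hom :: "('k, 'a) module \<Rightarrow> ('k, 'b) module \<Rightarrow> ('a \<Rightarrow> 'b) set" where
  "alg_hom A B = {h \<in> ring_hom A B. \<forall>k. \<forall>x\<in>carrier A. h (k \<odot>\<^bsub>A\<^esub> x) = k \<odot>\<^bsub>B\<^esub> h x}"

definition centralizer :: "('k, 'a) module \<Rightarrow> 'a \<Rightarrow> ('k, 'a) module" where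
  "centralizer A p = A\<lparr>carrier := {q \<in> carrier A. p \<otimes>\<^bsub>A\<^esub> q = q \<otimes>\<^bsub>A\<^esub> p}\<rparr>"

definition mat_alg :: "('k, 'a) module \<Rightarrow> ('k, 'm::finite \<Rightarrow> 'm \<Rightarrow> 'a) module" where
  "mat_alg A = \<lparr>carrier = {X. \<forall>i j. X i j \<in> carrier A},
     monoid.mult = (\<lambda>X Y i j. \<Oplus>\<^bsub>A\<^esub>k\<in>UNIV. X i k \<otimes>\<^bsub>A\<^esub> Y k j),
     one = (\<lambda>i j. if i = j then \<one>\<^bsub>A\<^esub> else \<zero>\<^bsub>A\<^esub>),
     zero = (\<lambda>i j. \<zero>\<^bsub>A\<^esub>),
     add = (\<lambda>X Y i j. X i j \<oplus>\<^bsub>A\<^esub> Y i j),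
     smult = (\<lambda>c X i j. c \<odot>\<^bsub>A\<^esub> X i j)\<rparr>"

definition scalar_matrix :: "'a \<Rightarrow> ('m \<Rightarrow> 'm \<Rightarrow> 'a) \<Rightarrow> bool" where
  "scalar_matrix z X \<longleftrightarrow> (\<exists>s. \<forall>i j. X i j = (if i = j then s else z))"

text \<open>
  Finitely supported families of coefficients indexed by the multi-indices on \<open>I\<close>. They serve both
  as polynomials in central variables and as coefficients of differential operators.
\<close>

definition families :: "('k, 'a) module \<Rightarrow> 'i set \<Rightarrow> ('i midx \<Rightarrow> 'a) set" where
  "families A I = {c. (\<forall>\<kappa>. c \<kappa> \<in> carrier A) \<and> finite {\<kappa>. c \<kappa> \<noteq> \<zero>\<^bsub>A\<^esub>} \<and>
     (\<forall>\<kappa>. c \<kappa> \<noteq> \<zero>\<^bsub>A\<^esub> \<longrightarrow> supported I \<kappa>)}"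

text \<open>The polynomial algebra \<open>A[\<xi>\<^sub>i : i \<in> I]\<close> over a possibly noncommutative \<open>A\<close>.\<close>

definition poly_alg :: "('k, 'a) module \<Rightarrow> 'i set \<Rightarrow> ('k, 'i midx \<Rightarrow> 'a) module" where
  "poly_alg A I = \<lparr>carrier = families A I,
     monoid.mult = (\<lambda>f g \<kappa>. \<Oplus>\<^bsub>A\<^esub>\<mu>\<in>{\<mu>. \<forall>i. \<mu> i \<le> \<kappa> i}. f \<mu> \<otimes>\<^bsub>A\<^esub> g (\<lambda>i. \<kappa> i - \<mu> i)),
     one = (\<lambda>\<kappa>. if \<kappa> = (\<lambda>i. 0) then \<one>\<^bsub>A\<^esub> else \<zero>\<^bsub>A\<^esub>),
     zero = (\<lambda>\<kappa>. \<zero>\<^bsub>A\<^esub>),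
     add = (\<lambda>f g \<kappa>. f \<kappa> \<oplus>\<^bsub>A\<^esub> g \<kappa>),
     smult = (\<lambda>k f \<kappa>. k \<odot>\<^bsub>A\<^esub> f \<kappa>)\<rparr>"


section \<open>Differential operators over an algebra with commuting derivations\<close>

text \<open>
  The iterated derivation \<open>\<delta>\<^sup>\<kappa>\<close>. The order in which the \<open>\<delta> i\<close> are applied is immaterial, since
  they commute on the function algebras below.
\<close>

definition iter_der :: "('i::finite \<Rightarrow> 'a \<Rightarrow> 'a) \<Rightarrow> 'i midx \<Rightarrow> 'a \<Rightarrow> 'a" where
  "iter_der \<delta> \<kappa> u =
     foldr (\<lambda>i. \<delta> i ^^ \<kappa> i) (SOME is. distinct is \<and> set is = (UNIV :: 'i set)) u"

text \<open>Operators are genuine maps on the carrier of \<open>A\<close>; multiplication is composition.\<close>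

definition diff_op ::
  "('k, 'a) module \<Rightarrow> ('i::finite \<Rightarrow> 'a \<Rightarrow> 'a) \<Rightarrow> ('i midx \<Rightarrow> 'a) \<Rightarrow> 'a \<Rightarrow> 'a" where
  "diff_op A \<delta> c =
     (\<lambda>u\<in>carrier A. \<Oplus>\<^bsub>A\<^esub>\<kappa>\<in>{\<kappa>. c \<kappa> \<noteq> \<zero>\<^bsub>A\<^esub>}. c \<kappa> \<otimes>\<^bsub>A\<^esub> iter_der \<delta> \<kappa> u)"

definition diff_alg ::
  "('k, 'a) module \<Rightarrow> ('i::finite \<Rightarrow> 'a \<Rightarrow> 'a) \<Rightarrow> 'i set \<Rightarrow> ('k, 'a \<Rightarrow> 'a) module" where
  "diff_alg A \<delta> I = \<lparr>carrier = diff_op A \<delta> ` families A I,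
     monoid.mult = compose (carrier A),
     one = (\<lambda>u\<in>carrier A. u),
     zero = (\<lambda>u\<in>carrier A. \<zero>\<^bsub>A\<^esub>),
     add = (\<lambda>P Q. \<lambda>u\<in>carrier A. P u \<oplus>\<^bsub>A\<^esub> Q u),
     smult = (\<lambda>k P. \<lambda>u\<in>carrier A. k \<odot>\<^bsub>A\<^esub> P u)\<rparr>"

definition coeffs ::
  "('k, 'a) module \<Rightarrow> ('i::finite \<Rightarrow> 'a \<Rightarrow> 'a) \<Rightarrow> 'i set \<Rightarrow> ('a \<Rightarrow> 'a) \<Rightarrow> 'i midx \<Rightarrow> 'a" where
  "coeffs A \<delta> I P = (THE c. c \<in> families A I \<and> P = diff_op A \<delta> c)"


section \<open>Real analytic functions\<close>

text \<open>
  For open \<open>S\<close> this is real analyticity on \<open>S\<close>. It is also applied to the open subset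
  \<open>S = N\<close> of \<open>{t = 0}\<close>: there all monomials containing some \<open>t\<^sub>i\<close> vanish, so that \<open>f\<close> is locally a
  convergent power series in \<open>x\<close>.
\<close>

definition real_analytic_on :: "((real ^ 'i::finite) \<Rightarrow> complex) \<Rightarrow> (real ^ 'i) set \<Rightarrow> bool" where
  "real_analytic_on f S \<longleftrightarrow> (\<forall>p\<in>S. \<exists>r>0. \<exists>c :: 'i midx \<Rightarrow> complex. \<forall>y\<in>S \<inter> ball p r.
     ((\<lambda>\<kappa>. c \<kappa> * of_real (\<Prod>i\<in>UNIV. (y $ i - p $ i) ^ \<kappa> i)) has_sum f y) UNIV)"

definition partial :: "'i::finite \<Rightarrow> ((real ^ 'i) \<Rightarrow> complex) \<Rightarrow> (real ^ 'i) \<Rightarrow> complex" where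
  "partial i f y = vector_derivative (\<lambda>s. f (y + s *\<^sub>R axis i 1)) (at 0)"

text \<open>The germ of \<open>f\<close> along \<open>N\<close>: all functions that agree with \<open>f\<close> on a neighborhood of \<open>N\<close>.\<close>

definition germ ::
  "(real ^ 'i::finite) set \<Rightarrow> ((real ^ 'i) \<Rightarrow> complex) \<Rightarrow> ((real ^ 'i) \<Rightarrow> complex) set" where
  "germ N f = {g. \<exists>U. open U \<and> N \<subseteq> U \<and> (\<forall>y\<in>U. g y = f y)}"

definition A_M ::
  "(real ^ 'i::finite) set \<Rightarrow> (complex, ((real ^ 'i) \<Rightarrow> complex) set) module" where
  "A_M N = \<lparr>carrier = {germ N f | f U. open U \<and> N \<subseteq> U \<and> real_analytic_on f U},
     monoid.mult = (\<lambda>F G. \<Union>f\<in>F. \<Union>g\<in>G. germ N (\<lambda>y. f y * g y)),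
     one = germ N (\<lambda>y. 1),
     zero = germ N (\<lambda>y. 0),
     add = (\<lambda>F G. \<Union>f\<in>F. \<Union>g\<in>G. germ N (\<lambda>y. f y + g y)),
     smult = (\<lambda>k F. \<Union>f\<in>F. germ N (\<lambda>y. k * f y))\<rparr>"

text \<open>\<open>\<vartheta>\<^sub>i = t\<^sub>i \<partial>/\<partial>t\<^sub>i\<close> for the \<open>t\<close>-coordinates and \<open>\<partial>/\<partial>x\<^sub>j\<close> for the \<open>x\<close>-coordinates.\<close>

definition der_M :: "(real ^ 'i::finite) set \<Rightarrow> 'i set \<Rightarrow> 'i \<Rightarrow>
    ((real ^ 'i) \<Rightarrow> complex) set \<Rightarrow> ((real ^ 'i) \<Rightarrow> complex) set" where
  "der_M N T i F = (\<Union>f\<in>F. germ N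
     (\<lambda>y. if i \<in> T then of_real (y $ i) * partial i f y else partial i f y))"

definition A_N :: "(real ^ 'i::finite) set \<Rightarrow> (complex, (real ^ 'i) \<Rightarrow> complex) module" where
  "A_N N = \<lparr>carrier = {f \<in> extensional N. real_analytic_on f N},
     monoid.mult = (\<lambda>f g. \<lambda>y\<in>N. f y * g y),
     one = (\<lambda>y\<in>N. 1),
     zero = (\<lambda>y\<in>N. 0),
     add = (\<lambda>f g. \<lambda>y\<in>N. f y + g y),
     smult = (\<lambda>k f. \<lambda>y\<in>N. k * f y)\<rparr>"

text \<open>
  Only used for the \<open>x\<close>-coordinates; along these, \<open>N\<close> contains all nearby points of the line through
  a point of \<open>N\<close>, so the values of \<open>f\<close> off \<open>N\<close> do not matter.
\<close>

definition der_N ::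
  "(real ^ 'i::finite) set \<Rightarrow> 'i \<Rightarrow> ((real ^ 'i) \<Rightarrow> complex) \<Rightarrow> (real ^ 'i) \<Rightarrow> complex" where
  "der_N N i f = (\<lambda>y\<in>N. partial i f y)"

text \<open>The restriction \<open>a(t, x) \<mapsto> a(0, x)\<close> to \<open>N\<close>, the same for all representatives of the germ.\<close>

definition at_N ::
  "(real ^ 'i::finite) set \<Rightarrow> ((real ^ 'i) \<Rightarrow> complex) set \<Rightarrow> (real ^ 'i) \<Rightarrow> complex" where
  "at_N N F = the_elem ((\<lambda>f. restrict f N) ` F)"


section \<open>The rings of differential operators and the symbol maps\<close>

type_synonym 'i op_M = "((real ^ 'i) \<Rightarrow> complex) set \<Rightarrow> ((real ^ 'i) \<Rightarrow> complex) set"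
type_synonym 'i op_N = "((real ^ 'i) \<Rightarrow> complex) \<Rightarrow> (real ^ 'i) \<Rightarrow> complex"

definition D_tilde :: "(real ^ 'i::finite) set \<Rightarrow> 'i set \<Rightarrow> (complex, 'i op_M) module" where
  "D_tilde N T = diff_alg (A_M N) (der_M N T) UNIV"

definition coeffs_M :: "(real ^ 'i::finite) set \<Rightarrow> 'i set \<Rightarrow> 'i op_M \<Rightarrow>
    'i midx \<Rightarrow> ((real ^ 'i) \<Rightarrow> complex) set" where
  "coeffs_M N T = coeffs (A_M N) (der_M N T) UNIV"

definition D_star :: "(real ^ 'i::finite) set \<Rightarrow> 'i set \<Rightarrow> (complex, 'i op_M) module" where
  "D_star N T = (D_tilde N T)\<lparr>carrier := {P \<in> carrier (D_tilde N T).
     \<forall>\<kappa>. \<not> supported T \<kappa> \<longrightarrow> at_N N (coeffs_M N T P \<kappa>) = \<zero>\<^bsub>A_N N\<^esub>}\<rparr>"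

definition D_N :: "(real ^ 'i::finite) set \<Rightarrow> 'i set \<Rightarrow> (complex, 'i op_N) module" where
  "D_N N T = diff_alg (A_N N) (der_N N) (- T)"

abbreviation D_N_xi ::
  "(real ^ 'i::finite) set \<Rightarrow> 'i set \<Rightarrow> (complex, 'i midx \<Rightarrow> 'i op_N) module" where
  "D_N_xi N T \<equiv> poly_alg (D_N N T) T"

text \<open>
  Substitution of \<open>t = 0\<close> and \<open>\<tau> = \<partial>\<^sub>x\<close>: the family \<open>a\<close> goes to
  \<open>\<Sum> a\<^sub>\<alpha>\<^sub>,\<^sub>\<beta>(0, x) \<xi>\<^sup>\<alpha> \<partial>\<^sub>x\<^sup>\<beta>\<close> in \<open>\<D>\<^sub>N[\<xi>]\<close>. The coefficient of \<open>\<xi>\<^sup>\<alpha>\<close> is the operator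
  \<open>\<Sum>\<^sub>\<beta> a\<^sub>\<alpha>\<^sub>,\<^sub>\<beta>(0, x) \<partial>\<^sub>x\<^sup>\<beta>\<close>, and \<open>(\<alpha>, \<beta>)\<close> is encoded as the pointwise sum of \<open>\<alpha>\<close> and \<open>\<beta>\<close>.
\<close>

definition subst_star :: "(real ^ 'i::finite) set \<Rightarrow> 'i set \<Rightarrow>
    ('i midx \<Rightarrow> ((real ^ 'i) \<Rightarrow> complex) set) \<Rightarrow> 'i midx \<Rightarrow> 'i op_N" where
  "subst_star N T a = (\<lambda>\<alpha>. diff_op (A_N N) (der_N N)
     (\<lambda>\<beta>. if supported T \<alpha> \<and> supported (- T) \<beta> then at_N N (a (\<lambda>i. \<alpha> i + \<beta> i)) else \<zero>\<^bsub>A_N N\<^esub>))"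

definition sigma_star ::
  "(real ^ 'i::finite) set \<Rightarrow> 'i set \<Rightarrow> ('m \<Rightarrow> 'm \<Rightarrow> 'i op_M) \<Rightarrow> 'm \<Rightarrow> 'm \<Rightarrow> 'i midx \<Rightarrow> 'i op_N" where
  "sigma_star N T P = (\<lambda>i j. subst_star N T (coeffs_M N T (P i j)))"

text \<open>
  \<open>\<sigma>\<^sub>k(P)\<close> as a polynomial in \<open>(\<xi>, \<tau>)\<close> over \<open>\<A>\<^sub>M\<close>; \<open>k\<close> is an integer so that
  \<open>k = ord P - 1\<close> makes sense also for \<open>ord P = 0\<close>.
\<close>

definition sigma_k :: "(real ^ 'i::finite) set \<Rightarrow> 'i set \<Rightarrow> int \<Rightarrow> ('m \<Rightarrow> 'm \<Rightarrow> 'i op_M) \<Rightarrow>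
    'm \<Rightarrow> 'm \<Rightarrow> 'i midx \<Rightarrow> ((real ^ 'i) \<Rightarrow> complex) set" where
  "sigma_k N T k P = (\<lambda>i j \<kappa>. if int (deg \<kappa>) = k then coeffs_M N T (P i j) \<kappa> else \<zero>\<^bsub>A_M N\<^esub>)"

text \<open>
  The maximal order of the components, i.e. the maximal \<open>k\<close> with \<open>\<sigma>\<^sub>k(P) \<noteq> 0\<close>. As \<open>Sup {} = 0\<close> on
  \<open>nat\<close>, the zero matrix has order \<open>0\<close>.
\<close>

definition ord_mat :: "(real ^ 'i::finite) set \<Rightarrow> 'i set \<Rightarrow> ('m \<Rightarrow> 'm \<Rightarrow> 'i op_M) \<Rightarrow> nat" where
  "ord_mat N T P = Sup {k. \<exists>i j. sigma_k N T (int k) P i j \<noteq> \<zero>\<^bsub>poly_alg (A_M N) UNIV\<^esub>}"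

definition principal_symbol :: "(real ^ 'i::finite) set \<Rightarrow> 'i set \<Rightarrow> ('m \<Rightarrow> 'm \<Rightarrow> 'i op_M) \<Rightarrow>
    'm \<Rightarrow> 'm \<Rightarrow> 'i midx \<Rightarrow> ((real ^ 'i) \<Rightarrow> complex) set" where
  "principal_symbol N T P = sigma_k N T (int (ord_mat N T P)) P"

definition sigma_bar ::
  "(real ^ 'i::finite) set \<Rightarrow> 'i set \<Rightarrow> ('m \<Rightarrow> 'm \<Rightarrow> 'i op_M) \<Rightarrow> 'm \<Rightarrow> 'm \<Rightarrow> 'i midx \<Rightarrow> 'i op_N" where
  "sigma_bar N T P = (\<lambda>i j. subst_star N T (principal_symbol N T P i j))"

text \<open>
  The value at \<open>(x, \<xi>)\<close> of an element of \<open>\<A>\<^sub>N[\<xi>]\<close>, viewed inside \<open>\<D>\<^sub>N[\<xi>]\<close>: its coefficients are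
  multiplication operators, and applying such an operator to the constant function \<open>1\<close> gives back
  the function one multiplies by. Components of \<open>\<xi>\<close> outside \<open>T\<close> are irrelevant.
\<close>

definition xi_value :: "(real ^ 'i::finite) set \<Rightarrow> 'i set \<Rightarrow> ('i midx \<Rightarrow> 'i op_N) \<Rightarrow>
    (real ^ 'i) \<Rightarrow> ('i \<Rightarrow> complex) \<Rightarrow> complex" where
  "xi_value N T f x \<xi> =
     (\<Sum>\<alpha> | f \<alpha> \<noteq> \<zero>\<^bsub>D_N N T\<^esub>. f \<alpha> \<one>\<^bsub>A_N N\<^esub> x * (\<Prod>i\<in>T. \<xi> i ^ \<alpha> i))"

definition xi_deriv :: "(real ^ 'i::finite) set \<Rightarrow> 'i set \<Rightarrow> 'i \<Rightarrow> ('i midx \<Rightarrow> 'i op_N) \<Rightarrow>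
    (real ^ 'i) \<Rightarrow> ('i \<Rightarrow> complex) \<Rightarrow> complex" where
  "xi_deriv N T \<nu> f x \<xi> = deriv (\<lambda>s. xi_value N T f x (\<xi>(\<nu> := s))) (\<xi> \<nu>)"

end

theory Submission
  imports Defs "HOL-Complex_Analysis.Cauchy_Integral_Formula"
begin

text \<open>
  Throughout, \<open>\<vartheta>\<^sub>i = t\<^sub>i \<partial>/\<partial>t\<^sub>i\<close>, and an operator is a finite sum of terms \<open>a(t, x) \<vartheta>\<^sup>\<alpha> \<partial>\<^sub>x\<^sup>\<beta>\<close>.

  Conjugation by \<open>t\<^sup>\<lambda>\<close> replaces \<open>\<vartheta>\<^sub>i\<close> by \<open>\<vartheta>\<^sub>i + \<lambda>\<^sub>i\<close>, and \<open>\<vartheta>\<^sub>i\<close> vanishes on \<open>N = {t = 0}\<close>.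
  Hence restricting \<open>t\<^sup>-\<^sup>\<lambda> Q t\<^sup>\<lambda>\<close> to \<open>N\<close> gives \<open>\<sigma>\<^sub>*(Q)\<close> at \<open>\<xi> = \<lambda>\<close>. Conjugation and restriction
  are multiplicative, and a polynomial in \<open>\<xi>\<close> is determined by its values; this is why \<open>\<sigma>\<^sub>*\<close> is a
  homomorphism (\<open>representable_compose\<close>, \<open>slice_compose\<close>, \<open>sigma_star_mult\<close>).

  For injectivity let \<open>D\<close> commute with \<open>P\<close>, let \<open>\<sigma>\<^sub>*(D) = 0\<close> and suppose \<open>D \<noteq> 0\<close>. Expand the
  coefficients of \<open>D\<close> in powers of \<open>t\<close> and choose \<open>\<gamma>\<close> of minimal degree such that the coefficient
  \<open>D\<^sub>\<gamma>\<close> of \<open>t\<^sup>\<gamma>\<close>, an operator in \<open>\<vartheta>\<close> and \<open>\<partial>\<^sub>x\<close> with coefficients on \<open>N\<close>, is not zero. Then \<open>\<gamma> \<noteq> 0\<close>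
  because \<open>\<sigma>\<^sub>*(D) = 0\<close>. On \<open>N\<close> the operator \<open>P\<close> is a polynomial \<open>p(x, \<vartheta>)\<close> free of \<open>\<partial>\<^sub>x\<close>, so the
  coefficient of \<open>t\<^sup>\<gamma>\<close> in \<open>[P, D] = 0\<close> is the identity
  \<open>p(x, \<vartheta> + \<gamma>) D\<^sub>\<gamma> = D\<^sub>\<gamma> p(x, \<vartheta>)\<close> (\<open>lowest_term\<close>).

  Let \<open>k\<close> be the order of \<open>P\<close>, and give \<open>\<vartheta>\<^sub>i\<close> the weight 1 and \<open>\<partial>\<^sub>x\<close> the weight 2. The shift by \<open>\<gamma>\<close>
  costs one unit of weight: \<open>p(x, \<xi> + \<gamma>) - p(x, \<xi>)\<close> has leading part
  \<open>\<Sum>\<^sub>\<nu> \<gamma>\<^sub>\<nu> \<partial>p\<^sub>k/\<partial>\<xi>\<^sub>\<nu>\<close>. Letting a \<open>\<partial>\<^sub>x\<close> act on \<open>p\<close> costs two units. The parts of \<open>p\<close> of degrees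
  \<open>k\<close> and \<open>k - 1\<close> are scalar and commute with matrices, and the remainder is two units below \<open>p\<^sub>k\<close>. So the
  leading part of the identity is \<open>(\<Sum>\<^sub>\<nu> \<gamma>\<^sub>\<nu> \<partial>p\<^sub>k/\<partial>\<xi>\<^sub>\<nu>) \<cdot> q = 0\<close>, where \<open>q \<noteq> 0\<close> is the leading part of
  \<open>D\<^sub>\<gamma>\<close> (\<open>leading_coefficient\<close>). By hypothesis the first factor does not vanish identically, so \<open>q\<close>
  vanishes near a point of \<open>N\<close>, hence on the connected \<open>N\<close> (\<open>identity_theorem\<close>), a contradiction
  (\<open>commuting_zero\<close>).

  If \<open>m = 1\<close> and \<open>Q, Q'\<close> lie in \<open>\<D>\<^sub>*\<close>, then \<open>\<sigma>\<^sub>*(Q)\<close> and \<open>\<sigma>\<^sub>*(Q')\<close> are polynomials in \<open>\<xi>\<close> whose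
  coefficients are functions. They commute, so \<open>Q Q'\<close> and \<open>Q' Q\<close> have the same image under \<open>\<sigma>\<^sub>*\<close>, and both
  commute with \<open>P\<close>.

  The analysis is carried out with representing functions. The locale \<open>function_model\<close> transfers it to
  operators on germs and on functions on \<open>N\<close>; the coefficients of such an operator are well defined because
  they can be read off from its values on the functions \<open>t\<^sup>\<lambda> exp(\<mu> \<cdot> x)\<close>, on which all \<open>\<vartheta>\<^sub>i\<close> and
  \<open>\<partial>/\<partial>x\<^sub>j\<close> act as scalars (\<open>twisted_op_zero_coeffs\<close>).
\<close>

section \<open>Multivariate power series\<close>

text \<open>
  The monomial \<open>z\<^sup>\<kappa>\<close>.
\<close>

definition mpow :: "'i::finite midx \<Rightarrow> ('i \<Rightarrow> 'a::comm_semiring_1) \<Rightarrow> 'a" where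
  "mpow \<kappa> z = (\<Prod>i\<in>UNIV. z i ^ \<kappa> i)"

definition has_power_series :: "((real ^ 'i::finite) \<Rightarrow> complex) \<Rightarrow> ('i midx \<Rightarrow> complex) \<Rightarrow> real ^ 'i \<Rightarrow> bool" where
  "has_power_series f c p \<longleftrightarrow> (\<forall>\<^sub>F y in nhds p.
     ((\<lambda>\<kappa>. c \<kappa> * mpow \<kappa> (\<lambda>i. of_real (y $ i - p $ i))) has_sum f y) UNIV)"

abbreviation up :: "'i \<Rightarrow> 'i midx \<Rightarrow> 'i midx" where
  "up i \<kappa> \<equiv> \<kappa>(i := Suc (\<kappa> i))"

lemma mpow_add: "mpow (\<lambda>i. \<kappa> i + \<mu> i) z = mpow \<kappa> z * mpow \<mu> z"
  by (simp add: mpow_def power_add prod.distrib)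

lemma mpow_zero [simp]: "mpow (\<lambda>i. 0) z = 1"
  by (simp add: mpow_def)

lemma mpow_fun_upd_arg: "mpow \<kappa> (z(i := w)) = w ^ \<kappa> i * (\<Prod>j\<in>UNIV - {i}. z j ^ \<kappa> j)"
  unfolding mpow_def by (subst prod.remove[of _ i]) auto

lemma mpow_split: "mpow \<kappa> z = z i ^ \<kappa> i * (\<Prod>j\<in>UNIV - {i}. z j ^ \<kappa> j)"
  using mpow_fun_upd_arg[of \<kappa> z i "z i"] by simp

lemma mpow_fun_upd_exponent: "mpow (\<kappa>(i := n)) z = z i ^ n * (\<Prod>j\<in>UNIV - {i}. z j ^ \<kappa> j)"
  unfolding mpow_def by (subst prod.remove[of _ i]) auto

lemma mpow_up: "mpow (up i \<kappa>) z = z i * mpow \<kappa> z"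
  by (simp add: mpow_fun_upd_exponent mpow_split[of \<kappa> z i] mult.assoc)

lemma mpow_zero_arg: "mpow \<kappa> (\<lambda>i. 0 :: 'a::{comm_semiring_1,semiring_no_zero_divisors}) = (if \<kappa> = (\<lambda>i. 0) then 1 else 0)"
proof (cases "\<kappa> = (\<lambda>i. 0)")
  case False
  then obtain i where "\<kappa> i \<noteq> 0" by auto
  then have "(0::'a) ^ \<kappa> i = 0" by (simp add: power_0_left)
  then have "(\<Prod>i\<in>UNIV. (0::'a) ^ \<kappa> i) = 0" by (intro prod_zero) auto
  with False show ?thesis by (simp add: mpow_def)
qed simp

lemma norm_mpow_le:
  fixes z :: "'i::finite \<Rightarrow> complex"
  assumes "\<And>i. norm (z i) \<le> \<rho>"
  shows "norm (mpow \<kappa> z) \<le> \<rho> ^ deg \<kappa>"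
proof -
  have "norm (mpow \<kappa> z) = (\<Prod>i\<in>UNIV. norm (z i) ^ \<kappa> i)"
    by (simp add: mpow_def norm_power prod_norm [symmetric])
  also have "\<dots> \<le> (\<Prod>i\<in>UNIV. \<rho> ^ \<kappa> i)"
    by (intro prod_mono conjI power_mono assms) auto
  finally show ?thesis by (simp add: deg_def power_sum)
qed

lemma midx_induct [case_names zero up]:
  fixes \<kappa> :: "'i::finite midx"
  assumes "P (\<lambda>i. 0)" "\<And>i \<kappa>. P \<kappa> \<Longrightarrow> P (up i \<kappa>)"
  shows "P \<kappa>"
proof (induction "deg \<kappa>" arbitrary: \<kappa>)
  case 0
  then have "\<kappa> = (\<lambda>i. 0)" by (auto simp: deg_def)
  then show ?case using assms(1) by simp
next
  case (Suc n)
  have "\<exists>i. \<kappa> i \<noteq> 0"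
  proof (rule ccontr)
    assume "\<nexists>i. \<kappa> i \<noteq> 0"
    then have "deg \<kappa> = 0" by (simp add: deg_def)
    with Suc(2) show False by simp
  qed
  then obtain i where i: "\<kappa> i \<noteq> 0" ..
  let ?\<mu> = "\<kappa>(i := \<kappa> i - 1)"
  have up: "up i ?\<mu> = \<kappa>" using i by auto
  have "deg \<kappa> = Suc (deg ?\<mu>)"
    unfolding deg_def using i by (simp add: sum.remove[of _ i])
  then have "P ?\<mu>" using Suc by simp
  from assms(2)[OF this, of i] show ?case unfolding up .
qed

lemma finite_box: "finite {\<mu> :: 'i::finite \<Rightarrow> nat. \<forall>i. \<mu> i \<le> \<kappa> i}"
proof -
  have "{\<mu>. \<forall>i. \<mu> i \<le> \<kappa> i} = PiE UNIV (\<lambda>i. {..\<kappa> i})" by (auto simp: PiE_def)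
  then show ?thesis by (simp add: finite_PiE)
qed

lemma power_series_add: "has_power_series f c p \<Longrightarrow> has_power_series g d p \<Longrightarrow> has_power_series (\<lambda>y. f y + g y) (\<lambda>\<kappa>. c \<kappa> + d \<kappa>) p"
  unfolding has_power_series_def
  by (erule (1) eventually_elim2) (simp only: distrib_right has_sum_add)

definition cauchy_product :: "('i::finite midx \<Rightarrow> complex) \<Rightarrow> ('i midx \<Rightarrow> complex) \<Rightarrow> 'i midx \<Rightarrow> complex" where
  "cauchy_product c d \<kappa> = (\<Sum>\<mu> | \<forall>i. \<mu> i \<le> \<kappa> i. c \<mu> * d (\<lambda>i. \<kappa> i - \<mu> i))"

text \<open>
  Both series converge absolutely, so the double series may be summed along the fibres of
  \<open>(\<mu>, \<nu>) \<mapsto> \<mu> + \<nu>\<close>.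
\<close>

lemma has_sum_cauchy_product:
  fixes c d :: "'i::finite midx \<Rightarrow> complex"
  assumes A: "((\<lambda>\<kappa>. c \<kappa> * mpow \<kappa> z) has_sum a) UNIV" and B: "((\<lambda>\<kappa>. d \<kappa> * mpow \<kappa> z) has_sum b) UNIV"
  shows "((\<lambda>\<kappa>. cauchy_product c d \<kappa> * mpow \<kappa> z) has_sum (a * b)) UNIV"
proof -
  let ?a = "\<lambda>\<kappa>. c \<kappa> * mpow \<kappa> z" and ?b = "\<lambda>\<kappa>. d \<kappa> * mpow \<kappa> z"
  let ?f = "\<lambda>(\<mu>, \<nu>). ?a \<mu> * ?b \<nu>"
  have absA: "(\<lambda>\<kappa>. norm (?a \<kappa>)) summable_on UNIV" and absB: "(\<lambda>\<kappa>. norm (?b \<kappa>)) summable_on UNIV"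
    using A B by (auto simp: summable_on_iff_abs_summable_on_complex [symmetric] summable_on_def)
  have "(\<lambda>x. norm (?f x)) summable_on (UNIV \<times> UNIV)"
    unfolding Infinite_Sum.abs_summable_on_Sigma_iff
  proof (intro conjI ballI)
    fix \<mu> show "(\<lambda>\<nu>. norm (?f (\<mu>, \<nu>))) summable_on UNIV"
      using absB by (auto simp: norm_mult intro!: summable_on_cmult_right)
  next
    have "(\<lambda>\<mu>. norm (?a \<mu>) * (\<Sum>\<^sub>\<infinity>\<nu>. norm (?b \<nu>))) summable_on UNIV"
      by (rule summable_on_cmult_left[OF absA])
    moreover have "(\<Sum>\<^sub>\<infinity>\<nu>. norm (?f (\<mu>, \<nu>))) = norm (?a \<mu>) * (\<Sum>\<^sub>\<infinity>\<nu>. norm (?b \<nu>))" for \<mu>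
      by (simp add: norm_mult infsum_cmult_right')
    moreover have "0 \<le> (\<Sum>\<^sub>\<infinity>\<nu>. norm (?b \<nu>))" by (rule infsum_nonneg) simp
    ultimately show "(\<lambda>\<mu>. norm (\<Sum>\<^sub>\<infinity>\<nu>. norm (?f (\<mu>, \<nu>)))) summable_on UNIV"
      by (simp add: norm_mult)
  qed
  then have "?f summable_on (UNIV \<times> UNIV)"
    by (rule summable_on_iff_abs_summable_on_complex[THEN iffD2])
  then have "(?f has_sum (a * b)) (UNIV \<times> UNIV)"
    by (rule has_sum_SigmaI[where g = "\<lambda>\<mu>. ?a \<mu> * b", rotated 2])
       (use A B in \<open>auto intro: has_sum_cmult_left has_sum_cmult_right\<close>)
  also have "?this \<longleftrightarrow> ((\<lambda>(\<kappa>, \<mu>). ?f (\<mu>, \<lambda>i. \<kappa> i - \<mu> i)) has_sum (a * b))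
      (SIGMA \<kappa>:UNIV. {\<mu>. \<forall>i. \<mu> i \<le> \<kappa> i})"
    by (rule has_sum_reindex_bij_witness[where j = "\<lambda>(\<mu>, \<nu>). (\<lambda>i. \<mu> i + \<nu> i, \<mu>)"
          and i = "\<lambda>(\<kappa>, \<mu>). (\<mu>, \<lambda>i. \<kappa> i - \<mu> i)"]) auto
  finally have 1: "((\<lambda>(\<kappa>, \<mu>). ?f (\<mu>, \<lambda>i. \<kappa> i - \<mu> i)) has_sum (a * b))
      (SIGMA \<kappa>:UNIV. {\<mu>. \<forall>i. \<mu> i \<le> \<kappa> i})" .
  have 2: "((\<lambda>\<mu>. (\<lambda>(\<kappa>, \<mu>). ?f (\<mu>, \<lambda>i. \<kappa> i - \<mu> i)) (\<kappa>, \<mu>)) has_sum (cauchy_product c d \<kappa> * mpow \<kappa> z))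
      {\<mu>. \<forall>i. \<mu> i \<le> \<kappa> i}" for \<kappa>
  proof -
    have "cauchy_product c d \<kappa> * mpow \<kappa> z = (\<Sum>\<mu> | \<forall>i. \<mu> i \<le> \<kappa> i. ?f (\<mu>, \<lambda>i. \<kappa> i - \<mu> i))"
      unfolding cauchy_product_def sum_distrib_right
    proof (rule sum.cong[OF refl])
      fix \<mu> assume "\<mu> \<in> {\<mu>. \<forall>i. \<mu> i \<le> \<kappa> i}"
      then have "mpow \<kappa> z = mpow \<mu> z * mpow (\<lambda>i. \<kappa> i - \<mu> i) z"
        by (subst mpow_add [symmetric]) simp
      then show "c \<mu> * d (\<lambda>i. \<kappa> i - \<mu> i) * mpow \<kappa> z = ?f (\<mu>, \<lambda>i. \<kappa> i - \<mu> i)" by simp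
    qed
    then show ?thesis using has_sum_finite[OF finite_box] by simp
  qed
  show ?thesis by (rule has_sum_SigmaD[OF 1 2])
qed

lemma power_series_mult: "has_power_series f c p \<Longrightarrow> has_power_series g d p \<Longrightarrow> has_power_series (\<lambda>y. f y * g y) (cauchy_product c d) p"
  unfolding has_power_series_def by (erule (1) eventually_elim2) (rule has_sum_cauchy_product)

lemma power_series_at: assumes "has_power_series f c p" shows "f p = c (\<lambda>i. 0)"
proof -
  have "((\<lambda>\<kappa>. c \<kappa> * mpow \<kappa> (\<lambda>i. 0)) has_sum f p) UNIV"
    using eventually_nhds_x_imp_x[OF assms[unfolded has_power_series_def]] by simp
  moreover have "((\<lambda>\<kappa>. c \<kappa> * mpow \<kappa> (\<lambda>i. 0)) has_sum c (\<lambda>i. 0)) UNIV \<longleftrightarrow>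
      ((\<lambda>\<kappa>. c \<kappa>) has_sum c (\<lambda>i. 0)) {\<lambda>i. 0}"
    by (rule has_sum_cong_neutral) (auto simp: mpow_zero_arg)
  moreover have "(c has_sum c (\<lambda>i. 0)) {\<lambda>i. 0}"
    using has_sum_finite[of "{\<lambda>i. 0}" c] by simp
  ultimately show ?thesis by (intro has_sum_unique[of "\<lambda>\<kappa>. c \<kappa> * mpow \<kappa> (\<lambda>i. 0)"]) auto
qed

lemma power_series_cong:
  assumes "\<forall>\<^sub>F y in nhds p. f y = g y" "has_power_series f c p" shows "has_power_series g c p"
  using assms unfolding has_power_series_def by eventually_elim simp

text \<open>
  Unconditional convergence at the single point \<open>p + (\<rho>, \<dots>, \<rho>)\<close> already dominates the series
  on the whole cube of radius \<open>\<rho>\<close>.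
\<close>

lemma power_series_radius:
  fixes f :: "(real ^ 'i::finite) \<Rightarrow> complex"
  assumes "has_power_series f c p"
  obtains \<rho> where "\<rho> > 0" "(\<lambda>\<kappa>. norm (c \<kappa>) * \<rho> ^ deg \<kappa>) summable_on UNIV"
    "\<forall>y. (\<forall>i. \<bar>y $ i - p $ i\<bar> \<le> \<rho>) \<longrightarrow>
      ((\<lambda>\<kappa>. c \<kappa> * mpow \<kappa> (\<lambda>i. of_real (y $ i - p $ i))) has_sum f y) UNIV"
proof -
  from assms obtain r where r: "r > 0" and
    S: "\<And>y. dist y p < r \<Longrightarrow> ((\<lambda>\<kappa>. c \<kappa> * mpow \<kappa> (\<lambda>i. of_real (y $ i - p $ i))) has_sum f y) UNIV"
    unfolding has_power_series_def eventually_nhds_metric by auto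
  \<comment> \<open>the cube of radius \<open>\<rho>\<close> then lies in the ball of radius \<open>r\<close>, by comparison with the \<open>1\<close>-norm\<close>
  define \<rho> where "\<rho> = r / (2 * real CARD('i))"
  have \<rho>: "\<rho> > 0" using r by (simp add: \<rho>_def)
  have near: "dist y p < r" if "\<And>i. \<bar>y $ i - p $ i\<bar> \<le> \<rho>" for y
  proof -
    have "dist y p \<le> (\<Sum>i\<in>UNIV. \<bar>(y - p) $ i\<bar>)" unfolding dist_norm by (rule norm_le_l1_cart)
    also have "\<dots> \<le> (\<Sum>i\<in>(UNIV::'i set). \<rho>)" by (rule sum_mono) (use that in simp)
    also have "\<dots> = r / 2" by (simp add: \<rho>_def)
    finally show ?thesis using r by simp
  qed
  let ?y = "p + (\<chi> i. \<rho>)"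
  have "((\<lambda>\<kappa>. c \<kappa> * mpow \<kappa> (\<lambda>i. of_real \<rho>)) has_sum f ?y) UNIV"
    using S[of ?y] near[of ?y] \<rho> by simp
  then have "(\<lambda>\<kappa>. norm (c \<kappa> * mpow \<kappa> (\<lambda>i. of_real \<rho>))) summable_on UNIV"
    by (rule has_sum_imp_summable[THEN summable_on_iff_abs_summable_on_complex[THEN iffD1]])
  moreover have "norm (c \<kappa> * mpow \<kappa> (\<lambda>i. of_real \<rho>)) = norm (c \<kappa>) * \<rho> ^ deg \<kappa>" for \<kappa>
    using \<rho> by (simp add: norm_mult mpow_def deg_def power_sum norm_power prod_norm [symmetric])
  ultimately show ?thesis using that[OF \<rho>] S near by simp
qed

lemma power_series_continuous:
  fixes f :: "(real ^ 'i::finite) \<Rightarrow> complex"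
  assumes "has_power_series f c p" shows "isCont f p"
proof -
  obtain \<rho> where \<rho>: "\<rho> > 0" "(\<lambda>\<kappa>. norm (c \<kappa>) * \<rho> ^ deg \<kappa>) summable_on UNIV"
    "\<forall>y. (\<forall>i. \<bar>y $ i - p $ i\<bar> \<le> \<rho>) \<longrightarrow>
      ((\<lambda>\<kappa>. c \<kappa> * mpow \<kappa> (\<lambda>i. of_real (y $ i - p $ i))) has_sum f y) UNIV"
    by (rule power_series_radius[OF assms])
  have near: "\<bar>y $ i - p $ i\<bar> \<le> \<rho>" if "y \<in> cball p \<rho>" for y i
    using component_le_norm_cart[of "y - p" i] that by (simp add: dist_norm norm_minus_commute)
  have "uniform_limit (cball p \<rho>) (\<lambda>X y. \<Sum>\<kappa>\<in>X. c \<kappa> * mpow \<kappa> (\<lambda>i. of_real (y $ i - p $ i))) f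
      (finite_subsets_at_top UNIV)"
  proof (rule Weierstrass_m_test_general'[OF _ _ \<rho>(2)])
    fix \<kappa> :: "'i midx" and y assume "y \<in> cball p \<rho>"
    then have "norm (mpow \<kappa> (\<lambda>i. complex_of_real (y $ i - p $ i))) \<le> \<rho> ^ deg \<kappa>"
      by (intro norm_mpow_le) (use near in \<open>auto simp flip: of_real_diff\<close>)
    then show "norm (c \<kappa> * mpow \<kappa> (\<lambda>i. of_real (y $ i - p $ i))) \<le> norm (c \<kappa>) * \<rho> ^ deg \<kappa>"
      by (simp add: norm_mult mult_left_mono del: of_real_diff)
  qed (use \<rho>(3) near in blast)
  then have "continuous_on (cball p \<rho>) f"
    by (rule uniform_limit_theorem[rotated])
       (auto intro!: continuous_intros always_eventually simp: mpow_def)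
  then have "continuous_on (ball p \<rho>) f" by (rule continuous_on_subset) auto
  then show ?thesis using \<rho>(1) by (simp add: continuous_on_eq_continuous_at)
qed

text \<open>
  In the variable \<open>z\<^sub>i\<close> the partial sums are polynomials that converge uniformly on a complex disc, so by
  Weierstrass their derivatives converge to the derivative of the limit. With the filter of finite subsets of the index set,
  this convergence is precisely the \<open>has_sum\<close> statement for the differentiated series.
\<close>

lemma power_series_deriv:
  fixes c :: "'i::finite midx \<Rightarrow> complex" and z :: "'i \<Rightarrow> complex"
  assumes summ: "(\<lambda>\<kappa>. norm (c \<kappa>) * \<rho> ^ deg \<kappa>) summable_on UNIV" and z: "\<And>j. norm (z j) < \<rho>"
  obtains D where
    "((\<lambda>w. \<Sum>\<^sub>\<infinity>\<kappa>. c \<kappa> * mpow \<kappa> (z(i := w))) has_field_derivative D) (at (z i))"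
    "((\<lambda>\<kappa>. of_nat (Suc (\<kappa> i)) * c (up i \<kappa>) * mpow \<kappa> z) has_sum D) UNIV"
proof -
  have \<rho>: "\<rho> > 0" using z[of i] norm_ge_zero[of "z i"] by linarith
  let ?R = "\<lambda>\<kappa>. \<Prod>j\<in>UNIV - {i}. z j ^ \<kappa> j"
  define h where "h w = (\<Sum>\<^sub>\<infinity>\<kappa>. c \<kappa> * mpow \<kappa> (z(i := w)))" for w
  have ul: "uniform_limit (cball 0 \<rho>) (\<lambda>X w. \<Sum>\<kappa>\<in>X. c \<kappa> * mpow \<kappa> (z(i := w))) h
      (finite_subsets_at_top UNIV)"
    unfolding h_def
  proof (rule Weierstrass_m_test_general[OF _ summ])
    fix \<kappa> :: "'i midx" and w :: complex assume "w \<in> cball 0 \<rho>"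
    then have "norm (mpow \<kappa> (z(i := w))) \<le> \<rho> ^ deg \<kappa>"
      using z by (intro norm_mpow_le) (auto intro: less_imp_le)
    then show "norm (c \<kappa> * mpow \<kappa> (z(i := w))) \<le> norm (c \<kappa>) * \<rho> ^ deg \<kappa>"
      by (simp add: norm_mult mult_left_mono)
  qed
  let ?d = "\<lambda>X w. \<Sum>\<kappa>\<in>X. c \<kappa> * (of_nat (\<kappa> i) * w ^ (\<kappa> i - 1)) * ?R \<kappa>"
  have ev: "\<forall>\<^sub>F X in finite_subsets_at_top UNIV.
      continuous_on (cball 0 \<rho>) (\<lambda>w. \<Sum>\<kappa>\<in>X. c \<kappa> * mpow \<kappa> (z(i := w))) \<and>
      (\<forall>w\<in>ball 0 \<rho>. ((\<lambda>w. \<Sum>\<kappa>\<in>X. c \<kappa> * mpow \<kappa> (z(i := w))) has_field_derivative ?d X w) (at w))"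
    unfolding mpow_fun_upd_arg
    by (intro always_eventually allI conjI ballI)
       (auto intro!: continuous_intros derivative_eq_intros sum.cong simp: mult_ac)
  obtain h' where h': "\<And>w. w \<in> ball 0 \<rho> \<Longrightarrow> (h has_field_derivative h' w) (at w) \<and>
      ((\<lambda>X. ?d X w) \<longlongrightarrow> h' w) (finite_subsets_at_top UNIV)"
    using has_complex_derivative_uniform_limit[OF ev ul _ \<rho>] by auto
  have zi: "z i \<in> ball 0 \<rho>" using z by simp
  have "((\<lambda>\<kappa>. c \<kappa> * (of_nat (\<kappa> i) * z i ^ (\<kappa> i - 1)) * ?R \<kappa>) has_sum h' (z i)) UNIV"
    using h'[OF zi] by (simp add: has_sum_def)
  also have "?this \<longleftrightarrow> ((\<lambda>\<kappa>. c \<kappa> * (of_nat (\<kappa> i) * z i ^ (\<kappa> i - 1)) * ?R \<kappa>) has_sum h' (z i)) {\<kappa>. \<kappa> i \<noteq> 0}"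
    by (rule has_sum_cong_neutral) auto
  also have "\<dots> \<longleftrightarrow> ((\<lambda>\<kappa>. of_nat (Suc (\<kappa> i)) * c (up i \<kappa>) * mpow \<kappa> z) has_sum h' (z i)) UNIV"
    by (rule has_sum_reindex_bij_witness[where i = "up i" and j = "\<lambda>\<kappa>. \<kappa>(i := \<kappa> i - 1)"])
       (auto simp: mpow_fun_upd_exponent)
  finally have "((\<lambda>\<kappa>. of_nat (Suc (\<kappa> i)) * c (up i \<kappa>) * mpow \<kappa> z) has_sum h' (z i)) UNIV" .
  moreover have "h = (\<lambda>w. \<Sum>\<^sub>\<infinity>\<kappa>. c \<kappa> * mpow \<kappa> (z(i := w)))" by (simp add: h_def fun_eq_iff)
  ultimately show ?thesis using that conjunct1[OF h'[OF zi]] by simp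
qed

lemma power_series_partial:
  fixes f :: "(real ^ 'i::finite) \<Rightarrow> complex"
  assumes "has_power_series f c p"
  shows "has_power_series (partial i f) (\<lambda>\<kappa>. of_nat (Suc (\<kappa> i)) * c (up i \<kappa>)) p"
    and "((\<lambda>s. f (p + s *\<^sub>R axis i 1)) has_vector_derivative partial i f p) (at 0)"
proof -
  obtain \<rho> where \<rho>: "\<rho> > 0" "(\<lambda>\<kappa>. norm (c \<kappa>) * \<rho> ^ deg \<kappa>) summable_on UNIV"
    "\<forall>y. (\<forall>i. \<bar>y $ i - p $ i\<bar> \<le> \<rho>) \<longrightarrow>
      ((\<lambda>\<kappa>. c \<kappa> * mpow \<kappa> (\<lambda>i. of_real (y $ i - p $ i))) has_sum f y) UNIV"
    by (rule power_series_radius[OF assms])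
  have main: "((\<lambda>\<kappa>. of_nat (Suc (\<kappa> i)) * c (up i \<kappa>) * mpow \<kappa> (\<lambda>i. of_real (y $ i - p $ i))) has_sum partial i f y) UNIV
      \<and> ((\<lambda>s. f (y + s *\<^sub>R axis i 1)) has_vector_derivative partial i f y) (at 0)"
    if y: "y \<in> ball p \<rho>" for y
  proof -
    have yj: "\<bar>y $ j - p $ j\<bar> < \<rho>" for j
      using component_le_norm_cart[of "y - p" j] y by (simp add: dist_norm norm_minus_commute)
    define z where "z = (\<lambda>i. complex_of_real (y $ i - p $ i))"
    have zj: "norm (z j) < \<rho>" for j using yj by (simp add: z_def flip: of_real_diff)
    obtain D where D: "((\<lambda>w. \<Sum>\<^sub>\<infinity>\<kappa>. c \<kappa> * mpow \<kappa> (z(i := w))) has_field_derivative D) (at (z i))"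
      "((\<lambda>\<kappa>. of_nat (Suc (\<kappa> i)) * c (up i \<kappa>) * mpow \<kappa> z) has_sum D) UNIV"
      by (rule power_series_deriv[OF \<rho>(2) zj])
    let ?h = "\<lambda>w. \<Sum>\<^sub>\<infinity>\<kappa>. c \<kappa> * mpow \<kappa> (z(i := w))" and ?a = "y $ i - p $ i"
    have 1: "((\<lambda>s. complex_of_real (?a + s)) has_vector_derivative complex_of_real 1) (at 0)"
      by (intro has_vector_derivative_of_real) (auto intro!: derivative_eq_intros)
    have "(?h has_field_derivative D) (at (complex_of_real (?a + 0)))"
      using D(1) unfolding z_def by simp
    from field_vector_diff_chain_at[OF 1 this]
    have 2: "((\<lambda>s. ?h (complex_of_real (?a + s))) has_vector_derivative D) (at 0)"
      unfolding o_def by simp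
    have op: "open {s. \<bar>?a + s\<bar> < \<rho>}" by (intro open_Collect_less continuous_intros)
    have ev: "?h (complex_of_real (?a + s)) = f (y + s *\<^sub>R axis i 1)" if s: "s \<in> {s. \<bar>?a + s\<bar> < \<rho>}" for s
    proof -
      let ?y = "y + s *\<^sub>R axis i 1"
      have z': "(\<lambda>j. complex_of_real (?y $ j - p $ j)) = z(i := complex_of_real (?a + s))"
        by (auto simp: z_def axis_def fun_eq_iff)
      have "\<bar>?y $ j - p $ j\<bar> \<le> \<rho>" for j
        using s yj[of j] by (cases "j = i") (auto simp: axis_def algebra_simps)
      then have "((\<lambda>\<kappa>. c \<kappa> * mpow \<kappa> (z(i := complex_of_real (?a + s)))) has_sum f ?y) UNIV"
        using \<rho>(3)[THEN spec[of _ ?y]] unfolding z' by blast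
      then show ?thesis by (rule infsumI)
    qed
    have 3: "((\<lambda>s. f (y + s *\<^sub>R axis i 1)) has_vector_derivative D) (at 0)"
      by (rule has_vector_derivative_transform_within_open[OF 2 op _ ev]) (use yj[of i] in simp)
    then have "partial i f y = D" unfolding partial_def by (rule vector_derivative_at)
    with 3 D(2) show ?thesis by (simp add: z_def)
  qed
  have "\<forall>\<^sub>F y in nhds p. y \<in> ball p \<rho>" using \<rho>(1) by (intro eventually_nhds_in_open) auto
  then show "has_power_series (partial i f) (\<lambda>\<kappa>. of_nat (Suc (\<kappa> i)) * c (up i \<kappa>)) p"
    unfolding has_power_series_def by (rule eventually_mono) (rule main[THEN conjunct1])
  show "((\<lambda>s. f (p + s *\<^sub>R axis i 1)) has_vector_derivative partial i f p) (at 0)"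
    by (rule main[THEN conjunct2]) (use \<rho>(1) in simp)
qed

text \<open>
  The constant term is the value at \<open>p\<close>, and the other coefficients are constant terms of the
  derivatives.
\<close>

lemma power_series_unique:
  assumes "has_power_series f c p" "has_power_series f d p" shows "c = d"
proof
  fix \<kappa>
  show "c \<kappa> = d \<kappa>"
    using assms
  proof (induction \<kappa> arbitrary: f c d rule: midx_induct)
    case zero
    then show ?case using power_series_at by metis
  next
    case (up i \<kappa>)
    from up(1)[OF power_series_partial(1)[OF up(2)] power_series_partial(1)[OF up(3)], of i]
    show ?case by (simp del: of_nat_Suc fun_upd_apply add: of_nat_neq_0)
  qed
qed

section \<open>Germs of real analytic functions\<close>

text \<open>
  An expansion is required at every point near \<open>p\<close>. The notion is therefore open in \<open>p\<close> by
  definition, and no power series has to be expanded around another centre.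
\<close>

definition real_analytic_at :: "((real ^ 'i::finite) \<Rightarrow> complex) \<Rightarrow> real ^ 'i \<Rightarrow> bool" where
  "real_analytic_at f p \<longleftrightarrow> (\<forall>\<^sub>F q in nhds p. \<exists>c. has_power_series f c q)"

definition near_eq :: "real ^ 'i::finite \<Rightarrow> ((real ^ 'i) \<Rightarrow> complex) \<Rightarrow> ((real ^ 'i) \<Rightarrow> complex) \<Rightarrow> bool" where
  "near_eq p f g \<longleftrightarrow> (\<forall>\<^sub>F y in nhds p. f y = g y)"

lemma near_eq_refl [simp]: "near_eq p f f" by (simp add: near_eq_def)
lemma near_eq_sym: "near_eq p f g \<Longrightarrow> near_eq p g f" by (simp add: near_eq_def eq_commute)
lemma near_eq_trans [trans]: "near_eq p f g \<Longrightarrow> near_eq p g h \<Longrightarrow> near_eq p f h"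
  unfolding near_eq_def by (erule (1) eventually_elim2) simp
lemma near_eq_at: "near_eq p f g \<Longrightarrow> f p = g p" unfolding near_eq_def by (rule eventually_nhds_x_imp_x)

lemma near_eq_near: "near_eq p f g \<Longrightarrow> \<forall>\<^sub>F q in nhds p. near_eq q f g"
  unfolding near_eq_def by (simp add: eventually_eventually)

lemma near_eq_add: "near_eq p f g \<Longrightarrow> near_eq p f' g' \<Longrightarrow> near_eq p (\<lambda>y. f y + f' y) (\<lambda>y. g y + g' y)"
  unfolding near_eq_def by (erule (1) eventually_elim2) simp
lemma near_eq_mult: "near_eq p f g \<Longrightarrow> near_eq p f' g' \<Longrightarrow> near_eq p (\<lambda>y. f y * f' y) (\<lambda>y. g y * g' y)"
  unfolding near_eq_def by (erule (1) eventually_elim2) simp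
lemma near_eq_sum: "(\<And>k. k \<in> K \<Longrightarrow> near_eq p (f k) (g k)) \<Longrightarrow> near_eq p (\<lambda>y. \<Sum>k\<in>K. f k y) (\<lambda>y. \<Sum>k\<in>K. g k y)"
  by (induction K rule: infinite_finite_induct) (auto intro: near_eq_add)

lemma analytic_near: "real_analytic_at f p \<Longrightarrow> \<forall>\<^sub>F q in nhds p. real_analytic_at f q"
  unfolding real_analytic_at_def by (simp add: eventually_eventually)

lemma analytic_power_series: assumes "real_analytic_at f p" obtains c where "has_power_series f c p"
  using eventually_nhds_x_imp_x[OF assms[unfolded real_analytic_at_def]] by blast

lemma analytic_cong: assumes "near_eq p f g" "real_analytic_at f p" shows "real_analytic_at g p"
  using near_eq_near[OF assms(1)] assms(2) unfolding real_analytic_at_def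
  by (rule eventually_elim2) (auto simp: near_eq_def intro: power_series_cong)

lemma analytic_add: "real_analytic_at f p \<Longrightarrow> real_analytic_at g p \<Longrightarrow> real_analytic_at (\<lambda>y. f y + g y) p"
  unfolding real_analytic_at_def by (erule (1) eventually_elim2) (auto intro: power_series_add)

lemma analytic_mult: "real_analytic_at f p \<Longrightarrow> real_analytic_at g p \<Longrightarrow> real_analytic_at (\<lambda>y. f y * g y) p"
  unfolding real_analytic_at_def by (erule (1) eventually_elim2) (auto intro: power_series_mult)

lemma power_series_finite:
  assumes K: "finite K" "\<And>\<kappa>. \<kappa> \<notin> K \<Longrightarrow> c \<kappa> = 0"
    and f: "\<And>y. f y = (\<Sum>\<kappa>\<in>K. c \<kappa> * mpow \<kappa> (\<lambda>i. of_real (y $ i - p $ i)))"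
  shows "has_power_series f c p"
  unfolding has_power_series_def
proof (intro always_eventually allI)
  fix y
  let ?g = "\<lambda>\<kappa>. c \<kappa> * mpow \<kappa> (\<lambda>i. complex_of_real (y $ i - p $ i))"
  have "(?g has_sum f y) K" unfolding f by (rule has_sum_finite[OF K(1)])
  also have "?this \<longleftrightarrow> (?g has_sum f y) UNIV" by (rule has_sum_cong_neutral) (auto simp: K(2))
  finally show "(?g has_sum f y) UNIV" .
qed

lemma power_series_const: "has_power_series (\<lambda>y. a) (\<lambda>\<kappa>. if \<kappa> = (\<lambda>i. 0) then a else 0) p"
  by (rule power_series_finite[of "{\<lambda>i. 0}"]) auto

lemma analytic_const [simp]: "real_analytic_at (\<lambda>y. a) p"
  unfolding real_analytic_at_def using power_series_const by (intro always_eventually) blast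

lemma power_series_coord:
  "has_power_series (\<lambda>y. of_real (y $ i)) (\<lambda>\<kappa>. if \<kappa> = (\<lambda>i. 0) then of_real (p $ i) else if \<kappa> = up i (\<lambda>i. 0) then 1 else 0) p"
proof (rule power_series_finite[of "{\<lambda>i. 0, up i (\<lambda>i. 0)}"])
  fix y
  have "up i (\<lambda>i. 0) \<noteq> (\<lambda>i. 0::nat)" by (metis fun_upd_same nat.distinct(1))
  then show "complex_of_real (y $ i) = (\<Sum>\<kappa>\<in>{\<lambda>i. 0, up i (\<lambda>i. 0)}. (if \<kappa> = (\<lambda>i. 0) then of_real (p $ i)
      else if \<kappa> = up i (\<lambda>i. 0) then 1 else 0) * mpow \<kappa> (\<lambda>i. of_real (y $ i - p $ i)))"
    using mpow_up[of "\<lambda>i. 0" i "\<lambda>i. complex_of_real (y $ i - p $ i)"] by (auto simp del: fun_upd_apply)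
qed auto

lemma analytic_coord [simp]: "real_analytic_at (\<lambda>y. of_real (y $ i)) p"
  unfolding real_analytic_at_def using power_series_coord by (intro always_eventually) blast

lemma power_series_exp:
  "has_power_series (\<lambda>y. exp (a * of_real (y $ i)))
     (\<lambda>\<kappa>. if \<kappa> = (\<lambda>j. 0)(i := \<kappa> i) then exp (a * of_real (p $ i)) * (a ^ \<kappa> i / fact (\<kappa> i)) else 0) p"
  unfolding has_power_series_def
proof (intro always_eventually allI)
  fix y :: "real ^ 'a"
  define z where "z = (\<lambda>i. complex_of_real (y $ i - p $ i))"
  define g where "g \<kappa> = (if \<kappa> = (\<lambda>j. 0)(i := \<kappa> i) then exp (a * of_real (p $ i)) * (a ^ \<kappa> i / fact (\<kappa> i)) else 0) * mpow \<kappa> z" for \<kappa>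
  let ?h = "\<lambda>n. (\<lambda>j. 0)(i := n)"
  have "summable (\<lambda>n. norm ((a * z i) ^ n /\<^sub>R fact n))" by (rule summable_norm_exp)
  moreover have "(\<lambda>n. (a * z i) ^ n /\<^sub>R fact n) sums exp (a * z i)" by (rule exp_converges)
  ultimately have "((\<lambda>n. (a * z i) ^ n /\<^sub>R fact n) has_sum exp (a * z i)) UNIV"
    by (rule norm_summable_imp_has_sum)
  then have "((\<lambda>n. exp (a * of_real (p $ i)) * ((a * z i) ^ n /\<^sub>R fact n)) has_sum exp (a * of_real (p $ i)) * exp (a * z i)) UNIV"
    by (rule has_sum_cmult_right)
  moreover have "exp (a * of_real (p $ i)) * exp (a * z i) = exp (a * of_real (y $ i))"
    by (simp add: exp_add [symmetric] z_def algebra_simps)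
  moreover have "exp (a * of_real (p $ i)) * ((a * z i) ^ n /\<^sub>R fact n) = (g \<circ> ?h) n" for n
  proof -
    have "mpow (?h n) z = z i ^ n" by (simp add: mpow_fun_upd_exponent)
    then show ?thesis
      by (simp add: g_def scaleR_conv_of_real field_simps power_mult_distrib)
  qed
  ultimately have "((g \<circ> ?h) has_sum exp (a * of_real (y $ i))) UNIV" by (simp add: o_def)
  moreover have "inj ?h" by (rule injI) (metis fun_upd_same)
  ultimately have "(g has_sum exp (a * of_real (y $ i))) (range ?h)" by (intro has_sum_reindex[THEN iffD2])
  also have "?this \<longleftrightarrow> (g has_sum exp (a * of_real (y $ i))) UNIV"
  proof (rule has_sum_cong_neutral)
    fix \<kappa> :: "'a midx" assume "\<kappa> \<in> UNIV - range ?h"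
    then have "\<kappa> \<noteq> ?h (\<kappa> i)" by blast
    then show "g \<kappa> = 0" by (simp add: g_def)
  qed auto
  finally show "((\<lambda>\<kappa>. (if \<kappa> = (\<lambda>j. 0)(i := \<kappa> i) then exp (a * of_real (p $ i)) * (a ^ \<kappa> i / fact (\<kappa> i)) else 0)
      * mpow \<kappa> (\<lambda>i. of_real (y $ i - p $ i))) has_sum exp (a * of_real (y $ i))) UNIV"
    unfolding g_def z_def .
qed

lemma analytic_exp: "real_analytic_at (\<lambda>y. exp (a * of_real (y $ i))) p"
  unfolding real_analytic_at_def using power_series_exp by (intro always_eventually) blast

lemma analytic_partial: "real_analytic_at f p \<Longrightarrow> real_analytic_at (partial i f) p"
  unfolding real_analytic_at_def by (erule eventually_mono) (auto intro: power_series_partial(1))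

lemma analytic_sum: "(\<And>k. k \<in> K \<Longrightarrow> real_analytic_at (f k) p) \<Longrightarrow> real_analytic_at (\<lambda>y. \<Sum>k\<in>K. f k y) p"
  by (induction K rule: infinite_finite_induct) (auto intro: analytic_add)

lemma analytic_prod: "(\<And>k. k \<in> K \<Longrightarrow> real_analytic_at (f k) p) \<Longrightarrow> real_analytic_at (\<lambda>y. \<Prod>k\<in>K. f k y) p"
  by (induction K rule: infinite_finite_induct) (auto intro: analytic_mult)

lemma analytic_power: "real_analytic_at f p \<Longrightarrow> real_analytic_at (\<lambda>y. f y ^ n) p"
  by (induction n) (auto intro: analytic_mult)

lemma analytic_isCont: "real_analytic_at f p \<Longrightarrow> isCont f p"
  by (erule analytic_power_series) (rule power_series_continuous)

lemma analytic_nonzero_near: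
  assumes "real_analytic_at f p" "f p \<noteq> 0" shows "\<forall>\<^sub>F y in nhds p. f y \<noteq> 0"
proof -
  have "(f \<longlongrightarrow> f p) (nhds p)"
    using analytic_isCont[OF assms(1)] by (simp add: isCont_def tendsto_at_iff_tendsto_nhds)
  then show ?thesis using assms(2) by (rule tendsto_imp_eventually_ne)
qed

lemma partial_derivative:
  "real_analytic_at f p \<Longrightarrow> ((\<lambda>s. f (p + s *\<^sub>R axis i 1)) has_vector_derivative partial i f p) (at 0)"
  by (erule analytic_power_series) (rule power_series_partial(2))

lemma partial_eq: "((\<lambda>s. f (p + s *\<^sub>R axis i 1)) has_vector_derivative D) (at 0) \<Longrightarrow> partial i f p = D"
  unfolding partial_def by (rule vector_derivative_at)

lemma partial_add: "real_analytic_at f p \<Longrightarrow> real_analytic_at g p \<Longrightarrow> partial i (\<lambda>y. f y + g y) p = partial i f p + partial i g p"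
  by (rule partial_eq) (intro has_vector_derivative_add partial_derivative)

lemma partial_mult:
  assumes "real_analytic_at f p" "real_analytic_at g p"
  shows "partial i (\<lambda>y. f y * g y) p = f p * partial i g p + partial i f p * g p"
  using has_vector_derivative_mult[OF partial_derivative partial_derivative, OF assms, of i i]
  by (intro partial_eq) simp

lemma partial_const [simp]: "partial i (\<lambda>y. a) p = 0"
  by (rule partial_eq) simp

lemma partial_cmult: "real_analytic_at f p \<Longrightarrow> partial i (\<lambda>y. a * f y) p = a * partial i f p"
  using partial_mult[of "\<lambda>y. a" p f i] by simp

lemma partial_sum:
  "(\<And>k. k \<in> K \<Longrightarrow> real_analytic_at (f k) p) \<Longrightarrow> partial i (\<lambda>y. \<Sum>k\<in>K. f k y) p = (\<Sum>k\<in>K. partial i (f k) p)"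
  by (induction K rule: infinite_finite_induct) (auto simp: partial_add analytic_sum)

lemma partial_coord: "partial i (\<lambda>y. of_real (y $ j)) p = (if i = j then 1 else 0)"
proof (rule partial_eq)
  have "((\<lambda>s. p $ j + s * (if i = j then 1 else 0)) has_field_derivative (if i = j then 1 else 0)) (at 0)"
    by (auto intro!: derivative_eq_intros)
  from has_vector_derivative_of_real[OF this]
  have 1: "((\<lambda>s. complex_of_real (p $ j + s * (if i = j then 1 else 0))) has_vector_derivative
      complex_of_real (if i = j then 1 else 0)) (at 0)" .
  have 2: "(\<lambda>s. complex_of_real ((p + s *\<^sub>R axis i 1) $ j)) = (\<lambda>s. complex_of_real (p $ j + s * (if i = j then 1 else 0)))"
    by (auto simp: axis_def fun_eq_iff)
  show "((\<lambda>s. complex_of_real ((p + s *\<^sub>R axis i 1) $ j)) has_vector_derivative (if i = j then 1 else 0)) (at 0)"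
    unfolding 2 using 1 by (simp split: if_splits)
qed

lemma partial_exp: "partial i (\<lambda>y. exp (a * of_real (y $ j))) p = (if i = j then a * exp (a * of_real (p $ j)) else 0)"
proof (rule partial_eq)
  have 1: "((\<lambda>s. complex_of_real ((p + s *\<^sub>R axis i 1) $ j)) has_vector_derivative (if i = j then 1 else 0)) (at 0)"
    using partial_derivative[OF analytic_coord, where i = i] by (simp add: partial_coord)
  have 2: "((\<lambda>w. exp (a * w)) has_field_derivative a * exp (a * of_real (p $ j))) (at (complex_of_real ((p + 0 *\<^sub>R axis i 1) $ j)))"
    by (auto intro!: derivative_eq_intros)
  show "((\<lambda>s. exp (a * of_real ((p + s *\<^sub>R axis i 1) $ j))) has_vector_derivative
      (if i = j then a * exp (a * of_real (p $ j)) else 0)) (at 0)"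
    using field_vector_diff_chain_at[OF 1 2] by (auto simp: o_def split: if_splits)
qed

lemma partial_cong: assumes "near_eq p f g" shows "partial i f p = partial i g p"
  unfolding partial_def
proof (rule vector_derivative_cong_eq)
  have "((\<lambda>s::real. p + s *\<^sub>R axis i 1) \<longlongrightarrow> p + 0 *\<^sub>R axis i 1) (nhds 0)"
    by (intro tendsto_intros filterlim_ident)
  then show "\<forall>\<^sub>F s in nhds 0. s \<in> UNIV \<longrightarrow> f (p + s *\<^sub>R axis i 1) = g (p + s *\<^sub>R axis i 1)"
    using assms unfolding near_eq_def filterlim_iff by auto
qed auto

text \<open>
  Both sides are the same coefficient of the power series at \<open>p\<close>.
\<close>

lemma partial_comm: assumes "real_analytic_at f p" shows "partial i (partial j f) p = partial j (partial i f) p"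
proof -
  obtain c where c: "has_power_series f c p" by (rule analytic_power_series[OF assms])
  show ?thesis
    using power_series_at[OF power_series_partial(1)[OF power_series_partial(1)[OF c, of j], of i]]
      power_series_at[OF power_series_partial(1)[OF power_series_partial(1)[OF c, of i], of j]]
    by (cases "i = j") (auto simp: fun_upd_twist)
qed

section \<open>Taylor coefficients\<close>

text \<open>
  The value at \<open>\<kappa>\<close> is the coefficient \<open>\<partial>\<^sup>\<kappa>f(p) / \<kappa>!\<close> of the expansion at \<open>p\<close>.
\<close>

definition taylor :: "((real ^ 'i::finite) \<Rightarrow> complex) \<Rightarrow> real ^ 'i \<Rightarrow> 'i midx \<Rightarrow> complex" where
  "taylor f p = (THE c. has_power_series f c p)"

lemma taylor_eqI: "has_power_series f c p \<Longrightarrow> taylor f p = c"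
  unfolding taylor_def by (rule the_equality) (auto intro: power_series_unique)

lemma power_series_taylor: "real_analytic_at f p \<Longrightarrow> has_power_series f (taylor f p) p"
  by (erule analytic_power_series) (simp add: taylor_eqI)

lemma taylor_zero: "real_analytic_at f p \<Longrightarrow> taylor f p (\<lambda>i. 0) = f p"
  by (metis power_series_at power_series_taylor)

lemma taylor_cong: "near_eq p f g \<Longrightarrow> real_analytic_at f p \<Longrightarrow> taylor f p = taylor g p"
  by (metis near_eq_def power_series_cong power_series_taylor taylor_eqI)

lemma taylor_add: "real_analytic_at f p \<Longrightarrow> real_analytic_at g p \<Longrightarrow> taylor (\<lambda>y. f y + g y) p \<kappa> = taylor f p \<kappa> + taylor g p \<kappa>"
  by (simp add: taylor_eqI[OF power_series_add[OF power_series_taylor power_series_taylor]])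

lemma taylor_mult: "real_analytic_at f p \<Longrightarrow> real_analytic_at g p \<Longrightarrow> taylor (\<lambda>y. f y * g y) p = cauchy_product (taylor f p) (taylor g p)"
  by (simp add: taylor_eqI[OF power_series_mult[OF power_series_taylor power_series_taylor]])

lemma taylor_const: "taylor (\<lambda>y. a) p \<kappa> = (if \<kappa> = (\<lambda>i. 0) then a else 0)"
  by (simp add: taylor_eqI[OF power_series_const])

lemma taylor_cmult: "real_analytic_at f p \<Longrightarrow> taylor (\<lambda>y. a * f y) p \<kappa> = a * taylor f p \<kappa>"
proof -
  assume f: "real_analytic_at f p"
  have "taylor (\<lambda>y. a * f y) p \<kappa> = cauchy_product (taylor (\<lambda>y. a) p) (taylor f p) \<kappa>" by (simp add: taylor_mult f)
  also have "\<dots> = (\<Sum>\<mu> | \<forall>i. \<mu> i \<le> \<kappa> i. if \<mu> = (\<lambda>i. 0) then a * taylor f p \<kappa> else 0)"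
    unfolding cauchy_product_def by (rule sum.cong) (auto simp: taylor_const)
  also have "\<dots> = a * taylor f p \<kappa>" by (subst sum.delta[OF finite_box]) simp
  finally show ?thesis .
qed

lemma taylor_sum:
  "(\<And>k. k \<in> K \<Longrightarrow> real_analytic_at (f k) p) \<Longrightarrow> taylor (\<lambda>y. \<Sum>k\<in>K. f k y) p \<kappa> = (\<Sum>k\<in>K. taylor (f k) p \<kappa>)"
  by (induction K rule: infinite_finite_induct) (auto simp: taylor_add taylor_const analytic_sum)

lemma taylor_partial: "real_analytic_at f p \<Longrightarrow> taylor (partial i f) p \<kappa> = of_nat (Suc (\<kappa> i)) * taylor f p (up i \<kappa>)"
  by (simp add: taylor_eqI[OF power_series_partial(1)[OF power_series_taylor]])

lemma taylor_coord_mult: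
  assumes f: "real_analytic_at f p" and p: "p $ i = 0"
  shows "taylor (\<lambda>y. of_real (y $ i) * f y) p \<kappa> = (if \<kappa> i = 0 then 0 else taylor f p (\<kappa>(i := \<kappa> i - 1)))"
proof -
  let ?e = "up i (\<lambda>i. 0)"
  have ne: "?e \<noteq> (\<lambda>i. 0)" by (metis fun_upd_same nat.distinct(1))
  have "taylor (\<lambda>y. of_real (y $ i) * f y) p \<kappa>
      = (\<Sum>\<mu> | \<forall>j. \<mu> j \<le> \<kappa> j. if \<mu> = ?e then taylor f p (\<lambda>j. \<kappa> j - ?e j) else 0)"
    unfolding taylor_mult[OF analytic_coord f] cauchy_product_def
    by (rule sum.cong) (auto simp: taylor_eqI[OF power_series_coord] p ne simp del: fun_upd_apply)
  also have "\<dots> = (if ?e \<in> {\<mu>. \<forall>j. \<mu> j \<le> \<kappa> j} then taylor f p (\<lambda>j. \<kappa> j - ?e j) else 0)"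
    by (subst sum.delta[OF finite_box]) simp
  also have "\<dots> = (if \<kappa> i = 0 then 0 else taylor f p (\<kappa>(i := \<kappa> i - 1)))"
    by (auto intro!: arg_cong[of _ _ "taylor f p"])
  finally show ?thesis .
qed

lemma taylor_up_fun: "real_analytic_at f p \<Longrightarrow> near_eq p (\<lambda>y. taylor f y (up i \<kappa>)) (\<lambda>y. inverse (of_nat (Suc (\<kappa> i))) * taylor (partial i f) y \<kappa>)"
  unfolding near_eq_def
  by (rule eventually_mono[OF analytic_near]) (auto simp: taylor_partial simp del: of_nat_Suc)

lemma analytic_taylor: "real_analytic_at f p \<Longrightarrow> real_analytic_at (\<lambda>y. taylor f y \<kappa>) p"
proof (induction \<kappa> arbitrary: f rule: midx_induct)
  case zero
  have "near_eq p f (\<lambda>y. taylor f y (\<lambda>i. 0))"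
    unfolding near_eq_def by (rule eventually_mono[OF analytic_near[OF zero]]) (simp add: taylor_zero)
  then show ?case using zero by (rule analytic_cong)
next
  case (up i \<kappa>)
  show ?case
    by (rule analytic_cong[OF near_eq_sym[OF taylor_up_fun[OF up(2)]]])
      (intro analytic_mult analytic_const up(1) analytic_partial up(2))
qed

text \<open>
  Up to a factorial a Taylor coefficient is an iterated partial derivative of \<open>f\<close>, and partial
  derivatives commute.
\<close>

lemma partial_taylor: "real_analytic_at f p \<Longrightarrow> partial i (\<lambda>y. taylor f y \<kappa>) p = taylor (partial i f) p \<kappa>"
proof (induction \<kappa> arbitrary: f rule: midx_induct)
  case zero
  have "near_eq p (\<lambda>y. taylor f y (\<lambda>i. 0)) f"
    unfolding near_eq_def by (rule eventually_mono[OF analytic_near[OF zero]]) (simp add: taylor_zero)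
  from partial_cong[OF this] show ?case by (simp add: taylor_zero analytic_partial zero)
next
  case (up j \<kappa>)
  have "near_eq p (partial i (partial j f)) (partial j (partial i f))"
    unfolding near_eq_def by (rule eventually_mono[OF analytic_near[OF up(2)]]) (rule partial_comm)
  from taylor_cong[OF this] have c: "taylor (partial i (partial j f)) p = taylor (partial j (partial i f)) p"
    by (simp add: analytic_partial up(2))
  have "partial i (\<lambda>y. taylor f y (up j \<kappa>)) p = inverse (of_nat (Suc (\<kappa> j))) * taylor (partial i (partial j f)) p \<kappa>"
    by (simp add: partial_cong[OF taylor_up_fun[OF up(2)]] partial_cmult analytic_taylor analytic_partial up del: of_nat_Suc)
  also have "\<dots> = taylor (partial i f) p (up j \<kappa>)"
    unfolding c by (simp add: taylor_partial analytic_partial up(2) del: of_nat_Suc)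
  finally show ?case .
qed

lemma near_eq_zero_if_taylor: assumes "real_analytic_at f p" "\<And>\<kappa>. taylor f p \<kappa> = 0" shows "near_eq p f (\<lambda>y. 0)"
  unfolding near_eq_def
proof (rule eventually_mono[OF power_series_taylor[OF assms(1), unfolded has_power_series_def]])
  fix y assume "((\<lambda>\<kappa>. taylor f p \<kappa> * mpow \<kappa> (\<lambda>i. complex_of_real (y $ i - p $ i))) has_sum f y) UNIV"
  then show "f y = 0" unfolding assms(2) by (simp add: has_sum_iff)
qed

section \<open>Iterated derivations\<close>

text \<open>
  The enumeration of the indices that \<open>iter_der\<close> uses.
\<close>

definition index_list :: "'i::finite list" where
  "index_list = (SOME is. distinct is \<and> set is = UNIV)"

lemma index_list: "distinct (index_list :: 'i::finite list)" "set (index_list :: 'i list) = UNIV"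
proof -
  have "\<exists>is::'i list. distinct is \<and> set is = UNIV"
    using finite_distinct_list[of "UNIV :: 'i set"] by auto
  from someI_ex[OF this] show "distinct (index_list :: 'i list)" "set (index_list :: 'i list) = UNIV"
    unfolding index_list_def by auto
qed

lemma iter_der_index_list: "iter_der \<delta> \<kappa> u = foldr (\<lambda>i. \<delta> i ^^ \<kappa> i) index_list u"
  by (simp add: iter_der_def index_list_def)

text \<open>
  A two-sided induction principle along the construction of \<open>iter_der\<close>: \<open>\<mu>\<close> counts the
  derivations applied so far, and the two iterations with \<open>\<delta>\<close> and \<open>\<delta>'\<close> run in parallel.
\<close>

lemma iter_der_count:
  fixes \<kappa> :: "'i::finite midx"
  assumes "Q (\<lambda>i. 0) u v"
    and step: "\<And>i \<mu> u v. \<mu> i < \<kappa> i \<Longrightarrow> Q \<mu> u v \<Longrightarrow> Q (up i \<mu>) (\<delta> i u) (\<delta>' i v)"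
  shows "Q \<kappa> (iter_der \<delta> \<kappa> u) (iter_der \<delta>' \<kappa> v)"
proof -
  have pow: "Q (\<mu>(i := n)) ((\<delta> i ^^ n) u) ((\<delta>' i ^^ n) v)" if "Q \<mu> u v" "\<mu> i = 0" "n \<le> \<kappa> i" for \<mu> i u v n
    using that(3)
  proof (induction n)
    case 0
    then show ?case using that by (simp add: fun_upd_idem)
  next
    case (Suc n)
    then have "Q (\<mu>(i := n)) ((\<delta> i ^^ n) u) ((\<delta>' i ^^ n) v)" by (simp del: fun_upd_apply)
    from step[OF _ this, of i] Suc(2) show ?case by (simp del: fun_upd_apply add: fun_upd_same)
  qed
  have "distinct is \<Longrightarrow> Q (\<lambda>i. if i \<in> set is then \<kappa> i else 0)
      (foldr (\<lambda>i. \<delta> i ^^ \<kappa> i) is u) (foldr (\<lambda>i. \<delta>' i ^^ \<kappa> i) is v)" for "is"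
  proof (induction "is")
    case Nil
    then show ?case using assms(1) by simp
  next
    case (Cons j js)
    have "(\<lambda>i. if i \<in> set (j # js) then \<kappa> i else 0) = (\<lambda>i. if i \<in> set js then \<kappa> i else 0)(j := \<kappa> j)"
      by auto
    then show ?case using pow[of "\<lambda>i. if i \<in> set js then \<kappa> i else 0" _ _ j "\<kappa> j"] Cons by simp
  qed
  from this[of index_list] show ?thesis by (simp add: index_list iter_der_index_list)
qed

lemma iter_der_rel:
  assumes "R u v" "\<And>i u v. \<kappa> i \<noteq> 0 \<Longrightarrow> R u v \<Longrightarrow> R (\<delta> i u) (\<delta>' i v)"
  shows "R (iter_der \<delta> \<kappa> u) (iter_der \<delta>' \<kappa> v)"
  by (rule iter_der_count[of "\<lambda>_. R"]) (use assms in auto)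

lemma iter_der_count_unary:
  assumes "Q (\<lambda>i. 0) u" "\<And>i \<mu> u. \<mu> i < \<kappa> i \<Longrightarrow> Q \<mu> u \<Longrightarrow> Q (up i \<mu>) (\<delta> i u)"
  shows "Q \<kappa> (iter_der \<delta> \<kappa> u)"
  using iter_der_count[of "\<lambda>\<mu> u v. Q \<mu> u" u u \<kappa> \<delta> \<delta>] assms by blast

lemma iter_der_induct:
  assumes "R u" "\<And>i u. \<kappa> i \<noteq> 0 \<Longrightarrow> R u \<Longrightarrow> R (\<delta> i u)" shows "R (iter_der \<delta> \<kappa> u)"
  using iter_der_rel[of "\<lambda>u v. R u" u u \<kappa> \<delta> \<delta>] assms by blast

lemma iter_der_zero [simp]: "iter_der \<delta> (\<lambda>i. 0) u = u"
proof -
  have "foldr (\<lambda>i. \<delta> i ^^ 0) is u = u" for "is" by (induction "is") auto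
  then show ?thesis by (simp add: iter_der_index_list)
qed

text \<open>
  The derivations need to commute only up to a congruence \<open>E\<close>; for functions, \<open>E\<close> is equality near
  a point.
\<close>

lemma iter_der_up:
  assumes "P u" and P: "\<And>i u. P u \<Longrightarrow> P (\<delta> i u)"
    and E: "\<And>u. E u u" "\<And>u v w. E u v \<Longrightarrow> E v w \<Longrightarrow> E u w" "\<And>i u v. E u v \<Longrightarrow> E (\<delta> i u) (\<delta> i v)"
    and comm: "\<And>j u. P u \<Longrightarrow> E (\<delta> j (\<delta> i u)) (\<delta> i (\<delta> j u))"
  shows "E (iter_der \<delta> (up i \<kappa>) u) (\<delta> i (iter_der \<delta> \<kappa> u))"
proof -
  let ?f = "\<lambda>\<kappa> is. foldr (\<lambda>i. \<delta> i ^^ \<kappa> i) is u"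
  have Pp: "P u \<Longrightarrow> P ((\<delta> j ^^ n) u)" for j n u by (induction n) (auto intro: P)
  have Pf: "P (?f \<kappa> is)" for "is" by (induction "is") (auto intro: Pp assms(1))
  have Ep: "E u v \<Longrightarrow> E ((\<delta> j ^^ n) u) ((\<delta> j ^^ n) v)" for j n u v by (induction n) (auto intro: E(3))
  have cp: "P u \<Longrightarrow> E ((\<delta> j ^^ n) (\<delta> i u)) (\<delta> i ((\<delta> j ^^ n) u))" for j n u
  proof (induction n)
    case 0
    then show ?case by (simp add: E(1))
  next
    case (Suc n)
    then have "E (\<delta> j ((\<delta> j ^^ n) (\<delta> i u))) (\<delta> j (\<delta> i ((\<delta> j ^^ n) u)))" by (intro E(3)) simp
    then show ?case using comm[OF Pp[OF Suc(2)]] E(2) by simp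
  qed
  have out: "i \<notin> set is \<Longrightarrow> ?f (up i \<kappa>) is = ?f \<kappa> is" for "is"
    by (induction "is") auto
  have "distinct is \<Longrightarrow> i \<in> set is \<Longrightarrow> E (?f (up i \<kappa>) is) (\<delta> i (?f \<kappa> is))" for "is"
  proof (induction "is")
    case (Cons j js)
    show ?case
    proof (cases "j = i")
      case True
      then show ?thesis using Cons out[of js] by (simp add: E(1))
    next
      case False
      then have "E (?f (up i \<kappa>) js) (\<delta> i (?f \<kappa> js))" using Cons by auto
      from E(2)[OF Ep[OF this, where j = j and n = "\<kappa> j"] cp[OF Pf]] False show ?thesis by simp
    qed
  qed simp
  from this[of index_list] show ?thesis by (simp add: index_list iter_der_index_list del: fun_upd_apply)
qed

section \<open>Twisted derivations\<close>

text \<open>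
  Let \<open>\<delta>\<^sub>i\<close> be \<open>t\<^sub>i \<partial>/\<partial>t\<^sub>i\<close> for \<open>i \<in> T\<close> and \<open>\<partial>/\<partial>x\<^sub>i\<close> otherwise. If \<open>\<delta>\<^sub>i u = l\<^sub>i u\<close> for all
  \<open>i\<close>, then conjugation by \<open>u\<close> turns \<open>\<delta>\<^sub>i\<close> into \<open>\<delta>\<^sub>i + l\<^sub>i\<close>. The untwisted case is \<open>l = 0\<close>.
\<close>

definition twisted_der :: "'i set \<Rightarrow> ('i \<Rightarrow> complex) \<Rightarrow> 'i \<Rightarrow> ((real ^ 'i::finite) \<Rightarrow> complex) \<Rightarrow> (real ^ 'i) \<Rightarrow> complex" where
  "twisted_der T l i f = (\<lambda>y. (if i \<in> T then of_real (y $ i) else 1) * partial i f y + l i * f y)"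

lemma analytic_fac [simp]: "real_analytic_at (\<lambda>y. if i \<in> T then complex_of_real (y $ i) else 1) p"
  by (cases "i \<in> T") auto

lemma analytic_twisted: "real_analytic_at f p \<Longrightarrow> real_analytic_at (twisted_der T l i f) p"
  unfolding twisted_der_def by (intro analytic_add analytic_mult analytic_partial analytic_const analytic_fac)

lemma analytic_iter: "real_analytic_at f p \<Longrightarrow> real_analytic_at (iter_der (twisted_der T l) \<kappa> f) p"
  by (rule iter_der_induct[of "\<lambda>u. real_analytic_at u p"]) (auto intro: analytic_twisted)

lemma twisted_cong: assumes "near_eq p f g" shows "near_eq p (twisted_der T l i f) (twisted_der T l i g)"
  unfolding near_eq_def[of p "twisted_der T l i f"]
  by (rule eventually_mono[OF near_eq_near[OF assms]])
     (simp add: twisted_der_def partial_cong[of _ f g] near_eq_at[of _ f g])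

lemma twisted_sum: "(\<And>k. k \<in> K \<Longrightarrow> real_analytic_at (f k) p) \<Longrightarrow> twisted_der T l i (\<lambda>y. \<Sum>k\<in>K. f k y) p = (\<Sum>k\<in>K. twisted_der T l i (f k) p)"
  by (simp add: twisted_der_def partial_sum sum.distrib sum_distrib_left)

lemma twisted_cmult: "real_analytic_at f p \<Longrightarrow> twisted_der T l i (\<lambda>y. a * f y) p = a * twisted_der T l i f p"
  by (simp add: twisted_der_def partial_cmult algebra_simps)

lemma twisted_mult: "real_analytic_at f p \<Longrightarrow> real_analytic_at g p \<Longrightarrow>
    twisted_der T l i (\<lambda>y. f y * g y) p = twisted_der T (\<lambda>_. 0) i f p * g p + f p * twisted_der T l i g p"
  by (simp add: twisted_der_def partial_mult algebra_simps)

lemma twisted_comm: assumes "real_analytic_at f p" shows "near_eq p (twisted_der T l i (twisted_der T l j f)) (twisted_der T l j (twisted_der T l i f))"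
  unfolding near_eq_def
proof (rule eventually_mono[OF analytic_near[OF assms]])
  fix q assume f: "real_analytic_at f q"
  have p: "partial i (twisted_der T l j f) q = (if j \<in> T then of_real (q $ j) else 1) * partial i (partial j f) q
      + (if j \<in> T \<and> i = j then partial j f q else 0) + l j * partial i f q" for i j
  proof -
    have "partial i (\<lambda>y. if j \<in> T then complex_of_real (y $ j) else 1) q = (if j \<in> T \<and> i = j then 1 else 0)"
      by (cases "j \<in> T") (auto simp: partial_coord)
    then show ?thesis unfolding twisted_der_def
      by (subst partial_add) (auto simp: partial_mult partial_cmult f analytic_partial intro!: analytic_mult)
  qed
  show "twisted_der T l i (twisted_der T l j f) q = twisted_der T l j (twisted_der T l i f) q"
    unfolding twisted_der_def[of T l i "twisted_der T l j f"] twisted_der_def[of T l j "twisted_der T l i f"] p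
    using partial_comm[OF f, of i j] by (auto simp: twisted_der_def algebra_simps)
qed

lemma iter_twisted_up: "real_analytic_at f p \<Longrightarrow> near_eq p (iter_der (twisted_der T l) (up i \<kappa>) f) (twisted_der T l i (iter_der (twisted_der T l) \<kappa> f))"
  by (rule iter_der_up[of "\<lambda>u. real_analytic_at u p"]) (erule near_eq_trans, assumption | simp add: analytic_twisted twisted_cong twisted_comm del: fun_upd_apply)+

lemma iter_der_pointwise: "iter_der (\<lambda>i F k. \<delta> i (F k)) \<kappa> F k = iter_der \<delta> \<kappa> (F k)"
  by (rule iter_der_rel[of "\<lambda>F u. F k = u"]) auto

lemma iter_lin:
  assumes "\<And>k. k \<in> K \<Longrightarrow> real_analytic_at (f k) p"
  shows "near_eq p (iter_der (twisted_der T l) \<kappa> (\<lambda>y. \<Sum>k\<in>K. a k * f k y)) (\<lambda>y. \<Sum>k\<in>K. a k * iter_der (twisted_der T l) \<kappa> (f k) y)"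
proof -
  let ?R = "\<lambda>u F. (\<forall>k\<in>K. real_analytic_at (F k) p) \<and> near_eq p u (\<lambda>y. \<Sum>k\<in>K. a k * F k y)"
  have "?R (iter_der (twisted_der T l) \<kappa> (\<lambda>y. \<Sum>k\<in>K. a k * f k y)) (iter_der (\<lambda>i F k. twisted_der T l i (F k)) \<kappa> f)"
  proof (rule iter_der_rel[of ?R])
    fix i u F assume R: "?R u F"
    have "near_eq p (twisted_der T l i (\<lambda>y. \<Sum>k\<in>K. a k * F k y)) (\<lambda>y. \<Sum>k\<in>K. a k * twisted_der T l i (F k) y)"
    proof -
      have "\<forall>\<^sub>F q in nhds p. \<forall>k\<in>K. real_analytic_at (F k) q" if "finite K"
        using R that by (intro eventually_ball_finite) (auto intro: analytic_near)
      then have "\<forall>\<^sub>F q in nhds p. \<forall>k\<in>K. finite K \<longrightarrow> real_analytic_at (F k) q"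
        by (cases "finite K") auto
      then show ?thesis unfolding near_eq_def
      proof eventually_elim
        case (elim q)
        then show ?case
        proof (cases "finite K")
          case True
          then show ?thesis using elim by (subst twisted_sum) (auto intro!: analytic_mult sum.cong simp: twisted_cmult)
        qed (simp add: twisted_der_def)
      qed
    qed
    with R show "?R (twisted_der T l i u) (\<lambda>k. twisted_der T l i (F k))"
      by (auto intro: analytic_twisted elim!: near_eq_trans[OF twisted_cong])
  qed (use assms in auto)
  then show ?thesis by (simp add: iter_der_pointwise)
qed

section \<open>Analytic functions along the normal crossing\<close>

text \<open>
  The second assumption says that \<open>N\<close> is open in the linear subspace \<open>{t = 0}\<close>.
\<close>

locale crossing =
  fixes N :: "(real ^ 'i::finite) set" and T :: "'i set"
  assumes N_T: "\<And>y i. y \<in> N \<Longrightarrow> i \<in> T \<Longrightarrow> y $ i = 0"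
    and N_open: "\<And>y. y \<in> N \<Longrightarrow> \<forall>\<^sub>F z in nhds y. (\<forall>i\<in>T. z $ i = 0) \<longrightarrow> z \<in> N"
begin

text \<open>
  Near \<open>y\<close> the line through \<open>y\<close> in direction \<open>i \<notin> T\<close> stays inside \<open>N\<close>.
\<close>

lemma partial_N_cong_near:
  assumes y: "y \<in> N" and i: "i \<notin> T" and uv: "\<forall>\<^sub>F z in nhds y. z \<in> N \<longrightarrow> u z = v z"
  shows "partial i u y = partial i v y"
  unfolding partial_def
proof (rule vector_derivative_cong_eq)
  have "((\<lambda>s::real. y + s *\<^sub>R axis i 1) \<longlongrightarrow> y + 0 *\<^sub>R axis i 1) (nhds 0)"
    by (intro tendsto_intros filterlim_ident)
  moreover have "\<forall>\<^sub>F z in nhds y. (\<forall>i\<in>T. z $ i = 0) \<longrightarrow> u z = v z"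
    using uv N_open[OF y] by eventually_elim blast
  ultimately have "\<forall>\<^sub>F s::real in nhds 0. (\<forall>j\<in>T. (y + s *\<^sub>R axis i 1) $ j = 0) \<longrightarrow> u (y + s *\<^sub>R axis i 1) = v (y + s *\<^sub>R axis i 1)"
    unfolding filterlim_iff by auto
  then show "\<forall>\<^sub>F s in nhds 0. s \<in> UNIV \<longrightarrow> u (y + s *\<^sub>R axis i 1) = v (y + s *\<^sub>R axis i 1)"
    by (rule eventually_mono) (use i N_T[OF y] in \<open>auto simp: axis_def\<close>)
qed auto

lemma partial_N_cong:
  "y \<in> N \<Longrightarrow> i \<notin> T \<Longrightarrow> (\<And>z. z \<in> N \<Longrightarrow> u z = v z) \<Longrightarrow> partial i u y = partial i v y"
  by (rule partial_N_cong_near) auto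

text \<open>
  The factor \<open>t\<^sub>i\<close> vanishes on \<open>N\<close>, so in the \<open>t\<close>-directions only the scalar \<open>l\<^sub>i\<close> remains.
\<close>

lemma twisted_on_N:
  "y \<in> N \<Longrightarrow> twisted_der T l i f y = (if i \<in> T then l i * f y else partial i f y + l i * f y)"
  by (simp add: twisted_der_def N_T)

lemma twisted_N_cong:
  assumes "\<And>z. z \<in> N \<Longrightarrow> u z = v z" "y \<in> N" shows "twisted_der T l i u y = twisted_der T l i v y"
  using assms partial_N_cong[of y i u v] by (simp add: twisted_on_N)

lemma iter_N_cong:
  assumes "\<And>z. z \<in> N \<Longrightarrow> u z = v z" "y \<in> N"
  shows "iter_der (twisted_der T l) \<kappa> u y = iter_der (twisted_der T l) \<kappa> v y"
proof -
  have "\<forall>y\<in>N. iter_der (twisted_der T l) \<kappa> u y = iter_der (twisted_der T l) \<kappa> v y"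
    by (rule iter_der_rel[of "\<lambda>u v. \<forall>y\<in>N. u y = v y"])
       (intro ballI twisted_N_cong | simp add: assms)+
  then show ?thesis using assms by blast
qed

lemma iter_N_zero: assumes "\<And>z. z \<in> N \<Longrightarrow> u z = 0" "y \<in> N" shows "iter_der (twisted_der T l) \<kappa> u y = 0"
proof -
  have "iter_der (twisted_der T l) \<kappa> u y = iter_der (twisted_der T l) \<kappa> (\<lambda>_. 0) y"
    using assms by (intro iter_N_cong) auto
  also have "iter_der (twisted_der T l) \<kappa> (\<lambda>_. 0) = (\<lambda>_. 0)"
    by (rule iter_der_induct[of "\<lambda>u. u = (\<lambda>_. 0)"]) (auto simp: twisted_der_def)
  finally show ?thesis by simp
qed

lemma iter_N_split:
  assumes f: "\<And>y. y \<in> N \<Longrightarrow> real_analytic_at f y" and y: "y \<in> N"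
  shows "iter_der (twisted_der T l) \<kappa> f y
    = (\<Prod>i\<in>T. l i ^ \<kappa> i) * iter_der (twisted_der T l) (\<lambda>i. if i \<in> T then 0 else \<kappa> i) f y"
proof -
  let ?\<delta> = "\<lambda>i. if i \<in> T then id else twisted_der T l i"
  let ?Q = "\<lambda>\<mu> u v. (\<forall>y\<in>N. real_analytic_at v y) \<and> (\<forall>y\<in>N. u y = (\<Prod>i\<in>T. l i ^ \<mu> i) * v y)"
  have "?Q \<kappa> (iter_der (twisted_der T l) \<kappa> f) (iter_der ?\<delta> \<kappa> f)"
  proof (rule iter_der_count[of ?Q])
    fix i \<mu> u v assume Q: "?Q \<mu> u v"
    show "?Q (up i \<mu>) (twisted_der T l i u) (?\<delta> i v)"
    proof (cases "i \<in> T")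
      case True
      have "(\<Prod>j\<in>T. l j ^ up i \<mu> j) = l i * (\<Prod>j\<in>T. l j ^ \<mu> j)"
        using True by (simp add: prod.remove[of _ i] mult.assoc)
      then show ?thesis using True Q by (simp add: twisted_on_N del: fun_upd_apply)
    next
      case False
      have 1: "(\<Prod>j\<in>T. l j ^ up i \<mu> j) = (\<Prod>j\<in>T. l j ^ \<mu> j)"
        using False by (intro prod.cong) auto
      have "partial i u y = (\<Prod>j\<in>T. l j ^ \<mu> j) * partial i v y" if "y \<in> N" for y
        using partial_N_cong[OF that False, of u "\<lambda>y. (\<Prod>j\<in>T. l j ^ \<mu> j) * v y"] Q that
        by (simp add: partial_cmult)
      then show ?thesis unfolding 1 using False Q
        by (simp add: twisted_on_N analytic_twisted distrib_left del: fun_upd_apply)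
    qed
  qed (use f in auto)
  moreover have "iter_der ?\<delta> \<kappa> f = iter_der (twisted_der T l) (\<lambda>i. if i \<in> T then 0 else \<kappa> i) f"
  proof -
    have "foldr (\<lambda>i. ?\<delta> i ^^ \<kappa> i) is f = foldr (\<lambda>i. twisted_der T l i ^^ (if i \<in> T then 0 else \<kappa> i)) is f" for "is"
      by (induction "is") (auto simp: id_funpow)
    then show ?thesis by (simp add: iter_der_index_list)
  qed
  ultimately show ?thesis using y by simp
qed

text \<open>
  Taking the coefficient of \<open>t\<^sup>\<gamma>\<close> turns \<open>t\<^sub>i \<partial>/\<partial>t\<^sub>i\<close> into \<open>\<gamma>\<^sub>i\<close> and commutes with the
  \<open>x\<close>-derivatives. It thus adds \<open>\<gamma>\<close> to the twist.
\<close>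

lemma taylor_iter:
  assumes g: "\<And>y. y \<in> N \<Longrightarrow> real_analytic_at g y" and \<gamma>: "supported T \<gamma>" and y: "y \<in> N"
  shows "taylor (iter_der (twisted_der T l) \<kappa> g) y \<gamma> = iter_der (twisted_der T (\<lambda>i. l i + of_nat (\<gamma> i))) \<kappa> (\<lambda>y. taylor g y \<gamma>) y"
proof -
  let ?l = "\<lambda>i. l i + of_nat (\<gamma> i)"
  let ?R = "\<lambda>g h. (\<forall>y\<in>N. real_analytic_at g y) \<and> (\<forall>y\<in>N. taylor g y \<gamma> = h y)"
  have "?R (iter_der (twisted_der T l) \<kappa> g) (iter_der (twisted_der T ?l) \<kappa> (\<lambda>y. taylor g y \<gamma>))"
  proof (rule iter_der_rel[of ?R])
    fix i g h assume R: "?R g h"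
    have "taylor (twisted_der T l i g) y \<gamma> = twisted_der T ?l i h y" if y: "y \<in> N" for y
    proof -
      have gy: "real_analytic_at g y" and gh: "taylor g y \<gamma> = h y" using R y by auto
      show ?thesis
      proof (cases "i \<in> T")
        case True
        have "taylor (twisted_der T l i g) y \<gamma> = taylor (\<lambda>y. of_real (y $ i) * partial i g y) y \<gamma> + l i * taylor g y \<gamma>"
          unfolding twisted_der_def using True
          by (simp add: taylor_add taylor_cmult analytic_mult analytic_partial gy)
        also have "taylor (\<lambda>y. of_real (y $ i) * partial i g y) y \<gamma> = of_nat (\<gamma> i) * taylor g y \<gamma>"
          by (simp add: taylor_coord_mult[OF analytic_partial[OF gy] N_T[OF y True]] taylor_partial gy fun_upd_idem del: of_nat_Suc)
        finally show ?thesis using True y gh by (simp add: twisted_on_N distrib_right)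
      next
        case False
        have "partial i h y = partial i (\<lambda>y. taylor g y \<gamma>) y"
          using R by (intro partial_N_cong[OF y False]) auto
        also have "\<dots> = taylor (partial i g) y \<gamma>" by (rule partial_taylor[OF gy])
        finally have 1: "partial i h y = taylor (partial i g) y \<gamma>" .
        have "taylor (twisted_der T l i g) y \<gamma> = taylor (partial i g) y \<gamma> + l i * taylor g y \<gamma>"
          unfolding twisted_der_def using False
          by (simp add: taylor_add taylor_cmult analytic_mult analytic_partial gy)
        then show ?thesis using False \<gamma> y gh 1 by (simp add: twisted_on_N supported_def)
      qed
    qed
    with R show "?R (twisted_der T l i g) (twisted_der T ?l i h)" by (auto intro: analytic_twisted)
  qed (use g in auto)
  then show ?thesis using y by blast
qed

text \<open>
  On \<open>N\<close> only the monomials in \<open>x\<close> of the expansion at \<open>p \<in> N\<close> survive.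
\<close>

lemma zero_near_iff_taylor:
  assumes p: "p \<in> N" and g: "real_analytic_at g p"
  shows "(\<forall>\<^sub>F z in nhds p. z \<in> N \<longrightarrow> g z = 0) \<longleftrightarrow> (\<forall>\<beta>. supported (- T) \<beta> \<longrightarrow> taylor g p \<beta> = 0)"
proof
  assume *: "\<forall>\<^sub>F z in nhds p. z \<in> N \<longrightarrow> g z = 0"
  have "real_analytic_at g p \<Longrightarrow> (\<forall>\<^sub>F z in nhds p. z \<in> N \<longrightarrow> g z = 0) \<Longrightarrow> supported (- T) \<beta> \<Longrightarrow> taylor g p \<beta> = 0" for \<beta>
  proof (induction \<beta> arbitrary: g rule: midx_induct)
    case zero
    then show ?case using p by (auto simp: taylor_zero dest: eventually_nhds_x_imp_x)
  next
    case (up i \<beta>)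
    have i: "i \<notin> T" and s: "supported (- T) \<beta>"
      using up(4) by (auto simp: supported_def split: if_splits)
    from up(3) have "\<forall>\<^sub>F y in nhds p. \<forall>\<^sub>F z in nhds y. z \<in> N \<longrightarrow> g z = 0" by (simp add: eventually_eventually)
    then have "\<forall>\<^sub>F y in nhds p. y \<in> N \<longrightarrow> partial i g y = 0"
    proof (rule eventually_mono, intro impI)
      fix y assume *: "\<forall>\<^sub>F z in nhds y. z \<in> N \<longrightarrow> g z = 0" and y: "y \<in> N"
      show "partial i g y = 0" using partial_N_cong_near[OF y i, of g "\<lambda>_. 0"] * by simp
    qed
    from up(1)[OF analytic_partial[OF up(2)] this s] taylor_partial[OF up(2), of i \<beta>] show ?case
      by (simp del: of_nat_Suc fun_upd_apply)
  qed
  then show "\<forall>\<beta>. supported (- T) \<beta> \<longrightarrow> taylor g p \<beta> = 0" using g * by blast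
next
  assume *: "\<forall>\<beta>. supported (- T) \<beta> \<longrightarrow> taylor g p \<beta> = 0"
  show "\<forall>\<^sub>F z in nhds p. z \<in> N \<longrightarrow> g z = 0"
  proof (rule eventually_mono[OF power_series_taylor[OF g, unfolded has_power_series_def]], intro impI)
    fix z
    assume S: "((\<lambda>\<kappa>. taylor g p \<kappa> * mpow \<kappa> (\<lambda>i. complex_of_real (z $ i - p $ i))) has_sum g z) UNIV" and z: "z \<in> N"
    have "taylor g p \<kappa> * mpow \<kappa> (\<lambda>i. complex_of_real (z $ i - p $ i)) = 0" for \<kappa>
    proof (cases "supported (- T) \<kappa>")
      case False
      then obtain i where i: "i \<in> T" "\<kappa> i \<noteq> 0" by (auto simp: supported_def)
      have "(\<Prod>i\<in>UNIV. complex_of_real (z $ i - p $ i) ^ \<kappa> i) = 0"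
        using i N_T[OF z, of i] N_T[OF p, of i] by (intro prod_zero) (auto intro!: exI[of _ i])
      then show ?thesis by (simp add: mpow_def)
    qed (use * in simp)
    then have "(\<lambda>\<kappa>. taylor g p \<kappa> * mpow \<kappa> (\<lambda>i. complex_of_real (z $ i - p $ i))) = (\<lambda>_. 0)" by (rule ext)
    from S[unfolded this] show "g z = 0" by (simp add: has_sum_iff)
  qed
qed

text \<open>
  The set of points of \<open>N\<close> near which \<open>g\<close> vanishes on \<open>N\<close> is open in \<open>N\<close>. Its complement is
  open as well, since there some Taylor coefficient in the \<open>x\<close>-directions is nonzero, and Taylor coefficients depend
  continuously on the point.
\<close>

lemma identity_theorem:
  assumes N: "connected N" and g: "\<And>p. p \<in> N \<Longrightarrow> real_analytic_at g p"
    and p: "p \<in> N" "\<forall>\<^sub>F z in nhds p. z \<in> N \<longrightarrow> g z = 0" and y: "y \<in> N"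
  shows "g y = 0"
proof -
  let ?Z = "\<lambda>p. \<forall>\<^sub>F z in nhds p. z \<in> N \<longrightarrow> g z = 0"
  have loc: "\<forall>\<^sub>F z in nhds a. z \<in> N \<longrightarrow> ?Z z = ?Z a" if a: "a \<in> N" for a
  proof (cases "?Z a")
    case True
    then have "\<forall>\<^sub>F z in nhds a. ?Z z" by (simp add: eventually_eventually)
    then show ?thesis by (rule eventually_mono) (use True in simp)
  next
    case False
    then obtain \<beta> where \<beta>: "supported (- T) \<beta>" "taylor g a \<beta> \<noteq> 0"
      unfolding zero_near_iff_taylor[OF a g[OF a]] by auto
    have "\<forall>\<^sub>F z in nhds a. taylor g z \<beta> \<noteq> 0"
      by (rule analytic_nonzero_near) (use \<beta>(2) in \<open>simp_all add: analytic_taylor g a\<close>)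
    then show ?thesis
    proof (rule eventually_mono, intro impI)
      fix z assume t: "taylor g z \<beta> \<noteq> 0" and z: "z \<in> N"
      have "\<not> ?Z z" unfolding zero_near_iff_taylor[OF z g[OF z]] using t \<beta>(1) by auto
      then show "?Z z = ?Z a" using False by simp
    qed
  qed
  have "?Z y"
  proof (rule connected_induction_simple[OF N p(1) y, where P = ?Z, OF p(2)])
    fix a assume a: "a \<in> N"
    obtain S where S: "open S" "a \<in> S" "\<forall>z\<in>S. z \<in> N \<longrightarrow> ?Z z = ?Z a"
      using eventually_nhds[THEN iffD1, OF loc[OF a]] by (elim exE conjE)
    show "\<exists>S. openin (top_of_set N) S \<and> a \<in> S \<and> (\<forall>x\<in>S. \<forall>y\<in>S. ?Z x \<longrightarrow> ?Z y)"
    proof (intro exI[of _ "N \<inter> S"] conjI ballI)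
      show "openin (top_of_set N) (N \<inter> S)" using S(1) by (rule openin_open_Int)
      fix x y assume "x \<in> N \<inter> S" "y \<in> N \<inter> S"
      then have "?Z x = ?Z a" "?Z y = ?Z a" using S(3) by simp_all
      then show "?Z x \<longrightarrow> ?Z y" by simp
    qed (use a S(2) in auto)
  qed
  then show ?thesis using y by (auto dest: eventually_nhds_x_imp_x)
qed

end

section \<open>Polynomial identities\<close>

text \<open>
  Kronecker substitution: for suitable weights \<open>w\<close> the substitution \<open>z\<^sub>i = s\<^bsup>w i\<^esup>\<close> sends the
  monomials with exponents in \<open>K\<close> to different powers of one variable \<open>s\<close>.
\<close>

lemma kronecker:
  fixes K :: "('i::finite midx) set"
  assumes K: "finite K"
  obtains w where "inj_on (\<lambda>\<kappa>. \<Sum>i\<in>UNIV. \<kappa> i * w i) K"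
proof -
  have "\<exists>w. \<forall>\<kappa>\<in>K. \<forall>\<kappa>'\<in>K. (\<Sum>i\<in>J. \<kappa> i * w i) = (\<Sum>i\<in>J. \<kappa>' i * w i) \<longrightarrow> (\<forall>i\<in>J. \<kappa> i = \<kappa>' i)"
    if "finite J" for J :: "'i set"
    using that
  proof (induction J)
    case (insert j J)
    then obtain w where w: "\<And>\<kappa> \<kappa>'. \<kappa> \<in> K \<Longrightarrow> \<kappa>' \<in> K \<Longrightarrow> (\<Sum>i\<in>J. \<kappa> i * w i) = (\<Sum>i\<in>J. \<kappa>' i * w i) \<Longrightarrow> \<forall>i\<in>J. \<kappa> i = \<kappa>' i"
      by blast
    \<comment> \<open>the new weight exceeds all sums over \<open>J\<close>, so the new exponent and the old sum are quotient and remainder\<close>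
    define B where "B = Suc (\<Sum>\<kappa>\<in>K. \<Sum>i\<in>J. \<kappa> i * w i)"
    have B: "(\<Sum>i\<in>J. \<kappa> i * w i) < B" if "\<kappa> \<in> K" for \<kappa>
      unfolding B_def using member_le_sum[OF that _ K, of "\<lambda>\<kappa>. \<Sum>i\<in>J. \<kappa> i * w i"] by simp
    have S: "(\<Sum>i\<in>insert j J. \<kappa> i * (w(j := B)) i) = \<kappa> j * B + (\<Sum>i\<in>J. \<kappa> i * w i)" for \<kappa> :: "'i midx"
    proof -
      have "(\<Sum>i\<in>J. \<kappa> i * (w(j := B)) i) = (\<Sum>i\<in>J. \<kappa> i * w i)"
        using insert.hyps by (intro sum.cong) auto
      then show ?thesis using insert.hyps by simp
    qed
    show ?case
    proof (intro exI[of _ "w(j := B)"] ballI impI)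
      fix \<kappa> \<kappa>' i assume k: "\<kappa> \<in> K" "\<kappa>' \<in> K"
        and "(\<Sum>i\<in>insert j J. \<kappa> i * (w(j := B)) i) = (\<Sum>i\<in>insert j J. \<kappa>' i * (w(j := B)) i)"
        and i: "i \<in> insert j J"
      then have e: "\<kappa> j * B + (\<Sum>i\<in>J. \<kappa> i * w i) = \<kappa>' j * B + (\<Sum>i\<in>J. \<kappa>' i * w i)" unfolding S by simp
      have "\<kappa> j = \<kappa>' j" using arg_cong[OF e, of "\<lambda>x. x div B"] B[OF k(1)] B[OF k(2)] by simp
      moreover have "\<forall>i\<in>J. \<kappa> i = \<kappa>' i"
        by (rule w[OF k]) (use arg_cong[OF e, of "\<lambda>x. x mod B"] B[OF k(1)] B[OF k(2)] in simp)
      ultimately show "\<kappa> i = \<kappa>' i" using i by auto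
    qed
  qed auto
  from this[of UNIV] obtain w where
    "\<forall>\<kappa>\<in>K. \<forall>\<kappa>'\<in>K. (\<Sum>i\<in>UNIV. \<kappa> i * w i) = (\<Sum>i\<in>UNIV. \<kappa>' i * w i) \<longrightarrow> (\<forall>i. \<kappa> i = \<kappa>' i)"
    by auto
  then have "inj_on (\<lambda>\<kappa>. \<Sum>i\<in>UNIV. \<kappa> i * w i) K" by (auto simp: inj_on_def)
  then show ?thesis by (rule that)
qed

lemma mpow_powers: "mpow \<kappa> (\<lambda>i. s ^ w i) = s ^ (\<Sum>i\<in>UNIV. \<kappa> i * w i)"
  by (simp add: mpow_def power_sum power_mult mult.commute flip: power_mult)

definition kronecker_poly :: "('i::finite \<Rightarrow> nat) \<Rightarrow> 'i midx set \<Rightarrow> ('i midx \<Rightarrow> complex) \<Rightarrow> complex poly" where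
  "kronecker_poly w K c = (\<Sum>\<kappa>\<in>K. Polynomial.monom (c \<kappa>) (\<Sum>i\<in>UNIV. \<kappa> i * w i))"

lemma poly_kronecker_poly: "poly (kronecker_poly w K c) s = (\<Sum>\<kappa>\<in>K. c \<kappa> * mpow \<kappa> (\<lambda>i. s ^ w i))"
  by (simp add: kronecker_poly_def poly_sum poly_monom mpow_powers)

lemma kronecker_poly_zero_iff:
  assumes K: "finite K" "K \<subseteq> L" and w: "inj_on (\<lambda>\<kappa>. \<Sum>i\<in>UNIV. \<kappa> i * w i) L"
  shows "kronecker_poly w K c = 0 \<longleftrightarrow> (\<forall>\<kappa>\<in>K. c \<kappa> = 0)"
proof -
  have "coeff (kronecker_poly w K c) (\<Sum>i\<in>UNIV. \<kappa> i * w i) = c \<kappa>" if \<kappa>: "\<kappa> \<in> K" for \<kappa>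
  proof -
    have "coeff (kronecker_poly w K c) (\<Sum>i\<in>UNIV. \<kappa> i * w i) = (\<Sum>\<mu>\<in>K. if \<mu> = \<kappa> then c \<mu> else 0)"
      unfolding kronecker_poly_def coeff_sum coeff_monom
    proof (rule sum.cong[OF refl])
      fix \<mu> assume "\<mu> \<in> K"
      then have "(\<Sum>i\<in>UNIV. \<mu> i * w i) = (\<Sum>i\<in>UNIV. \<kappa> i * w i) \<longleftrightarrow> \<mu> = \<kappa>"
        using inj_on_eq_iff[OF inj_on_subset[OF w K(2)], of \<mu> \<kappa>] \<kappa> by simp
      then show "(if (\<Sum>i\<in>UNIV. \<mu> i * w i) = (\<Sum>i\<in>UNIV. \<kappa> i * w i) then c \<mu> else 0) = (if \<mu> = \<kappa> then c \<mu> else 0)"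
        by simp
    qed
    then show ?thesis using \<kappa> K(1) by simp
  qed
  then show ?thesis by (auto simp: kronecker_poly_def)
qed

text \<open>
  The substitution \<open>z\<^sub>i = s\<^bsup>w i\<^esup>\<close> with natural \<open>s\<close> produces a polynomial in one variable with
  infinitely many zeros.
\<close>

lemma poly_coeffs_zero:
  fixes c :: "'i::finite midx \<Rightarrow> complex"
  assumes K: "finite K" and z: "\<And>n. (\<Sum>\<kappa>\<in>K. c \<kappa> * mpow \<kappa> (\<lambda>i. of_nat (n i))) = 0" and \<kappa>: "\<kappa> \<in> K"
  shows "c \<kappa> = 0"
proof -
  obtain w where w: "inj_on (\<lambda>\<kappa>. \<Sum>i\<in>UNIV. \<kappa> i * w i) K" by (rule kronecker[OF K])
  have "poly (kronecker_poly w K c) (of_nat s) = 0" for s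
    using z[of "\<lambda>i. s ^ w i"] by (simp add: poly_kronecker_poly)
  then have "range of_nat \<subseteq> {s. poly (kronecker_poly w K c) s = 0}" by auto
  moreover have "infinite (range (of_nat :: nat \<Rightarrow> complex))" by (simp add: finite_image_iff inj_of_nat)
  ultimately have "kronecker_poly w K c = 0" using poly_roots_finite finite_subset by blast
  then show ?thesis using kronecker_poly_zero_iff[OF K _ w] \<kappa> by simp
qed

text \<open>
  After a Kronecker substitution that is injective for both factors, this is the absence of zero
  divisors among polynomials in one variable.
\<close>

lemma poly_product_zero:
  fixes c d :: "'i::finite midx \<Rightarrow> complex"
  assumes K: "finite K" and L: "finite L"
    and z: "\<And>\<xi>. (\<Sum>\<kappa>\<in>K. c \<kappa> * mpow \<kappa> \<xi>) * (\<Sum>\<kappa>\<in>L. d \<kappa> * mpow \<kappa> \<xi>) = 0"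
    and c: "\<kappa> \<in> K" "c \<kappa> \<noteq> 0" and \<mu>: "\<mu> \<in> L"
  shows "d \<mu> = 0"
proof -
  obtain w where w: "inj_on (\<lambda>\<kappa>. \<Sum>i\<in>UNIV. \<kappa> i * w i) (K \<union> L)"
    by (rule kronecker[of "K \<union> L"]) (use K L in auto)
  have "poly (kronecker_poly w K c * kronecker_poly w L d) s = 0" for s
    using z[of "\<lambda>i. s ^ w i"] by (simp add: poly_kronecker_poly)
  then have "kronecker_poly w K c * kronecker_poly w L d = 0" using poly_all_0_iff_0 by blast
  then show ?thesis using kronecker_poly_zero_iff[OF K _ w] kronecker_poly_zero_iff[OF L _ w] c \<mu> by auto
qed

section \<open>Operators with function coefficients\<close>

definition twisted_op :: "'i::finite set \<Rightarrow> ('i \<Rightarrow> complex) \<Rightarrow> 'i midx set \<Rightarrow>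
    ('i midx \<Rightarrow> (real ^ 'i) \<Rightarrow> complex) \<Rightarrow> ((real ^ 'i) \<Rightarrow> complex) \<Rightarrow> (real ^ 'i) \<Rightarrow> complex" where
  "twisted_op T l K c f = (\<lambda>y. \<Sum>\<kappa>\<in>K. c \<kappa> y * iter_der (twisted_der T l) \<kappa> f y)"

lemma analytic_twisted_op: "(\<And>\<kappa>. \<kappa> \<in> K \<Longrightarrow> real_analytic_at (c \<kappa>) p) \<Longrightarrow> real_analytic_at f p \<Longrightarrow> real_analytic_at (twisted_op T l K c f) p"
  unfolding twisted_op_def by (intro analytic_sum analytic_mult analytic_iter)

lemma twisted_op_superset:
  assumes "finite K'" "K \<subseteq> K'" "\<And>\<kappa>. \<kappa> \<notin> K \<Longrightarrow> c \<kappa> = (\<lambda>_. 0)"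
  shows "twisted_op T l K c f = twisted_op T l K' c f"
  unfolding twisted_op_def using assms by (intro ext sum.mono_neutral_left) auto

text \<open>
  The finite set \<open>K\<close> bounds the support. It is a separate parameter so that several families can be summed
  over a common set. The points of \<open>S\<close> are those at which the coefficients are analytic.
\<close>

definition coeff_family :: "(real ^ 'i::finite) set \<Rightarrow> 'i set \<Rightarrow> 'i midx set \<Rightarrow> ('i midx \<Rightarrow> (real ^ 'i) \<Rightarrow> complex) \<Rightarrow> bool" where
  "coeff_family S I K c \<longleftrightarrow> finite K \<and> (\<forall>\<kappa>\<in>K. supported I \<kappa>) \<and> (\<forall>\<kappa>. \<forall>p\<in>S. real_analytic_at (c \<kappa>) p) \<and> (\<forall>\<kappa>. \<kappa> \<notin> K \<longrightarrow> c \<kappa> = (\<lambda>_. 0))"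

text \<open>
  One and the same coefficient family has to serve for every twist \<open>l\<close>. This uniformity is what makes
  the evaluations of \<open>\<sigma>\<^sub>*\<close> at all points \<open>l\<close> multiplicative at once.
\<close>

definition representable :: "(real ^ 'i::finite) set \<Rightarrow> 'i set \<Rightarrow> 'i set \<Rightarrow>
    (('i \<Rightarrow> complex) \<Rightarrow> ((real ^ 'i) \<Rightarrow> complex) \<Rightarrow> (real ^ 'i) \<Rightarrow> complex) \<Rightarrow> bool" where
  "representable S T I \<Phi> \<longleftrightarrow> (\<exists>K c. coeff_family S I K c \<and> (\<forall>l f. \<forall>p\<in>S. real_analytic_at f p \<longrightarrow> near_eq p (\<Phi> l f) (twisted_op T l K c f)))"

lemma coeff_family_add: "coeff_family S I K a \<Longrightarrow> coeff_family S I L b \<Longrightarrow> coeff_family S I (K \<union> L) (\<lambda>\<kappa> y. a \<kappa> y + b \<kappa> y)"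
  by (auto simp: coeff_family_def intro: analytic_add)

lemma coeff_family_cmult: "coeff_family S I K a \<Longrightarrow> coeff_family S I K (\<lambda>\<kappa> y. z * a \<kappa> y)"
  by (auto simp: coeff_family_def intro: analytic_mult)

lemma twisted_op_add:
  assumes "coeff_family S I K a" "coeff_family S I L b"
  shows "twisted_op T l (K \<union> L) (\<lambda>\<kappa> y. a \<kappa> y + b \<kappa> y) f = (\<lambda>y. twisted_op T l K a f y + twisted_op T l L b f y)"
proof -
  have "twisted_op T l K a f = twisted_op T l (K \<union> L) a f" "twisted_op T l L b f = twisted_op T l (K \<union> L) b f"
    using assms by (auto simp: coeff_family_def intro!: twisted_op_superset)
  then show ?thesis by (simp add: twisted_op_def sum.distrib distrib_right)
qed

lemma representable_add:
  assumes "representable S T I \<Phi>" "representable S T I \<Psi>" shows "representable S T I (\<lambda>l f y. \<Phi> l f y + \<Psi> l f y)"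
proof -
  obtain K a L b where a: "coeff_family S I K a" "\<And>l f p. p \<in> S \<Longrightarrow> real_analytic_at f p \<Longrightarrow> near_eq p (\<Phi> l f) (twisted_op T l K a f)"
    and b: "coeff_family S I L b" "\<And>l f p. p \<in> S \<Longrightarrow> real_analytic_at f p \<Longrightarrow> near_eq p (\<Psi> l f) (twisted_op T l L b f)"
    using assms unfolding representable_def by blast
  show ?thesis unfolding representable_def
    by (intro exI conjI allI ballI impI, rule coeff_family_add[OF a(1) b(1)])
       (auto simp: twisted_op_add[OF a(1) b(1)] intro!: near_eq_add a b)
qed

lemma representable_zero: "representable S T I (\<lambda>l f y. 0)"
  unfolding representable_def by (intro exI[of _ "{}"] exI[of _ "\<lambda>_ _. 0"]) (auto simp: coeff_family_def twisted_op_def)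

lemma representable_sum: "finite J \<Longrightarrow> (\<And>j. j \<in> J \<Longrightarrow> representable S T I (\<Phi> j)) \<Longrightarrow> representable S T I (\<lambda>l f y. \<Sum>j\<in>J. \<Phi> j l f y)"
  by (induction J rule: finite_induct) (auto intro: representable_zero representable_add)

lemma representable_mult:
  assumes "representable S T I \<Phi>" and g: "\<And>p. p \<in> S \<Longrightarrow> real_analytic_at g p" shows "representable S T I (\<lambda>l f y. g y * \<Phi> l f y)"
proof -
  obtain K a where a: "coeff_family S I K a" "\<And>l f p. p \<in> S \<Longrightarrow> real_analytic_at f p \<Longrightarrow> near_eq p (\<Phi> l f) (twisted_op T l K a f)"
    using assms unfolding representable_def by blast
  have "coeff_family S I K (\<lambda>\<kappa> y. g y * a \<kappa> y)" using a(1) g by (auto simp: coeff_family_def intro: analytic_mult)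
  moreover have "twisted_op T l K (\<lambda>\<kappa> y. g y * a \<kappa> y) f = (\<lambda>y. g y * twisted_op T l K a f y)" for l f
    by (simp add: twisted_op_def sum_distrib_left mult.assoc)
  ultimately show ?thesis unfolding representable_def
    by (intro exI[of _ K] exI[of _ "\<lambda>\<kappa> y. g y * a \<kappa> y"]) (auto intro!: near_eq_mult a)
qed

text \<open>
  This is \<open>\<delta>\<^sub>i \<circ> a = \<delta>\<^sub>i(a) + a \<circ> \<delta>\<^sub>i\<close>. The twist enters only the second summand, so that the new
  coefficients do not depend on it.
\<close>

lemma representable_twisted:
  assumes "representable S T I \<Phi>" and i: "i \<in> I" shows "representable S T I (\<lambda>l f. twisted_der T l i (\<Phi> l f))"
proof -
  obtain K a where a: "coeff_family S I K a" "\<And>l f p. p \<in> S \<Longrightarrow> real_analytic_at f p \<Longrightarrow> near_eq p (\<Phi> l f) (twisted_op T l K a f)"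
    using assms unfolding representable_def by blast
  have fin: "finite K" and ana_a: "\<And>\<kappa> p. p \<in> S \<Longrightarrow> real_analytic_at (a \<kappa>) p" using a(1) by (auto simp: coeff_family_def)
  let ?b = "\<lambda>\<kappa>. twisted_der T (\<lambda>_. 0) i (a \<kappa>)"
  let ?c = "\<lambda>\<kappa>. if \<kappa> i = 0 then (\<lambda>_. 0) else a (\<kappa>(i := \<kappa> i - 1))"
  have sder0: "twisted_der T (\<lambda>_. 0) i (\<lambda>_. 0) = (\<lambda>_. 0)" by (simp add: twisted_der_def)
  have b: "coeff_family S I K ?b" using a(1) by (auto simp: coeff_family_def intro: analytic_twisted) (simp add: sder0)
  have c: "coeff_family S I (up i ` K) ?c"
    unfolding coeff_family_def
  proof (intro conjI allI ballI impI)
    fix \<kappa> assume "\<kappa> \<notin> up i ` K"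
    moreover have "\<kappa> = up i (\<kappa>(i := \<kappa> i - 1))" if "\<kappa> i \<noteq> 0" using that by auto
    ultimately have "\<kappa>(i := \<kappa> i - 1) \<notin> K" if "\<kappa> i \<noteq> 0" using that by blast
    then show "?c \<kappa> = (\<lambda>_. 0)" using a(1) by (auto simp: coeff_family_def)
  qed (use a(1) i in \<open>auto simp: coeff_family_def supported_def\<close>)
  have main: "near_eq p (twisted_der T l i (\<Phi> l f)) (twisted_op T l (K \<union> up i ` K) (\<lambda>\<kappa> y. ?b \<kappa> y + ?c \<kappa> y) f)"
    if p: "p \<in> S" and f: "real_analytic_at f p" for l f p
  proof -
    have ev: "\<forall>\<^sub>F q in nhds p. real_analytic_at f q \<and> (\<forall>\<kappa>\<in>K. real_analytic_at (a \<kappa>) q \<and>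
        iter_der (twisted_der T l) (up i \<kappa>) f q = twisted_der T l i (iter_der (twisted_der T l) \<kappa> f) q)"
      using p f by (intro eventually_conj eventually_ball_finite fin ballI analytic_near ana_a
          iter_twisted_up[unfolded near_eq_def])
    have "near_eq p (twisted_der T l i (twisted_op T l K a f)) (\<lambda>y. twisted_op T l K ?b f y + twisted_op T l (up i ` K) ?c f y)"
      unfolding near_eq_def
    proof (rule eventually_mono[OF ev])
      fix q assume q: "real_analytic_at f q \<and> (\<forall>\<kappa>\<in>K. real_analytic_at (a \<kappa>) q \<and>
        iter_der (twisted_der T l) (up i \<kappa>) f q = twisted_der T l i (iter_der (twisted_der T l) \<kappa> f) q)"
      have "twisted_der T l i (twisted_op T l K a f) q = (\<Sum>\<kappa>\<in>K. twisted_der T l i (\<lambda>y. a \<kappa> y * iter_der (twisted_der T l) \<kappa> f y) q)"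
        unfolding twisted_op_def using q by (intro twisted_sum analytic_mult analytic_iter) auto
      also have "\<dots> = (\<Sum>\<kappa>\<in>K. ?b \<kappa> q * iter_der (twisted_der T l) \<kappa> f q) + (\<Sum>\<kappa>\<in>K. a \<kappa> q * iter_der (twisted_der T l) (up i \<kappa>) f q)"
        unfolding sum.distrib [symmetric] using q by (intro sum.cong refl) (simp add: twisted_mult analytic_iter del: fun_upd_apply)
      also have "(\<Sum>\<kappa>\<in>K. a \<kappa> q * iter_der (twisted_der T l) (up i \<kappa>) f q) = twisted_op T l (up i ` K) ?c f q"
      proof -
        have inj: "inj_on (up i) K" by (rule inj_onI) (metis fun_upd_same fun_upd_triv fun_upd_upd nat.inject)
        show ?thesis unfolding twisted_op_def by (subst sum.reindex[OF inj]) (auto intro!: sum.cong)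
      qed
      finally show "twisted_der T l i (twisted_op T l K a f) q = twisted_op T l K ?b f q + twisted_op T l (up i ` K) ?c f q"
        by (simp add: twisted_op_def)
    qed
    with twisted_cong[OF a(2)[OF p f]] show ?thesis unfolding twisted_op_add[OF b c] by (rule near_eq_trans)
  qed
  show ?thesis unfolding representable_def using coeff_family_add[OF b c] main by blast
qed

lemma representable_iter:
  assumes "representable S T I \<Phi>" and \<kappa>: "supported I \<kappa>" shows "representable S T I (\<lambda>l f. iter_der (twisted_der T l) \<kappa> (\<Phi> l f))"
proof -
  let ?\<delta> = "\<lambda>i \<Phi> l f. twisted_der T l i (\<Phi> l f)"
  have "representable S T I (iter_der ?\<delta> \<kappa> \<Phi>)"
  proof (rule iter_der_induct[of "\<lambda>u. representable S T I u"])
    fix i u assume "\<kappa> i \<noteq> 0" "representable S T I u"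
    moreover from this have "i \<in> I" using \<kappa> by (auto simp: supported_def)
    ultimately show "representable S T I (\<lambda>l f. twisted_der T l i (u l f))" by (intro representable_twisted)
  qed (rule assms)
  moreover have "iter_der ?\<delta> \<kappa> \<Phi> l f = iter_der (twisted_der T l) \<kappa> (\<Phi> l f)" for l f
    by (rule iter_der_rel[of "\<lambda>u v. u l f = v"]) auto
  then have "iter_der ?\<delta> \<kappa> \<Phi> = (\<lambda>l f. iter_der (twisted_der T l) \<kappa> (\<Phi> l f))" by (intro ext) simp
  ultimately show ?thesis by simp
qed

lemma representable_twisted_op: "coeff_family S I K c \<Longrightarrow> representable S T I (\<lambda>l. twisted_op T l K c)"
  unfolding representable_def by (metis near_eq_refl)

lemma representable_compose:
  assumes "coeff_family S I K c" "representable S T I \<Phi>" shows "representable S T I (\<lambda>l f. twisted_op T l K c (\<Phi> l f))"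
  unfolding twisted_op_def using assms by (intro representable_sum representable_mult representable_iter) (auto simp: coeff_family_def)

lemma twisted_op_lin:
  assumes "\<And>k. k \<in> J \<Longrightarrow> real_analytic_at (f k) p"
  shows "near_eq p (twisted_op T l K c (\<lambda>y. \<Sum>k\<in>J. z k * f k y)) (\<lambda>y. \<Sum>k\<in>J. z k * twisted_op T l K c (f k) y)"
proof -
  have "near_eq p (twisted_op T l K c (\<lambda>y. \<Sum>k\<in>J. z k * f k y)) (\<lambda>y. \<Sum>\<kappa>\<in>K. c \<kappa> y * (\<Sum>k\<in>J. z k * iter_der (twisted_der T l) \<kappa> (f k) y))"
    unfolding twisted_op_def by (intro near_eq_sum near_eq_mult near_eq_refl iter_lin assms)
  also have "(\<lambda>y. \<Sum>\<kappa>\<in>K. c \<kappa> y * (\<Sum>k\<in>J. z k * iter_der (twisted_der T l) \<kappa> (f k) y))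
      = (\<lambda>y. \<Sum>k\<in>J. z k * twisted_op T l K c (f k) y)"
    unfolding twisted_op_def sum_distrib_left by (subst sum.swap) (simp add: mult_ac)
  finally show ?thesis .
qed

section \<open>Common eigenfunctions\<close>

text \<open>
  The function \<open>t\<^sup>n exp(n \<cdot> x)\<close>. The exponents of \<open>t\<close> must be natural numbers for the function to be
  analytic on \<open>{t = 0}\<close>.
\<close>

definition eigenfun :: "'i::finite set \<Rightarrow> ('i \<Rightarrow> nat) \<Rightarrow> (real ^ 'i) \<Rightarrow> complex" where
  "eigenfun T n y = (\<Prod>i\<in>UNIV. if i \<in> T then of_real (y $ i) ^ n i else exp (of_nat (n i) * of_real (y $ i)))"

lemma analytic_eigenfun_fac: "real_analytic_at (\<lambda>y. if i \<in> T then complex_of_real (y $ i) ^ m else exp (a * of_real (y $ i))) p"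
  by (cases "i \<in> T") (auto intro: analytic_power analytic_exp)

lemma analytic_eigenfun: "real_analytic_at (eigenfun T n) p"
  unfolding eigenfun_def by (intro analytic_prod analytic_eigenfun_fac)

lemma partial_coord_power:
  "partial i (\<lambda>y. of_real (y $ j) ^ m) p = (if i = j then of_nat m * of_real (p $ j) ^ (m - 1) else 0)"
proof (induction m)
  case (Suc m)
  then show ?case
    by (cases m) (auto simp: partial_mult analytic_power analytic_mult partial_coord algebra_simps)
qed simp

lemma partial_prod_zero:
  "(\<And>k. k \<in> K \<Longrightarrow> real_analytic_at (f k) p) \<Longrightarrow> (\<And>k. k \<in> K \<Longrightarrow> partial i (f k) p = 0) \<Longrightarrow> partial i (\<lambda>y. \<Prod>k\<in>K. f k y) p = 0"
  by (induction K rule: infinite_finite_induct) (auto simp: partial_mult analytic_prod)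

lemma twisted_eigenfun: "twisted_der T (\<lambda>_. 0) i (eigenfun T n) = (\<lambda>y. of_nat (n i) * eigenfun T n y)"
proof
  fix y
  let ?h = "\<lambda>i y. if i \<in> T then complex_of_real (y $ i) ^ n i else exp (of_nat (n i) * of_real (y $ i))"
  have e: "eigenfun T n = (\<lambda>y. ?h i y * (\<Prod>j\<in>UNIV - {i}. ?h j y))"
    unfolding eigenfun_def by (rule ext, subst prod.remove[of _ i]) auto
  have "partial i (?h j) y = 0" if "j \<noteq> i" for j
    using that by (cases "j \<in> T") (simp_all add: partial_coord_power partial_exp)
  then have 0: "partial i (\<lambda>y. \<Prod>j\<in>UNIV - {i}. ?h j y) y = 0"
    by (intro partial_prod_zero analytic_eigenfun_fac) auto
  have 1: "(if i \<in> T then of_real (y $ i) else 1) * partial i (?h i) y = of_nat (n i) * ?h i y"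
    by (cases "i \<in> T"; cases "n i") (simp_all add: partial_coord_power partial_exp del: power_Suc, simp)
  have "partial i (eigenfun T n) y = partial i (?h i) y * (\<Prod>j\<in>UNIV - {i}. ?h j y)"
    unfolding e by (subst partial_mult) (simp_all only: 0 analytic_eigenfun_fac analytic_prod, simp)
  then have "twisted_der T (\<lambda>_. 0) i (eigenfun T n) y = ((if i \<in> T then of_real (y $ i) else 1) * partial i (?h i) y) * (\<Prod>j\<in>UNIV - {i}. ?h j y)"
    by (simp add: twisted_der_def mult.assoc)
  then show "twisted_der T (\<lambda>_. 0) i (eigenfun T n) y = of_nat (n i) * eigenfun T n y" unfolding 1 e by (simp only: mult.assoc)
qed

lemma iter_eigenfun: "iter_der (twisted_der T (\<lambda>_. 0)) \<kappa> (eigenfun T n) = (\<lambda>y. mpow \<kappa> (\<lambda>i. of_nat (n i)) * eigenfun T n y)"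
proof (rule iter_der_count_unary[of "\<lambda>\<mu> u. u = (\<lambda>y. mpow \<mu> (\<lambda>i. of_nat (n i)) * eigenfun T n y)"])
  fix i \<mu> u assume "u = (\<lambda>y. mpow \<mu> (\<lambda>i. of_nat (n i)) * eigenfun T n y)"
  then show "twisted_der T (\<lambda>_. 0) i u = (\<lambda>y. mpow (up i \<mu>) (\<lambda>i. of_nat (n i)) * eigenfun T n y)"
    by (intro ext) (simp add: twisted_cmult[OF analytic_eigenfun] twisted_eigenfun mpow_up del: fun_upd_apply)
qed simp

lemma twisted_op_eigenfun: "twisted_op T (\<lambda>_. 0) K c (eigenfun T n) = (\<lambda>y. (\<Sum>\<kappa>\<in>K. c \<kappa> y * mpow \<kappa> (\<lambda>i. of_nat (n i))) * eigenfun T n y)"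
  by (simp add: twisted_op_def iter_eigenfun sum_distrib_right mult.assoc)

lemma eigenfun_nonzero_near: "\<not> (\<forall>\<^sub>F y in nhds q. eigenfun T n y = 0)"
proof
  assume "\<forall>\<^sub>F y in nhds q. eigenfun T n y = 0"
  moreover have "((\<lambda>s::real. q + s *\<^sub>R (\<chi> i. 1)) \<longlongrightarrow> q + 0 *\<^sub>R (\<chi> i. 1)) (at 0)"
    by (intro tendsto_intros)
  ultimately have 1: "\<forall>\<^sub>F s::real in at 0. eigenfun T n (q + s *\<^sub>R (\<chi> i. 1)) = 0"
    unfolding filterlim_iff by auto
  have "\<forall>\<^sub>F s::real in at 0. q $ i + s \<noteq> 0" for i
  proof (cases "q $ i = 0")
    case True
    then show ?thesis by (simp add: eventually_at_filter)
  next
    case False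
    have "((\<lambda>s::real. q $ i + s) \<longlongrightarrow> q $ i + 0) (at 0)" by (intro tendsto_intros)
    then show ?thesis by (rule tendsto_imp_eventually_ne) (use False in simp)
  qed
  then have 2: "\<forall>\<^sub>F s::real in at 0. \<forall>i. q $ i + s \<noteq> 0" by (intro eventually_all_finite)
  have "\<forall>\<^sub>F s::real in at 0. False"
    using 1 2
  proof eventually_elim
    case (elim s)
    have "eigenfun T n (q + s *\<^sub>R (\<chi> i. 1)) \<noteq> 0"
      using elim(2) unfolding eigenfun_def by (subst prod_zero_iff) (auto simp flip: of_real_add)
    then show False using elim(1) by simp
  qed
  then show False by simp
qed

text \<open>
  The zero set of an eigenfunction is contained in the union of the hyperplanes \<open>t\<^sub>i = 0\<close>, whose complement is
  dense; so \<open>g\<close> vanishes by continuity.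
\<close>

lemma cancel_eigenfun:
  assumes g: "real_analytic_at g p" and z: "near_eq p (\<lambda>y. g y * eigenfun T n y) (\<lambda>_. 0)" shows "near_eq p g (\<lambda>_. 0)"
  unfolding near_eq_def
proof (rule eventually_mono[OF eventually_conj[OF near_eq_near[OF z] analytic_near[OF g]]], rule ccontr)
  fix q assume q: "near_eq q (\<lambda>y. g y * eigenfun T n y) (\<lambda>_. 0) \<and> real_analytic_at g q" and "g q \<noteq> 0"
  then have "\<forall>\<^sub>F y in nhds q. g y \<noteq> 0" by (intro analytic_nonzero_near) auto
  moreover have "\<forall>\<^sub>F y in nhds q. g y * eigenfun T n y = 0" using q by (simp add: near_eq_def)
  ultimately have "\<forall>\<^sub>F y in nhds q. eigenfun T n y = 0" by eventually_elim simp
  then show False using eigenfun_nonzero_near by blast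
qed

text \<open>
  On the eigenfunction with exponent \<open>n\<close> the operator is multiplication by \<open>\<Sum>\<^sub>\<kappa> c\<^sub>\<kappa> n\<^sup>\<kappa>\<close>.
  Neighbourhoods on which this vanishes may shrink with \<open>n\<close>; passing to Taylor coefficients at \<open>p\<close> leaves a polynomial
  identity between numbers.
\<close>

lemma twisted_op_zero_coeffs:
  assumes K: "finite K" and c: "\<And>\<kappa>. \<kappa> \<in> K \<Longrightarrow> real_analytic_at (c \<kappa>) p"
    and z: "\<And>n. near_eq p (twisted_op T (\<lambda>_. 0) K c (eigenfun T n)) (\<lambda>_. 0)" and \<kappa>: "\<kappa> \<in> K"
  shows "near_eq p (c \<kappa>) (\<lambda>_. 0)"
proof (rule near_eq_zero_if_taylor[OF c[OF \<kappa>]])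
  fix \<mu>
  show "taylor (c \<kappa>) p \<mu> = 0"
  proof (rule poly_coeffs_zero[OF K _ \<kappa>])
    fix n
    let ?m = "\<lambda>\<kappa>::'a midx. mpow \<kappa> (\<lambda>i. complex_of_nat (n i))"
    have 0: "(\<lambda>y. \<Sum>\<kappa>\<in>K. c \<kappa> y * ?m \<kappa>) = (\<lambda>y. \<Sum>\<kappa>\<in>K. ?m \<kappa> * c \<kappa> y)" by (simp add: mult.commute)
    have a: "real_analytic_at (\<lambda>y. \<Sum>\<kappa>\<in>K. ?m \<kappa> * c \<kappa> y) p" by (intro analytic_sum analytic_mult analytic_const c)
    have "near_eq p (\<lambda>y. \<Sum>\<kappa>\<in>K. ?m \<kappa> * c \<kappa> y) (\<lambda>_. 0)"
      using z[of n] unfolding twisted_op_eigenfun by (intro cancel_eigenfun[OF a]) (simp add: mult.commute)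
    from taylor_cong[OF this a] have "taylor (\<lambda>y. \<Sum>\<kappa>\<in>K. ?m \<kappa> * c \<kappa> y) p \<mu> = 0" by (simp add: taylor_const)
    moreover have "taylor (\<lambda>y. \<Sum>\<kappa>\<in>K. ?m \<kappa> * c \<kappa> y) p \<mu> = (\<Sum>\<kappa>\<in>K. ?m \<kappa> * taylor (c \<kappa>) p \<mu>)"
      by (subst taylor_sum) (simp_all add: analytic_mult c taylor_cmult)
    ultimately show "(\<Sum>\<kappa>\<in>K. taylor (c \<kappa>) p \<mu> * ?m \<kappa>) = 0" by (simp only: mult.commute)
  qed
qed

section \<open>Monomials under a shift of the variables\<close>

lemma mpow_cong: "supported T \<alpha> \<Longrightarrow> (\<And>i. i \<in> T \<Longrightarrow> z i = w i) \<Longrightarrow> mpow \<alpha> z = mpow \<alpha> w"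
  unfolding mpow_def supported_def by (intro prod.cong) (auto, metis power_0)

lemma iter_one: "iter_der (twisted_der T l) \<kappa> (\<lambda>_. 1) = (\<lambda>_. mpow \<kappa> l)"
proof (rule iter_der_count_unary[of "\<lambda>\<mu> u. u = (\<lambda>_. mpow \<mu> l)"])
  fix i \<mu> and u :: "(real ^ 'a) \<Rightarrow> complex" assume "u = (\<lambda>_. mpow \<mu> l)"
  then show "twisted_der T l i u = (\<lambda>_. mpow (up i \<mu>) l)" by (simp add: twisted_der_def mpow_up del: fun_upd_apply)
qed simp

lemma poly_factor_zero:
  fixes m :: "'x \<Rightarrow> 'i::finite midx" and d :: "'i midx \<Rightarrow> complex"
  assumes X: "finite X" and L: "finite L"
    and z: "\<And>\<xi>. (\<Sum>x\<in>X. c x * mpow (m x) \<xi>) * (\<Sum>\<kappa>\<in>L. d \<kappa> * mpow \<kappa> \<xi>) = 0"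
    and nz: "(\<Sum>x\<in>X. c x * mpow (m x) \<zeta>) \<noteq> 0" and \<mu>: "\<mu> \<in> L"
  shows "d \<mu> = 0"
proof -
  let ?c = "\<lambda>\<kappa>. \<Sum>x\<in>{x \<in> X. m x = \<kappa>}. c x"
  have e: "(\<Sum>x\<in>X. c x * mpow (m x) \<xi>) = (\<Sum>\<kappa>\<in>m ` X. ?c \<kappa> * mpow \<kappa> \<xi>)" for \<xi>
    unfolding sum.image_gen[OF X, of "\<lambda>x. c x * mpow (m x) \<xi>" m] sum_distrib_right
    by (intro sum.cong) auto
  have "\<exists>\<kappa>\<in>m ` X. ?c \<kappa> \<noteq> 0"
  proof (rule ccontr)
    assume "\<not> (\<exists>\<kappa>\<in>m ` X. ?c \<kappa> \<noteq> 0)"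
    then have "(\<Sum>x\<in>X. c x * mpow (m x) \<zeta>) = 0" unfolding e by (intro sum.neutral) auto
    with nz show False by simp
  qed
  then obtain \<kappa> where "\<kappa> \<in> m ` X" "?c \<kappa> \<noteq> 0" by blast
  then show ?thesis using poly_product_zero[of "m ` X" L ?c d \<kappa> \<mu>] X L z e \<mu> by simp
qed

text \<open>
  The derivative of \<open>mpow \<alpha>\<close> at \<open>\<xi>\<close> in direction \<open>\<gamma>\<close>.
\<close>

definition dir_deriv :: "'i::finite midx \<Rightarrow> 'i midx \<Rightarrow> ('i \<Rightarrow> complex) \<Rightarrow> complex" where
  "dir_deriv \<gamma> \<alpha> \<xi> = (\<Sum>\<nu>\<in>UNIV. of_nat (\<gamma> \<nu>) * of_nat (\<alpha> \<nu>) * mpow (\<alpha>(\<nu> := \<alpha> \<nu> - 1)) \<xi>)"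

lemma dir_deriv_derivative:
  "((\<lambda>h. mpow \<alpha> (\<lambda>i. \<xi> i + h * of_nat (\<gamma> i))) has_field_derivative dir_deriv \<gamma> \<alpha> \<xi>) (at 0)"
proof -
  have "((\<lambda>h. \<Prod>i\<in>UNIV. (\<xi> i + h * of_nat (\<gamma> i)) ^ \<alpha> i) has_field_derivative
      (\<Sum>i\<in>UNIV. (of_nat (\<alpha> i) * of_nat (\<gamma> i) * (\<xi> i + 0 * of_nat (\<gamma> i)) ^ (\<alpha> i - 1))
         * (\<Prod>j\<in>UNIV - {i}. (\<xi> j + 0 * of_nat (\<gamma> j)) ^ \<alpha> j))) (at 0)"
    by (rule has_field_derivative_prod) (auto intro!: derivative_eq_intros)
  moreover have "(\<lambda>h. \<Prod>i\<in>UNIV. (\<xi> i + h * of_nat (\<gamma> i)) ^ \<alpha> i) = (\<lambda>h. mpow \<alpha> (\<lambda>i. \<xi> i + h * of_nat (\<gamma> i)))"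
    by (simp add: mpow_def)
  moreover have "dir_deriv \<gamma> \<alpha> \<xi> = (\<Sum>i\<in>UNIV. (of_nat (\<alpha> i) * of_nat (\<gamma> i) * (\<xi> i + 0 * of_nat (\<gamma> i)) ^ (\<alpha> i - 1))
         * (\<Prod>j\<in>UNIV - {i}. (\<xi> j + 0 * of_nat (\<gamma> j)) ^ \<alpha> j))"
    by (simp add: dir_deriv_def mpow_fun_upd_exponent mult_ac)
  ultimately show ?thesis by simp
qed

lemma inverse_of_nat_at_0: "filterlim (\<lambda>s. inverse (of_nat s) :: complex) (at 0) sequentially"
proof (rule filterlim_atI)
  show "((\<lambda>s. inverse (of_nat s) :: complex) \<longlongrightarrow> 0) sequentially"
    by (rule lim_inverse_n)
  show "\<forall>\<^sub>F s in sequentially. inverse (of_nat s) \<noteq> (0::complex)"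
    using eventually_gt_at_top[of 0] by eventually_elim simp
qed

lemma mpow_scale: "mpow \<alpha> (\<lambda>i. z * \<xi> i) = z ^ deg \<alpha> * mpow \<alpha> \<xi>"
  by (simp add: mpow_def deg_def power_mult_distrib prod.distrib power_sum)

lemma mpow_shift:
  assumes "s > 0"
  shows "mpow \<alpha> (\<lambda>i. of_nat s * \<xi> i + of_nat (\<gamma> i))
    = of_nat s ^ deg \<alpha> * mpow \<alpha> (\<lambda>i. \<xi> i + inverse (of_nat s) * of_nat (\<gamma> i) :: complex)"
proof -
  have "(\<lambda>i. of_nat s * \<xi> i + of_nat (\<gamma> i))
      = (\<lambda>i. of_nat s * (\<xi> i + inverse (of_nat s) * of_nat (\<gamma> i)) :: complex)"
    using assms by (auto simp: field_simps)
  then show ?thesis by (simp only: mpow_scale)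
qed

lemma lim_pow_ratio:
  assumes "m < n" shows "(\<lambda>s. of_nat s ^ m / of_nat s ^ n :: complex) \<longlonglongrightarrow> 0"
proof -
  have "(\<lambda>s. inverse (of_nat s :: complex) ^ (n - m)) \<longlonglongrightarrow> 0 ^ (n - m)"
    by (intro tendsto_power lim_inverse_n)
  then have 1: "(\<lambda>s. inverse (of_nat s :: complex) ^ (n - m)) \<longlonglongrightarrow> 0" using assms by (simp add: power_0_left)
  have "\<forall>\<^sub>F s in sequentially. inverse (of_nat s :: complex) ^ (n - m) = of_nat s ^ m / of_nat s ^ n"
    using eventually_gt_at_top[of 0]
    by eventually_elim (use assms in \<open>simp add: power_diff divide_simps power_inverse\<close>)
  from Lim_transform_eventually[OF 1 this] show ?thesis .
qed

text \<open>
  By homogeneity the shift of \<open>s \<xi>\<close> by \<open>\<gamma>\<close> is a shift of \<open>\<xi>\<close> by \<open>\<gamma> / s\<close>. The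
  difference in the third part is therefore a difference quotient at \<open>\<xi>\<close> with step \<open>1 / s\<close>.
\<close>

lemma lim_mpow_shift:
  shows lim_mpow_shift_eq: "(\<lambda>s. mpow \<alpha> (\<lambda>i. of_nat s * \<xi> i + of_nat (\<gamma> i)) / of_nat s ^ deg \<alpha>) \<longlonglongrightarrow> mpow \<alpha> \<xi>"
    and lim_mpow_shift_less: "deg \<alpha> < k \<Longrightarrow>
      (\<lambda>s. mpow \<alpha> (\<lambda>i. of_nat s * \<xi> i + of_nat (\<gamma> i)) / of_nat s ^ k) \<longlonglongrightarrow> 0"
    and lim_mpow_shift_diff: "deg \<alpha> = Suc k \<Longrightarrow>
      (\<lambda>s. (mpow \<alpha> (\<lambda>i. of_nat s * \<xi> i + of_nat (\<gamma> i)) - mpow \<alpha> (\<lambda>i. of_nat s * \<xi> i)) / of_nat s ^ k)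
        \<longlonglongrightarrow> dir_deriv \<gamma> \<alpha> \<xi>"
proof -
  let ?f = "\<lambda>h. mpow \<alpha> (\<lambda>i. \<xi> i + h * of_nat (\<gamma> i))"
  have pos: "\<forall>\<^sub>F s::nat in sequentially. s > 0" by (rule eventually_gt_at_top)
  have "(?f \<longlongrightarrow> ?f 0) (at 0)"
    using DERIV_isCont[OF dir_deriv_derivative] by (rule isContD)
  from filterlim_compose[OF this inverse_of_nat_at_0]
  have "(\<lambda>s. ?f (inverse (of_nat s))) \<longlonglongrightarrow> mpow \<alpha> \<xi>" by simp
  moreover have "\<forall>\<^sub>F s in sequentially. ?f (inverse (of_nat s))
      = mpow \<alpha> (\<lambda>i. of_nat s * \<xi> i + of_nat (\<gamma> i)) / of_nat s ^ deg \<alpha>"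
    using pos by eventually_elim (simp add: mpow_shift)
  ultimately show 1: "(\<lambda>s. mpow \<alpha> (\<lambda>i. of_nat s * \<xi> i + of_nat (\<gamma> i)) / of_nat s ^ deg \<alpha>) \<longlonglongrightarrow> mpow \<alpha> \<xi>"
    by (rule Lim_transform_eventually)
  show "(\<lambda>s. mpow \<alpha> (\<lambda>i. of_nat s * \<xi> i + of_nat (\<gamma> i)) / of_nat s ^ k) \<longlonglongrightarrow> 0" if "deg \<alpha> < k"
  proof -
    have "(\<lambda>s. mpow \<alpha> (\<lambda>i. of_nat s * \<xi> i + of_nat (\<gamma> i)) / of_nat s ^ deg \<alpha> * (of_nat s ^ deg \<alpha> / of_nat s ^ k)) \<longlonglongrightarrow> mpow \<alpha> \<xi> * 0"
      by (intro tendsto_mult 1 lim_pow_ratio that)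
    moreover have "\<forall>\<^sub>F s in sequentially. mpow \<alpha> (\<lambda>i. of_nat s * \<xi> i + of_nat (\<gamma> i)) / of_nat s ^ deg \<alpha> * (of_nat s ^ deg \<alpha> / of_nat s ^ k)
        = mpow \<alpha> (\<lambda>i. of_nat s * \<xi> i + of_nat (\<gamma> i)) / of_nat s ^ k"
      using pos by eventually_elim simp
    ultimately show ?thesis using Lim_transform_eventually by fastforce
  qed
  show "(\<lambda>s. (mpow \<alpha> (\<lambda>i. of_nat s * \<xi> i + of_nat (\<gamma> i)) - mpow \<alpha> (\<lambda>i. of_nat s * \<xi> i)) / of_nat s ^ k)
        \<longlonglongrightarrow> dir_deriv \<gamma> \<alpha> \<xi>" if "deg \<alpha> = Suc k"
  proof -
    have "((\<lambda>h. (?f h - ?f 0) / h) \<longlongrightarrow> dir_deriv \<gamma> \<alpha> \<xi>) (at 0)"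
      using dir_deriv_derivative[of \<alpha> \<xi> \<gamma>] by (simp add: has_field_derivative_iff)
    from filterlim_compose[OF this inverse_of_nat_at_0]
    have "(\<lambda>s. (?f (inverse (of_nat s)) - ?f 0) / inverse (of_nat s)) \<longlonglongrightarrow> dir_deriv \<gamma> \<alpha> \<xi>" .
    moreover have "\<forall>\<^sub>F s in sequentially. (?f (inverse (of_nat s)) - ?f 0) / inverse (of_nat s)
        = (mpow \<alpha> (\<lambda>i. of_nat s * \<xi> i + of_nat (\<gamma> i)) - mpow \<alpha> (\<lambda>i. of_nat s * \<xi> i)) / of_nat s ^ k"
      using pos
    proof eventually_elim
      case (elim s)
      have "mpow \<alpha> (\<lambda>i. of_nat s * \<xi> i + of_nat (\<gamma> i)) - mpow \<alpha> (\<lambda>i. of_nat s * \<xi> i)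
          = of_nat s ^ Suc k * (?f (inverse (of_nat s)) - ?f 0)"
        by (simp only: mpow_shift[OF elim] mpow_scale that) (simp add: algebra_simps)
      then show ?case using elim by (simp add: field_simps)
    qed
    ultimately show ?thesis by (rule Lim_transform_eventually)
  qed
qed

section \<open>Weights\<close>

text \<open>
  With weight 2 for the \<open>x\<close>-derivatives, replacing one of them by the derivative of a coefficient is of smaller
  weight than shifting the variables \<open>\<xi>\<close>, which costs only one unit.
\<close>

definition index_weight :: "'i set \<Rightarrow> 'i::finite \<Rightarrow> nat" where "index_weight T i = (if i \<in> T then 1 else 2)"

definition weight :: "'i set \<Rightarrow> 'i::finite midx \<Rightarrow> nat" where "weight T \<kappa> = (\<Sum>i\<in>UNIV. \<kappa> i * index_weight T i)"

lemma weight_up: "weight T (up i \<kappa>) = weight T \<kappa> + index_weight T i"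
  by (simp add: weight_def sum.remove[of UNIV i])

lemma weight_zero [simp]: "weight T (\<lambda>i. 0) = 0" by (simp add: weight_def)

lemma weight_supported: "supported T \<kappa> \<Longrightarrow> weight T \<kappa> = deg \<kappa>"
  unfolding weight_def deg_def by (rule sum.cong) (auto simp: index_weight_def supported_def)

text \<open>
  The weighted dilation of \<open>\<xi>\<close> by \<open>s\<close>.
\<close>

definition scaled :: "'i set \<Rightarrow> ('i::finite \<Rightarrow> complex) \<Rightarrow> nat \<Rightarrow> 'i \<Rightarrow> complex" where
  "scaled T \<xi> s i = of_nat s ^ index_weight T i * \<xi> i"

lemma mpow_scaled: "mpow \<kappa> (scaled T \<xi> s) = of_nat s ^ weight T \<kappa> * mpow \<kappa> \<xi>"
  by (simp add: mpow_def scaled_def weight_def power_mult_distrib prod.distrib power_sum mult.commute flip: power_mult)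

text \<open>
  The full symbol of the operator with coefficients \<open>a\<close>: its twist by \<open>l\<close> applied to the constant
  function 1.
\<close>

definition symbol :: "'i::finite midx set \<Rightarrow> ('i midx \<Rightarrow> (real ^ 'i) \<Rightarrow> complex) \<Rightarrow> ('i \<Rightarrow> complex) \<Rightarrow> (real ^ 'i) \<Rightarrow> complex" where
  "symbol K a l y = (\<Sum>\<kappa>\<in>K. a \<kappa> y * mpow \<kappa> l)"

lemma twisted_op_one: "twisted_op T l K a (\<lambda>_. 1) = symbol K a l"
  by (simp add: twisted_op_def symbol_def iter_one fun_eq_iff)

lemma analytic_symbol: "(\<And>\<kappa>. \<kappa> \<in> K \<Longrightarrow> real_analytic_at (a \<kappa>) p) \<Longrightarrow> real_analytic_at (symbol K a l) p"
  unfolding twisted_op_one[of UNIV, symmetric] by (intro analytic_twisted_op) auto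

context crossing
begin

text \<open>
  Functions of the twist \<open>l\<close> that are polynomials in \<open>l\<close> of weight at most \<open>n - 2\<close>, with analytic
  coefficients. The inequality in the second rule avoids the subtraction for \<open>n < 2\<close>.
\<close>

inductive low_weight :: "nat \<Rightarrow> (('i \<Rightarrow> complex) \<Rightarrow> (real ^ 'i) \<Rightarrow> complex) \<Rightarrow> bool" for n where
  zero: "low_weight n (\<lambda>l y. 0)"
| monomial: "(\<And>p. p \<in> N \<Longrightarrow> real_analytic_at g p) \<Longrightarrow> weight T \<mu> + 2 \<le> n \<Longrightarrow> low_weight n (\<lambda>l y. mpow \<mu> l * g y)"
| add: "low_weight n F \<Longrightarrow> low_weight n G \<Longrightarrow> low_weight n (\<lambda>l y. F l y + G l y)"

lemma low_weight_mono: "low_weight m F \<Longrightarrow> m \<le> n \<Longrightarrow> low_weight n F"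
  by (induction rule: low_weight.induct) (auto intro: low_weight.intros)

lemma low_weight_analytic: "low_weight n F \<Longrightarrow> p \<in> N \<Longrightarrow> real_analytic_at (F l) p"
  by (induction rule: low_weight.induct) (auto intro: analytic_add analytic_mult)

lemma low_weight_mult: "low_weight n F \<Longrightarrow> low_weight (n + index_weight T i) (\<lambda>l y. l i * F l y)"
proof (induction rule: low_weight.induct)
  case (monomial g \<mu>)
  have "low_weight (n + index_weight T i) (\<lambda>l y. mpow (up i \<mu>) l * g y)"
    by (rule low_weight.monomial) (use monomial in \<open>auto simp: weight_up simp del: fun_upd_apply\<close>)
  then show ?case by (simp add: mpow_up mult.assoc del: fun_upd_apply)
next
  case (add F G)
  from low_weight.add[OF add.IH] show ?case by (simp add: distrib_left)
qed (simp add: low_weight.zero)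

lemma low_weight_partial: "low_weight n F \<Longrightarrow> \<exists>G. low_weight n G \<and> (\<forall>l. \<forall>y\<in>N. partial i (F l) y = G l y)"
proof (induction rule: low_weight.induct)
  case zero
  then show ?case by (intro exI[of _ "\<lambda>l y. 0"]) (auto intro: low_weight.zero)
next
  case (monomial g \<mu>)
  then show ?case
    by (intro exI[of _ "\<lambda>l y. mpow \<mu> l * partial i g y"]) (auto intro!: low_weight.monomial analytic_partial simp: partial_cmult)
next
  case (add F G)
  then obtain F' G' where "low_weight n F'" "low_weight n G'" "\<And>l y. y \<in> N \<Longrightarrow> partial i (F l) y = F' l y"
    "\<And>l y. y \<in> N \<Longrightarrow> partial i (G l) y = G' l y" by blast
  then show ?case using add.hyps
    by (intro exI[of _ "\<lambda>l y. F' l y + G' l y"]) (auto intro!: low_weight.add simp: partial_add low_weight_analytic)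
qed

lemma low_weight_lim:
  assumes "low_weight n F" "y \<in> N"
  shows "(\<lambda>s. of_nat s * F (scaled T \<xi> s) y / of_nat s ^ n) \<longlonglongrightarrow> 0"
  using assms
proof (induction rule: low_weight.induct)
  case (monomial g \<mu>)
  have "(\<lambda>s. (of_nat s ^ Suc (weight T \<mu>) / of_nat s ^ n) * (mpow \<mu> \<xi> * g y)) \<longlonglongrightarrow> 0 * (mpow \<mu> \<xi> * g y)"
    by (intro tendsto_mult lim_pow_ratio tendsto_const) (use monomial in simp)
  then show ?case by (simp add: mpow_scaled mult_ac)
next
  case (add F G)
  from tendsto_add[OF add.IH] add.prems show ?case by (simp add: distrib_left add_divide_distrib)
qed simp

text \<open>
  Each factor \<open>\<delta>\<^sub>i + l\<^sub>i\<close> contributes either the variable \<open>l\<^sub>i\<close> or, for \<open>i \<notin> T\<close> only, a derivative of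
  \<open>g\<close> at the cost of two units of weight. On \<open>N\<close> the \<open>t\<close>-directions contribute no derivative.
\<close>

lemma iter_leading:
  assumes g: "\<And>p. p \<in> N \<Longrightarrow> real_analytic_at g p"
  obtains R where "low_weight (weight T \<kappa>) R"
    "\<And>l y. y \<in> N \<Longrightarrow> iter_der (twisted_der T l) \<kappa> g y = mpow \<kappa> l * g y + R l y"
proof -
  let ?Q = "\<lambda>\<mu> u. \<exists>R. low_weight (weight T \<mu>) R \<and> (\<forall>l. \<forall>y\<in>N. u l y = mpow \<mu> l * g y + R l y)"
  let ?\<delta> = "\<lambda>i u l. twisted_der T l i (u l)"
  have "?Q \<kappa> (iter_der ?\<delta> \<kappa> (\<lambda>l. g))"
  proof (rule iter_der_count_unary[of ?Q])
    show "?Q (\<lambda>i. 0) (\<lambda>l. g)" by (intro exI[of _ "\<lambda>l y. 0"]) (auto intro: low_weight.zero)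
  next
    fix i \<mu> u assume "?Q \<mu> u"
    then obtain R where R: "low_weight (weight T \<mu>) R" and u: "\<And>l y. y \<in> N \<Longrightarrow> u l y = mpow \<mu> l * g y + R l y" by blast
    show "?Q (up i \<mu>) (\<lambda>l. twisted_der T l i (u l))"
    proof (cases "i \<in> T")
      case True
      have "low_weight (weight T (up i \<mu>)) (\<lambda>l y. l i * R l y)" unfolding weight_up by (rule low_weight_mult[OF R])
      with True show ?thesis
        by (intro exI[of _ "\<lambda>l y. l i * R l y"])
           (simp add: u twisted_on_N mpow_up algebra_simps del: fun_upd_apply)
    next
      case False
      obtain G where G: "low_weight (weight T \<mu>) G" "\<And>l y. y \<in> N \<Longrightarrow> partial i (R l) y = G l y"
        using low_weight_partial[OF R] by blast
      have "partial i (u l) y = mpow \<mu> l * partial i g y + G l y" if y: "y \<in> N" for l y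
      proof -
        have "partial i (u l) y = partial i (\<lambda>y. mpow \<mu> l * g y + R l y) y"
          by (rule partial_N_cong[OF y False u])
        then show ?thesis using y g low_weight_analytic[OF R y]
          by (simp add: partial_add analytic_mult partial_cmult G)
      qed
      moreover have "low_weight (weight T \<mu> + index_weight T i) (\<lambda>l y. mpow \<mu> l * partial i g y + (G l y + l i * R l y))"
        by (intro low_weight.add low_weight.monomial low_weight_mult R low_weight_mono[OF G(1)] analytic_partial g)
           (use False in \<open>auto simp: index_weight_def\<close>)
      ultimately show ?thesis using False
        by (intro exI[of _ "\<lambda>l y. mpow \<mu> l * partial i g y + (G l y + l i * R l y)"])
           (simp add: weight_up u twisted_on_N mpow_up algebra_simps del: fun_upd_apply)
    qed
  qed
  moreover have "iter_der ?\<delta> \<kappa> (\<lambda>l. g) l = iter_der (twisted_der T l) \<kappa> g" for l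
    by (rule iter_der_rel[of "\<lambda>u v. u l = v"]) auto
  ultimately show ?thesis using that by auto
qed

section \<open>The lowest coefficient of a commutator\<close>

text \<open>
  In the Cauchy product for the coefficient of \<open>t\<^sup>\<gamma>\<close> all terms with a lower coefficient of \<open>g\<close>
  vanish.
\<close>

lemma taylor_mult_lowest:
  assumes f: "real_analytic_at f y" and g: "real_analytic_at g y" and \<gamma>: "supported T \<gamma>"
    and 0: "\<And>\<gamma>'. supported T \<gamma>' \<Longrightarrow> deg \<gamma>' < deg \<gamma> \<Longrightarrow> taylor g y \<gamma>' = 0"
  shows "taylor (\<lambda>y. f y * g y) y \<gamma> = f y * taylor g y \<gamma>"
proof -
  have "taylor (\<lambda>y. f y * g y) y \<gamma> = (\<Sum>\<mu> | \<forall>i. \<mu> i \<le> \<gamma> i. if \<mu> = (\<lambda>i. 0) then f y * taylor g y \<gamma> else 0)"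
    unfolding taylor_mult[OF f g] cauchy_product_def
  proof (rule sum.cong[OF refl])
    fix \<mu> :: "'i midx" assume \<mu>: "\<mu> \<in> {\<mu>. \<forall>i. \<mu> i \<le> \<gamma> i}"
    show "taylor f y \<mu> * taylor g y (\<lambda>i. \<gamma> i - \<mu> i) = (if \<mu> = (\<lambda>i. 0) then f y * taylor g y \<gamma> else 0)"
    proof (cases "\<mu> = (\<lambda>i. 0)")
      case False
      then obtain i where "\<mu> i \<noteq> 0" by auto
      then have "deg \<mu> > 0" unfolding deg_def by (intro sum_pos2[of _ i]) auto
      moreover have "deg \<gamma> = deg \<mu> + deg (\<lambda>i. \<gamma> i - \<mu> i)"
        unfolding deg_def sum.distrib [symmetric] using \<mu> by (intro sum.cong) auto
      ultimately have "deg (\<lambda>i. \<gamma> i - \<mu> i) < deg \<gamma>" by simp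
      then have "taylor g y (\<lambda>i. \<gamma> i - \<mu> i) = 0" using \<gamma> by (intro 0) (auto simp: supported_def)
      then show ?thesis using False by simp
    qed (simp add: taylor_zero f)
  qed
  also have "\<dots> = f y * taylor g y \<gamma>" by (subst sum.delta[OF finite_box]) simp
  finally show ?thesis .
qed

lemma iter_symbol:
  assumes a: "\<And>\<kappa> p. p \<in> N \<Longrightarrow> real_analytic_at (a \<kappa>) p" and y: "y \<in> N"
  shows "iter_der (twisted_der T l) \<kappa> (symbol K a l') y = (\<Sum>\<alpha>\<in>K. mpow \<alpha> l' * iter_der (twisted_der T l) \<kappa> (a \<alpha>) y)"
proof -
  have "near_eq y (iter_der (twisted_der T l) \<kappa> (\<lambda>y. \<Sum>\<alpha>\<in>K. mpow \<alpha> l' * a \<alpha> y)) (\<lambda>y. \<Sum>\<alpha>\<in>K. mpow \<alpha> l' * iter_der (twisted_der T l) \<kappa> (a \<alpha>) y)"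
    by (rule iter_lin) (rule a[OF y])
  from near_eq_at[OF this] show ?thesis by (simp add: symbol_def[abs_def] mult.commute)
qed

text \<open>
  The identity \<open>p(x, \<vartheta> + \<gamma>) D\<^sub>\<gamma> = D\<^sub>\<gamma> p(x, \<vartheta>)\<close>, evaluated on the twist by \<open>l\<close>. On the left, the
  shift by \<open>\<gamma>\<close> comes from \<open>taylor_iter\<close>, and \<open>star\<close> says that \<open>P\<close> contains no \<open>x\<close>-derivatives on \<open>N\<close>.
  On the right these derivatives remain, since \<open>D\<^sub>\<gamma>\<close> contains them.
\<close>

lemma lowest_term:
  fixes a d :: "'m::finite \<Rightarrow> 'm \<Rightarrow> 'i midx \<Rightarrow> (real ^ 'i) \<Rightarrow> complex"
  assumes a: "\<And>i j \<kappa> p. p \<in> N \<Longrightarrow> real_analytic_at (a i j \<kappa>) p" and d: "\<And>i j \<kappa> p. p \<in> N \<Longrightarrow> real_analytic_at (d i j \<kappa>) p"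
    and comm: "\<And>i j p. p \<in> N \<Longrightarrow> near_eq p (\<lambda>y. \<Sum>k\<in>UNIV. twisted_op T l K (a i k) (symbol L (d k j) l) y)
        (\<lambda>y. \<Sum>k\<in>UNIV. twisted_op T l L (d i k) (symbol K (a k j) l) y)"
    and star: "\<And>i j \<kappa> y. y \<in> N \<Longrightarrow> \<not> supported T \<kappa> \<Longrightarrow> a i j \<kappa> y = 0"
    and \<gamma>: "supported T \<gamma>"
    and vanish: "\<And>\<gamma>' i j \<kappa> y. supported T \<gamma>' \<Longrightarrow> deg \<gamma>' < deg \<gamma> \<Longrightarrow> y \<in> N \<Longrightarrow> taylor (d i j \<kappa>) y \<gamma>' = 0"
    and y: "y \<in> N"
  shows "(\<Sum>k\<in>UNIV. symbol K (a i k) (\<lambda>\<nu>. l \<nu> + of_nat (\<gamma> \<nu>)) y * symbol L (\<lambda>\<kappa> y. taylor (d k j \<kappa>) y \<gamma>) l y)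
    = (\<Sum>k\<in>UNIV. \<Sum>\<kappa>\<in>L. taylor (d i k \<kappa>) y \<gamma> * iter_der (twisted_der T l) \<kappa> (symbol K (a k j) l) y)"
proof -
  let ?l = "\<lambda>\<nu>. l \<nu> + of_nat (\<gamma> \<nu>)"
  have tay_d: "taylor (symbol L (d k j) l) y \<gamma>' = symbol L (\<lambda>\<kappa> y. taylor (d k j \<kappa>) y \<gamma>') l y" if "y \<in> N" for k j \<gamma>' y
  proof -
    have "taylor (\<lambda>y. \<Sum>\<kappa>\<in>L. mpow \<kappa> l * d k j \<kappa> y) y \<gamma>' = (\<Sum>\<kappa>\<in>L. mpow \<kappa> l * taylor (d k j \<kappa>) y \<gamma>')"
      using d[OF that] by (subst taylor_sum) (auto simp: taylor_cmult intro: analytic_mult)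
    then show ?thesis by (simp add: symbol_def[abs_def] mult.commute)
  qed
  have ana_d: "real_analytic_at (symbol L (d k j) l) p" if "p \<in> N" for k j p by (intro analytic_symbol d that)
  have left: "taylor (twisted_op T l K (a i k) (symbol L (d k j) l)) y \<gamma>
      = symbol K (a i k) ?l y * symbol L (\<lambda>\<kappa> y. taylor (d k j \<kappa>) y \<gamma>) l y" for k
  proof -
    let ?s = "symbol L (d k j) l"
    have "taylor (\<lambda>y. a i k \<kappa> y * iter_der (twisted_der T l) \<kappa> ?s y) y \<gamma> = a i k \<kappa> y * (mpow \<kappa> ?l * taylor ?s y \<gamma>)" for \<kappa>
    proof -
      have "taylor (\<lambda>y. a i k \<kappa> y * iter_der (twisted_der T l) \<kappa> ?s y) y \<gamma> = a i k \<kappa> y * taylor (iter_der (twisted_der T l) \<kappa> ?s) y \<gamma>"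
      proof (rule taylor_mult_lowest[OF a[OF y] analytic_iter[OF ana_d[OF y]] \<gamma>])
        fix \<gamma>' assume \<gamma>': "supported T \<gamma>'" "deg \<gamma>' < deg \<gamma>"
        have "taylor (iter_der (twisted_der T l) \<kappa> ?s) y \<gamma>' = iter_der (twisted_der T (\<lambda>i. l i + of_nat (\<gamma>' i))) \<kappa> (\<lambda>y. taylor ?s y \<gamma>') y"
          by (rule taylor_iter[OF ana_d \<gamma>'(1) y])
        also have "\<dots> = 0"
          by (rule iter_N_zero[OF _ y]) (simp add: tay_d symbol_def vanish[OF \<gamma>'])
        finally show "taylor (iter_der (twisted_der T l) \<kappa> ?s) y \<gamma>' = 0" .
      qed
      also have "taylor (iter_der (twisted_der T l) \<kappa> ?s) y \<gamma> = iter_der (twisted_der T ?l) \<kappa> (\<lambda>y. taylor ?s y \<gamma>) y"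
        by (rule taylor_iter[OF ana_d \<gamma> y])
      also have "a i k \<kappa> y * \<dots> = a i k \<kappa> y * (mpow \<kappa> ?l * taylor ?s y \<gamma>)"
      proof (cases "supported T \<kappa>")
        case True
        then have 0: "(\<lambda>i. if i \<in> T then 0 else \<kappa> i) = (\<lambda>i. 0)" by (auto simp: supported_def)
        have "mpow \<kappa> ?l = (\<Prod>i\<in>T. ?l i ^ \<kappa> i)"
          unfolding mpow_def using True by (intro prod.mono_neutral_right) (auto simp: supported_def)
        then show ?thesis
          by (simp add: iter_N_split[OF analytic_taylor[OF ana_d] y] 0)
      qed (simp add: star[OF y])
      finally show ?thesis .
    qed
    then have "(\<Sum>\<kappa>\<in>K. taylor (\<lambda>y. a i k \<kappa> y * iter_der (twisted_der T l) \<kappa> ?s y) y \<gamma>) = symbol K (a i k) ?l y * taylor ?s y \<gamma>"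
      by (simp add: symbol_def sum_distrib_right mult.assoc)
    then show ?thesis unfolding twisted_op_def
      by (subst taylor_sum) (auto intro!: analytic_mult a analytic_iter ana_d y simp: tay_d[OF y])
  qed
  have right: "taylor (twisted_op T l L (d i k) (symbol K (a k j) l)) y \<gamma>
      = (\<Sum>\<kappa>\<in>L. taylor (d i k \<kappa>) y \<gamma> * iter_der (twisted_der T l) \<kappa> (symbol K (a k j) l) y)" for k
  proof -
    let ?s = "\<lambda>\<kappa>. iter_der (twisted_der T l) \<kappa> (symbol K (a k j) l)"
    have ana_s: "real_analytic_at (?s \<kappa>) y" for \<kappa> by (intro analytic_iter analytic_symbol a y)
    have "taylor (\<lambda>y. ?s \<kappa> y * d i k \<kappa> y) y \<gamma> = ?s \<kappa> y * taylor (d i k \<kappa>) y \<gamma>" for \<kappa>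
      by (rule taylor_mult_lowest[OF ana_s d[OF y] \<gamma> vanish]) (auto simp: y)
    then have "taylor (\<lambda>y. d i k \<kappa> y * ?s \<kappa> y) y \<gamma> = taylor (d i k \<kappa>) y \<gamma> * ?s \<kappa> y" for \<kappa>
      by (simp only: mult.commute)
    then show ?thesis unfolding twisted_op_def
      by (subst taylor_sum) (auto intro!: analytic_mult d ana_s y)
  qed
  have "taylor (\<lambda>y. \<Sum>k\<in>UNIV. twisted_op T l K (a i k) (symbol L (d k j) l) y) y \<gamma>
      = taylor (\<lambda>y. \<Sum>k\<in>UNIV. twisted_op T l L (d i k) (symbol K (a k j) l) y) y \<gamma>"
    by (subst taylor_cong[OF comm[OF y]]) (auto intro!: analytic_sum analytic_twisted_op ana_d a y)
  then show ?thesis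
    by (simp add: taylor_sum analytic_twisted_op analytic_symbol a d y left right)
qed

end

context crossing
begin

section \<open>The leading part of the lowest coefficient\<close>

text \<open>
  Evaluate the identity of the lowest coefficients at the weighted dilation \<open>l = s \<cdot> \<xi>\<close>, move
  \<open>\<Sum>\<^sub>r q\<^sub>i\<^sub>r p\<^sub>r\<^sub>j\<close> to the left, divide by \<open>s\<^bsup>k + \<omega>\<^esup>\<close> and let \<open>s\<close> tend to infinity. Here \<open>k + 1\<close> is the order
  of \<open>P\<close>, and \<open>\<omega>\<close> is the weight of \<open>D\<^sub>\<gamma>\<close>. The left hand side tends to the product of the two leading parts, and the
  right hand side tends to 0.
\<close>

lemma leading_coefficient:
  fixes a :: "'m::finite \<Rightarrow> 'm \<Rightarrow> 'i midx \<Rightarrow> (real ^ 'i) \<Rightarrow> complex" and c :: "'m \<Rightarrow> 'm \<Rightarrow> 'i midx \<Rightarrow> complex"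
  assumes K: "finite K" and L: "finite L" and y: "y \<in> N"
    and a: "\<And>i j \<kappa> p. p \<in> N \<Longrightarrow> real_analytic_at (a i j \<kappa>) p"
    and star: "\<And>i j \<kappa> y. y \<in> N \<Longrightarrow> \<not> supported T \<kappa> \<Longrightarrow> a i j \<kappa> y = 0"
    and order: "\<And>i j \<kappa> y. y \<in> N \<Longrightarrow> deg \<kappa> > Suc k \<Longrightarrow> a i j \<kappa> y = 0"
    and scalar: "\<And>i j \<kappa>. deg \<kappa> \<ge> k \<Longrightarrow> a i j \<kappa> y = (if i = j then b \<kappa> else 0)"
    and top: "\<And>i j \<kappa>. \<kappa> \<in> L \<Longrightarrow> c i j \<kappa> \<noteq> 0 \<Longrightarrow> weight T \<kappa> \<le> \<omega>"
    and eq: "\<And>l. (\<Sum>r\<in>UNIV. symbol K (a i r) (\<lambda>\<nu>. l \<nu> + of_nat (\<gamma> \<nu>)) y * (\<Sum>\<kappa>\<in>L. c r j \<kappa> * mpow \<kappa> l))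
      = (\<Sum>r\<in>UNIV. \<Sum>\<kappa>\<in>L. c i r \<kappa> * iter_der (twisted_der T l) \<kappa> (symbol K (a r j) l) y)"
  shows "(\<Sum>\<alpha> | \<alpha> \<in> K \<and> deg \<alpha> = Suc k. b \<alpha> * dir_deriv \<gamma> \<alpha> \<xi>)
    * (\<Sum>\<kappa> | \<kappa> \<in> L \<and> weight T \<kappa> = \<omega>. c i j \<kappa> * mpow \<kappa> \<xi>) = 0"
proof -
  define l where "l s = scaled T \<xi> s" for s
  define l' where "l' s = (\<lambda>\<nu>. l s \<nu> + of_nat (\<gamma> \<nu>))" for s
  define q where "q i j l = (\<Sum>\<kappa>\<in>L. c i j \<kappa> * mpow \<kappa> l)" for i j l
  define qt where "qt i j = (\<Sum>\<kappa> | \<kappa> \<in> L \<and> weight T \<kappa> = \<omega>. c i j \<kappa> * mpow \<kappa> \<xi>)" for i j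
  define P where "P l = (\<Sum>\<alpha> | \<alpha> \<in> K \<and> deg \<alpha> \<ge> k. b \<alpha> * mpow \<alpha> l)" for l
  define E where "E i j l = (\<Sum>\<alpha> | \<alpha> \<in> K \<and> deg \<alpha> < k. a i j \<alpha> y * mpow \<alpha> l)" for i j l
  define G where "G = (\<Sum>\<alpha> | \<alpha> \<in> K \<and> deg \<alpha> = Suc k. b \<alpha> * dir_deriv \<gamma> \<alpha> \<xi>)"
  have pos: "\<forall>\<^sub>F s::nat in sequentially. s > 0" by (rule eventually_gt_at_top)
  have b0: "b \<alpha> = 0" if "k \<le> deg \<alpha>" "\<not> supported T \<alpha> \<or> deg \<alpha> > Suc k" for \<alpha>
    using that star[OF y, of \<alpha> i i] order[OF y, of \<alpha> i i] scalar[of \<alpha> i i] by auto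
  \<comment> \<open>the parts of degrees \<open>k\<close> and \<open>k + 1\<close> are scalar, and the remainder \<open>E\<close> has degree below \<open>k\<close>\<close>
  have decomp: "symbol K (a i j) l y = (if i = j then P l else 0) + E i j l" for i j l
  proof -
    have "K = {\<alpha>. \<alpha> \<in> K \<and> deg \<alpha> \<ge> k} \<union> {\<alpha>. \<alpha> \<in> K \<and> deg \<alpha> < k}" by auto
    then have "symbol K (a i j) l y = (\<Sum>\<alpha> | \<alpha> \<in> K \<and> deg \<alpha> \<ge> k. a i j \<alpha> y * mpow \<alpha> l) + E i j l"
      unfolding symbol_def E_def by (subst sum.union_disjoint [symmetric]) (use K in auto)
    also have "(\<Sum>\<alpha> | \<alpha> \<in> K \<and> deg \<alpha> \<ge> k. a i j \<alpha> y * mpow \<alpha> l) = (if i = j then P l else 0)"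
      unfolding P_def by (auto simp: scalar intro!: sum.neutral)
    finally show ?thesis .
  qed
  have shift: "mpow \<alpha> (l' s) = mpow \<alpha> (\<lambda>i. of_nat s * \<xi> i + of_nat (\<gamma> i))"
    "mpow \<alpha> (l s) = mpow \<alpha> (\<lambda>i. of_nat s * \<xi> i)" if "supported T \<alpha>" for \<alpha> s
    by (rule mpow_cong[OF that], simp add: l'_def l_def scaled_def index_weight_def)+
  have limP: "(\<lambda>s. (P (l' s) - P (l s)) / of_nat s ^ k) \<longlonglongrightarrow> G"
  proof -
    have "(\<lambda>s. b \<alpha> * ((mpow \<alpha> (l' s) - mpow \<alpha> (l s)) / of_nat s ^ k))
        \<longlonglongrightarrow> (if deg \<alpha> = Suc k then b \<alpha> * dir_deriv \<gamma> \<alpha> \<xi> else 0)" if k: "k \<le> deg \<alpha>" for \<alpha>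
    proof (cases "supported T \<alpha> \<and> deg \<alpha> \<le> Suc k")
      case True
      then consider "deg \<alpha> = Suc k" | "deg \<alpha> = k" using k by linarith
      then show ?thesis
      proof cases
        case 1
        from tendsto_mult_left[OF lim_mpow_shift_diff[OF 1]] show ?thesis using 1 True by (simp add: shift)
      next
        case 2
        have "(\<lambda>s. mpow \<alpha> (\<lambda>i. of_nat s * \<xi> i + of_nat (\<gamma> i)) / of_nat s ^ deg \<alpha>
            - mpow \<alpha> (\<lambda>i. of_nat s * \<xi> i + of_nat ((\<lambda>_. 0) i)) / of_nat s ^ deg \<alpha>) \<longlonglongrightarrow> mpow \<alpha> \<xi> - mpow \<alpha> \<xi>"
          by (intro tendsto_diff lim_mpow_shift_eq)
        from tendsto_mult_left[OF this, of "b \<alpha>"] show ?thesis using 2 True by (simp add: shift diff_divide_distrib)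
      qed
    qed (use b0 k in auto)
    then have "(\<lambda>s. \<Sum>\<alpha> | \<alpha> \<in> K \<and> deg \<alpha> \<ge> k. b \<alpha> * ((mpow \<alpha> (l' s) - mpow \<alpha> (l s)) / of_nat s ^ k))
        \<longlonglongrightarrow> (\<Sum>\<alpha> | \<alpha> \<in> K \<and> deg \<alpha> \<ge> k. if deg \<alpha> = Suc k then b \<alpha> * dir_deriv \<gamma> \<alpha> \<xi> else 0)"
      by (intro tendsto_sum) auto
    moreover have "(\<Sum>\<alpha> | \<alpha> \<in> K \<and> deg \<alpha> \<ge> k. if deg \<alpha> = Suc k then b \<alpha> * dir_deriv \<gamma> \<alpha> \<xi> else 0) = G"
      unfolding G_def using K by (intro sum.mono_neutral_cong_right) auto
    ultimately show ?thesis
      by (simp add: P_def sum_subtractf [symmetric] sum_divide_distrib right_diff_distrib)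
  qed
  have limE': "(\<lambda>s. E i j (l' s) / of_nat s ^ k) \<longlonglongrightarrow> 0" for i j
  proof -
    have "(\<lambda>s. \<Sum>\<alpha> | \<alpha> \<in> K \<and> deg \<alpha> < k. a i j \<alpha> y * (mpow \<alpha> (l' s) / of_nat s ^ k))
        \<longlonglongrightarrow> (\<Sum>\<alpha> | \<alpha> \<in> K \<and> deg \<alpha> < k. a i j \<alpha> y * 0)"
    proof (rule tendsto_sum)
      fix \<alpha> assume \<alpha>: "\<alpha> \<in> {\<alpha>. \<alpha> \<in> K \<and> deg \<alpha> < k}"
      show "(\<lambda>s. a i j \<alpha> y * (mpow \<alpha> (l' s) / of_nat s ^ k)) \<longlonglongrightarrow> a i j \<alpha> y * 0"
      proof (cases "supported T \<alpha>")
        case True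
        then show ?thesis using \<alpha> by (intro tendsto_mult_left) (simp add: shift lim_mpow_shift_less)
      qed (simp add: star[OF y])
    qed
    then show ?thesis by (simp add: E_def sum_divide_distrib)
  qed
  have limE: "(\<lambda>s. E i j (l s) / of_nat s ^ k) \<longlonglongrightarrow> 0" for i j
  proof -
    have "(\<lambda>s. \<Sum>\<alpha> | \<alpha> \<in> K \<and> deg \<alpha> < k. a i j \<alpha> y * (mpow \<alpha> (l s) / of_nat s ^ k))
        \<longlonglongrightarrow> (\<Sum>\<alpha> | \<alpha> \<in> K \<and> deg \<alpha> < k. a i j \<alpha> y * 0)"
    proof (rule tendsto_sum)
      fix \<alpha> assume \<alpha>: "\<alpha> \<in> {\<alpha>. \<alpha> \<in> K \<and> deg \<alpha> < k}"
      show "(\<lambda>s. a i j \<alpha> y * (mpow \<alpha> (l s) / of_nat s ^ k)) \<longlonglongrightarrow> a i j \<alpha> y * 0"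
      proof (cases "supported T \<alpha>")
        case True
        have "(\<lambda>s. mpow \<alpha> (\<lambda>i. of_nat s * \<xi> i + of_nat ((\<lambda>_. 0) i)) / of_nat s ^ k) \<longlonglongrightarrow> 0"
          by (rule lim_mpow_shift_less) (use \<alpha> in auto)
        then show ?thesis using True by (intro tendsto_mult_left) (simp add: shift)
      qed (simp add: star[OF y])
    qed
    then show ?thesis by (simp add: E_def sum_divide_distrib)
  qed
  have limq: "(\<lambda>s. q i j (l s) / of_nat s ^ \<omega>) \<longlonglongrightarrow> qt i j" for i j
  proof -
    have "(\<lambda>s. \<Sum>\<kappa>\<in>L. c i j \<kappa> * mpow \<kappa> \<xi> * (of_nat s ^ weight T \<kappa> / of_nat s ^ \<omega>))
        \<longlonglongrightarrow> (\<Sum>\<kappa>\<in>L. if weight T \<kappa> = \<omega> then c i j \<kappa> * mpow \<kappa> \<xi> else 0)"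
    proof (rule tendsto_sum)
      fix \<kappa> assume \<kappa>: "\<kappa> \<in> L"
      consider "weight T \<kappa> = \<omega>" | "weight T \<kappa> < \<omega>" | "c i j \<kappa> = 0" using top[OF \<kappa>] by force
      then show "(\<lambda>s. c i j \<kappa> * mpow \<kappa> \<xi> * (of_nat s ^ weight T \<kappa> / of_nat s ^ \<omega>))
        \<longlonglongrightarrow> (if weight T \<kappa> = \<omega> then c i j \<kappa> * mpow \<kappa> \<xi> else 0)"
      proof cases
        case 1
        have "\<forall>\<^sub>F s in sequentially. c i j \<kappa> * mpow \<kappa> \<xi> = c i j \<kappa> * mpow \<kappa> \<xi> * (of_nat s ^ weight T \<kappa> / of_nat s ^ \<omega>)"
          using pos by eventually_elim (simp add: 1)
        from Lim_transform_eventually[OF tendsto_const this] show ?thesis using 1 by simp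
      next
        case 2
        from tendsto_mult_left[OF lim_pow_ratio[OF 2], of "c i j \<kappa> * mpow \<kappa> \<xi>"] 2 show ?thesis by simp
      qed simp
    qed
    moreover have "(\<Sum>\<kappa>\<in>L. if weight T \<kappa> = \<omega> then c i j \<kappa> * mpow \<kappa> \<xi> else 0) = qt i j"
      unfolding qt_def using L by (intro sum.mono_neutral_cong_right) auto
    moreover have "q i j (l s) / of_nat s ^ \<omega> = (\<Sum>\<kappa>\<in>L. c i j \<kappa> * mpow \<kappa> \<xi> * (of_nat s ^ weight T \<kappa> / of_nat s ^ \<omega>))" for s
      by (simp add: q_def l_def mpow_scaled sum_divide_distrib mult_ac)
    ultimately show ?thesis by simp
  qed
  let ?M = "k + \<omega>"
  let ?it = "\<lambda>s \<kappa> f. iter_der (twisted_der T (l s)) \<kappa> f y"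
  \<comment> \<open>derivatives of the coefficients of \<open>P\<close> lose two units of weight, one more than the normalization allows for\<close>
  have limR: "(\<lambda>s. c i r \<kappa> * (mpow \<alpha> (l s) * (?it s \<kappa> (a r j \<alpha>) - mpow \<kappa> (l s) * a r j \<alpha> y)) / of_nat s ^ ?M) \<longlonglongrightarrow> 0"
    if \<kappa>: "\<kappa> \<in> L" for r \<kappa> \<alpha>
  proof (cases "c i r \<kappa> \<noteq> 0 \<and> supported T \<alpha> \<and> deg \<alpha> \<le> Suc k")
    case True
    obtain R where R: "low_weight (weight T \<kappa>) R"
      "\<And>l y. y \<in> N \<Longrightarrow> iter_der (twisted_der T l) \<kappa> (a r j \<alpha>) y = mpow \<kappa> l * a r j \<alpha> y + R l y"
      using iter_leading[of "a r j \<alpha>" \<kappa>] a by blast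
    define n where "n = Suc ?M - deg \<alpha>"
    have n: "weight T \<kappa> \<le> n" "Suc ?M = n + deg \<alpha>" using True top[OF \<kappa>, of i r] by (auto simp: n_def)
    from tendsto_mult_left[OF low_weight_lim[OF low_weight_mono[OF R(1) n(1)] y, of \<xi>], of "c i r \<kappa> * mpow \<alpha> \<xi>"]
    have "(\<lambda>s. c i r \<kappa> * mpow \<alpha> \<xi> * (of_nat s * R (l s) y / of_nat s ^ n)) \<longlonglongrightarrow> 0" by (simp add: l_def)
    moreover have "\<forall>\<^sub>F s in sequentially. c i r \<kappa> * mpow \<alpha> \<xi> * (of_nat s * R (l s) y / of_nat s ^ n)
        = c i r \<kappa> * (mpow \<alpha> (l s) * (?it s \<kappa> (a r j \<alpha>) - mpow \<kappa> (l s) * a r j \<alpha> y)) / of_nat s ^ ?M"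
      using pos
    proof eventually_elim
      case (elim s)
      have "of_nat s * R (l s) y / of_nat s ^ n = of_nat s ^ deg \<alpha> * R (l s) y / of_nat s ^ ?M"
      proof -
        have "(of_nat s :: complex) * of_nat s ^ ?M = of_nat s ^ n * of_nat s ^ deg \<alpha>"
          using n(2) by (metis power_Suc power_add)
        then show ?thesis using elim by (simp add: frac_eq_eq mult_ac)
      qed
      moreover have "mpow \<alpha> (l s) = of_nat s ^ deg \<alpha> * mpow \<alpha> \<xi>"
        using True by (simp add: l_def mpow_scaled weight_supported)
      ultimately show ?case by (simp add: R(2)[OF y])
    qed
    ultimately show ?thesis by (rule Lim_transform_eventually)
  next
    case False
    show ?thesis
    proof (cases "c i r \<kappa> = 0")
      case False2: False
      then have 0: "a r j \<alpha> z = 0" if "z \<in> N" for z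
        using False star[OF that] order[OF that] by auto
      then have "?it s \<kappa> (a r j \<alpha>) = 0" for s by (intro iter_N_zero y)
      then show ?thesis using 0[OF y] by simp
    qed simp
  qed
  have lim0: "(\<lambda>s. (\<Sum>r\<in>UNIV. symbol K (a i r) (l' s) y * q r j (l s) - q i r (l s) * symbol K (a r j) (l s) y) / of_nat s ^ ?M) \<longlonglongrightarrow> 0"
  proof -
    have "(\<lambda>s. \<Sum>r\<in>UNIV. \<Sum>\<kappa>\<in>L. \<Sum>\<alpha>\<in>K. c i r \<kappa> * (mpow \<alpha> (l s) * (?it s \<kappa> (a r j \<alpha>) - mpow \<kappa> (l s) * a r j \<alpha> y)) / of_nat s ^ ?M)
        \<longlonglongrightarrow> (\<Sum>r\<in>(UNIV::'m set). \<Sum>\<kappa>\<in>L. \<Sum>\<alpha>\<in>K. 0)"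
      by (intro tendsto_sum limR)
    moreover have "(\<Sum>r\<in>UNIV. \<Sum>\<kappa>\<in>L. \<Sum>\<alpha>\<in>K. c i r \<kappa> * (mpow \<alpha> (l s) * (?it s \<kappa> (a r j \<alpha>) - mpow \<kappa> (l s) * a r j \<alpha> y)) / of_nat s ^ ?M)
        = (\<Sum>r\<in>UNIV. symbol K (a i r) (l' s) y * q r j (l s) - q i r (l s) * symbol K (a r j) (l s) y) / of_nat s ^ ?M" for s
    proof -
      have "(\<Sum>r\<in>UNIV. symbol K (a i r) (l' s) y * q r j (l s)) = (\<Sum>r\<in>UNIV. \<Sum>\<kappa>\<in>L. c i r \<kappa> * ?it s \<kappa> (symbol K (a r j) (l s)))"
        unfolding l'_def q_def by (rule eq)
      also have "\<dots> = (\<Sum>r\<in>UNIV. \<Sum>\<kappa>\<in>L. \<Sum>\<alpha>\<in>K. c i r \<kappa> * (mpow \<alpha> (l s) * ?it s \<kappa> (a r j \<alpha>)))"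
        by (simp add: iter_symbol[OF a y] sum_distrib_left)
      finally have 1: "(\<Sum>r\<in>UNIV. symbol K (a i r) (l' s) y * q r j (l s)) = \<dots>" .
      have 2: "(\<Sum>r\<in>UNIV. q i r (l s) * symbol K (a r j) (l s) y)
          = (\<Sum>r\<in>UNIV. \<Sum>\<kappa>\<in>L. \<Sum>\<alpha>\<in>K. c i r \<kappa> * (mpow \<alpha> (l s) * (mpow \<kappa> (l s) * a r j \<alpha> y)))"
        by (simp add: q_def symbol_def sum_product mult_ac)
      show ?thesis
        unfolding sum_subtractf 1 2 by (simp add: sum_subtractf [symmetric] sum_divide_distrib right_diff_distrib)
    qed
    ultimately show ?thesis by simp
  qed
  have limG: "(\<lambda>s. (\<Sum>r\<in>UNIV. symbol K (a i r) (l' s) y * q r j (l s) - q i r (l s) * symbol K (a r j) (l s) y) / of_nat s ^ ?M) \<longlonglongrightarrow> G * qt i j"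
  proof -
    have "(\<lambda>s. (P (l' s) - P (l s)) / of_nat s ^ k * (q i j (l s) / of_nat s ^ \<omega>)
        + (\<Sum>r\<in>UNIV. E i r (l' s) / of_nat s ^ k * (q r j (l s) / of_nat s ^ \<omega>)
           - q i r (l s) / of_nat s ^ \<omega> * (E r j (l s) / of_nat s ^ k)))
        \<longlonglongrightarrow> G * qt i j + (\<Sum>r\<in>(UNIV::'m set). 0 * qt r j - qt i r * 0)"
      by (intro tendsto_add tendsto_mult tendsto_sum tendsto_diff limP limq limE limE')
    moreover have "(P (l' s) - P (l s)) / of_nat s ^ k * (q i j (l s) / of_nat s ^ \<omega>)
        + (\<Sum>r\<in>UNIV. E i r (l' s) / of_nat s ^ k * (q r j (l s) / of_nat s ^ \<omega>)
           - q i r (l s) / of_nat s ^ \<omega> * (E r j (l s) / of_nat s ^ k))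
        = (\<Sum>r\<in>UNIV. symbol K (a i r) (l' s) y * q r j (l s) - q i r (l s) * symbol K (a r j) (l s) y) / of_nat s ^ ?M" for s
    proof -
      have "(\<Sum>r\<in>UNIV. symbol K (a i r) (l' s) y * q r j (l s)) = P (l' s) * q i j (l s) + (\<Sum>r\<in>UNIV. E i r (l' s) * q r j (l s))"
        by (simp add: decomp distrib_right sum.distrib if_distrib[of "\<lambda>x. x * _"] cong: if_cong)
      moreover have "(\<Sum>r\<in>UNIV. q i r (l s) * symbol K (a r j) (l s) y) = q i j (l s) * P (l s) + (\<Sum>r\<in>UNIV. q i r (l s) * E r j (l s))"
        by (simp add: decomp distrib_left sum.distrib if_distrib[of "\<lambda>x. _ * x"] cong: if_cong)
      ultimately have "(\<Sum>r\<in>UNIV. symbol K (a i r) (l' s) y * q r j (l s) - q i r (l s) * symbol K (a r j) (l s) y)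
          = (P (l' s) - P (l s)) * q i j (l s) + (\<Sum>r\<in>UNIV. E i r (l' s) * q r j (l s) - q i r (l s) * E r j (l s))"
        by (simp add: sum_subtractf algebra_simps)
      moreover have "E i r (l' s) / of_nat s ^ k * (q r j (l s) / of_nat s ^ \<omega>)
           - q i r (l s) / of_nat s ^ \<omega> * (E r j (l s) / of_nat s ^ k)
          = (E i r (l' s) * q r j (l s) - q i r (l s) * E r j (l s)) / of_nat s ^ ?M" for r
        by (simp add: power_add diff_divide_distrib mult_ac)
      moreover have "(P (l' s) - P (l s)) / of_nat s ^ k * (q i j (l s) / of_nat s ^ \<omega>)
          = (P (l' s) - P (l s)) * q i j (l s) / of_nat s ^ ?M"
        by (simp add: power_add)
      ultimately show ?thesis by (simp only: add_divide_distrib sum_divide_distrib)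
    qed
    ultimately show ?thesis by simp
  qed
  show ?thesis using LIMSEQ_unique[OF limG lim0] by (simp add: G_def qt_def)
qed

text \<open>
  As \<open>\<gamma>\<close> and \<open>\<beta>\<close> have disjoint supports, no binomial factor arises.
\<close>

lemma taylor_taylor:
  assumes "real_analytic_at g p" and \<gamma>: "supported T \<gamma>" and \<beta>: "supported (- T) \<beta>"
  shows "taylor (\<lambda>y. taylor g y \<gamma>) p \<beta> = taylor g p (\<lambda>i. \<gamma> i + \<beta> i)"
  using assms(1) \<beta>
proof (induction \<beta> arbitrary: g rule: midx_induct)
  case zero
  then show ?case by (simp add: taylor_zero analytic_taylor)
next
  case (up i \<beta>)
  have i: "\<gamma> i = 0" and s: "supported (- T) \<beta>"
    using up(3) \<gamma> by (auto simp: supported_def split: if_splits)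
  have "near_eq p (partial i (\<lambda>y. taylor g y \<gamma>)) (\<lambda>y. taylor (partial i g) y \<gamma>)"
    unfolding near_eq_def by (rule eventually_mono[OF analytic_near[OF up(2)]]) (rule partial_taylor)
  from taylor_cong[OF this] have "taylor (partial i (\<lambda>y. taylor g y \<gamma>)) p \<beta> = taylor (\<lambda>y. taylor (partial i g) y \<gamma>) p \<beta>"
    by (simp add: analytic_partial analytic_taylor up(2))
  also have "\<dots> = taylor (partial i g) p (\<lambda>i. \<gamma> i + \<beta> i)" by (intro up(1) analytic_partial up(2) s)
  also have "\<dots> = of_nat (Suc (\<beta> i)) * taylor g p (up i (\<lambda>i. \<gamma> i + \<beta> i))"
    using i by (simp add: taylor_partial up(2) del: of_nat_Suc fun_upd_apply)
  finally have "of_nat (Suc (\<beta> i)) * taylor (\<lambda>y. taylor g y \<gamma>) p (up i \<beta>) = of_nat (Suc (\<beta> i)) * taylor g p (up i (\<lambda>i. \<gamma> i + \<beta> i))"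
    by (simp add: taylor_partial analytic_taylor up(2) del: of_nat_Suc fun_upd_apply)
  moreover have "up i (\<lambda>i. \<gamma> i + \<beta> i) = (\<lambda>j. \<gamma> j + up i \<beta> j)" by auto
  ultimately show ?case by (simp del: of_nat_Suc fun_upd_apply)
qed

text \<open>
  The injectivity argument for coefficient functions: \<open>a\<close> are the coefficients of \<open>P\<close>, and \<open>d\<close> those
  of an operator matrix that commutes with \<open>P\<close> and vanishes under \<open>\<sigma>\<^sub>*\<close>. The function \<open>b\<close> is the scalar by which
  the top two homogeneous parts of \<open>P\<close> act on \<open>N\<close>.
\<close>

lemma commuting_zero:
  fixes a d :: "'m::finite \<Rightarrow> 'm \<Rightarrow> 'i midx \<Rightarrow> (real ^ 'i) \<Rightarrow> complex"
  assumes N: "connected N"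
    and a: "\<And>i j. coeff_family N UNIV K (a i j)" and d: "\<And>i j. coeff_family N UNIV L (d i j)"
    and comm: "\<And>l i j p. p \<in> N \<Longrightarrow> near_eq p (\<lambda>y. \<Sum>k\<in>UNIV. twisted_op T l K (a i k) (symbol L (d k j) l) y)
        (\<lambda>y. \<Sum>k\<in>UNIV. twisted_op T l L (d i k) (symbol K (a k j) l) y)"
    and star: "\<And>i j \<kappa> y. y \<in> N \<Longrightarrow> \<not> supported T \<kappa> \<Longrightarrow> a i j \<kappa> y = 0"
    and order: "\<And>i j \<kappa> y. y \<in> N \<Longrightarrow> deg \<kappa> > n \<Longrightarrow> a i j \<kappa> y = 0"
    and scalar: "\<And>i j \<kappa> y. y \<in> N \<Longrightarrow> Suc (deg \<kappa>) \<ge> n \<Longrightarrow> a i j \<kappa> y = (if i = j then b \<kappa> y else 0)"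
    and nondeg: "\<And>\<gamma>. supported T \<gamma> \<Longrightarrow> \<gamma> \<noteq> (\<lambda>i. 0) \<Longrightarrow>
      \<exists>x\<in>N. \<exists>\<xi>. (\<Sum>\<alpha> | \<alpha> \<in> K \<and> deg \<alpha> = n. b \<alpha> x * dir_deriv \<gamma> \<alpha> \<xi>) \<noteq> 0"
    and d0: "\<And>i j \<kappa> y. y \<in> N \<Longrightarrow> d i j \<kappa> y = 0"
    and p: "p \<in> N"
  shows "near_eq p (d i j \<kappa>) (\<lambda>_. 0)"
proof -
  have K: "finite K" and L: "finite L" using a d by (auto simp: coeff_family_def)
  have ana_a: "real_analytic_at (a i j \<kappa>) p" and ana_d: "real_analytic_at (d i j \<kappa>) p" if "p \<in> N" for i j \<kappa> p
    using a d that by (auto simp: coeff_family_def)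
  define bad where "bad \<gamma> \<longleftrightarrow> supported T \<gamma> \<and> (\<exists>i j \<kappa>. \<exists>y\<in>N. taylor (d i j \<kappa>) y \<gamma> \<noteq> 0)" for \<gamma>
  have no_bad: "\<not> bad \<gamma>" for \<gamma>
  proof
    assume "bad \<gamma>"
    then obtain \<gamma> where \<gamma>: "bad \<gamma>" and least: "\<And>\<gamma>'. bad \<gamma>' \<Longrightarrow> deg \<gamma> \<le> deg \<gamma>'"
      using ex_has_least_nat[of bad \<gamma> deg] by blast
    have s\<gamma>: "supported T \<gamma>" using \<gamma> by (simp add: bad_def)
    have vanish: "taylor (d i j \<kappa>) y \<gamma>' = 0" if "supported T \<gamma>'" "deg \<gamma>' < deg \<gamma>" "y \<in> N" for \<gamma>' i j \<kappa> y
    proof -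
      have "\<not> bad \<gamma>'" using least[of \<gamma>'] that by auto
      then show ?thesis using that by (auto simp: bad_def)
    qed
    have "\<gamma> \<noteq> (\<lambda>i. 0)"
      using \<gamma> by (auto simp: bad_def taylor_zero ana_d d0)
    then obtain x \<xi> where x: "x \<in> N" and nz: "(\<Sum>\<alpha> | \<alpha> \<in> K \<and> deg \<alpha> = n. b \<alpha> x * dir_deriv \<gamma> \<alpha> \<xi>) \<noteq> 0"
      using nondeg s\<gamma> by blast
    have "\<exists>\<alpha>. deg \<alpha> = n \<and> dir_deriv \<gamma> \<alpha> \<xi> \<noteq> 0"
    proof (rule ccontr)
      assume "\<not> ?thesis"
      then have "(\<Sum>\<alpha> | \<alpha> \<in> K \<and> deg \<alpha> = n. b \<alpha> x * dir_deriv \<gamma> \<alpha> \<xi>) = 0" by (intro sum.neutral) auto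
      with nz show False by simp
    qed
    then obtain \<alpha> where \<alpha>: "deg \<alpha> = n" "dir_deriv \<gamma> \<alpha> \<xi> \<noteq> 0" by blast
    have "n \<noteq> 0"
    proof
      assume "n = 0"
      then have "\<alpha> i = 0" for i using \<alpha>(1) by (simp add: deg_def)
      then show False using \<alpha>(2) by (simp add: dir_deriv_def)
    qed
    then obtain k where n: "n = Suc k" by (cases n) auto
    let ?B = "{(i, j, \<kappa>). \<kappa> \<in> L \<and> (\<exists>y\<in>N. taylor (d i j \<kappa>) y \<gamma> \<noteq> 0)}"
    have "?B \<subseteq> UNIV \<times> UNIV \<times> L" by auto
    then have finB: "finite ?B" by (rule finite_subset) (use L in auto)
    have outL: "taylor (d i j \<kappa>) y \<gamma> = 0" if "\<kappa> \<notin> L" for i j \<kappa> y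
      using d[of i j] that by (simp add: coeff_family_def taylor_const)
    \<comment> \<open>the maximal weight of a coefficient of \<open>D\<^sub>\<gamma>\<close> that is nonzero somewhere on \<open>N\<close>, among all matrix entries\<close>
    define \<omega> where "\<omega> = Max ((\<lambda>(i, j, \<kappa>). weight T \<kappa>) ` ?B)"
    have "?B \<noteq> {}" using \<gamma> outL unfolding bad_def by blast
    then have "\<omega> \<in> (\<lambda>(i, j, \<kappa>). weight T \<kappa>) ` ?B" unfolding \<omega>_def using finB by (intro Max_in) auto
    then obtain i j \<kappa> y where top: "\<kappa> \<in> L" "y \<in> N" "taylor (d i j \<kappa>) y \<gamma> \<noteq> 0" "weight T \<kappa> = \<omega>" by auto
    have max: "weight T \<kappa> \<le> \<omega>" if "\<kappa> \<in> L" "taylor (d i j \<kappa>) y \<gamma> \<noteq> 0" "y \<in> N" for i j \<kappa> y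
      unfolding \<omega>_def by (rule Max_ge) (use finB that in force)+
    have lead: "(\<Sum>\<alpha> | \<alpha> \<in> K \<and> deg \<alpha> = n. b \<alpha> y * dir_deriv \<gamma> \<alpha> \<xi>)
        * (\<Sum>\<kappa> | \<kappa> \<in> L \<and> weight T \<kappa> = \<omega>. taylor (d i j \<kappa>) y \<gamma> * mpow \<kappa> \<xi>) = 0" if y: "y \<in> N" for y \<xi>
      unfolding n
    proof (rule leading_coefficient[OF K L y ana_a star, where c = "\<lambda>i j \<kappa>. taylor (d i j \<kappa>) y \<gamma>"])
      fix l
      show "(\<Sum>r\<in>UNIV. symbol K (a i r) (\<lambda>\<nu>. l \<nu> + of_nat (\<gamma> \<nu>)) y * (\<Sum>\<kappa>\<in>L. taylor (d r j \<kappa>) y \<gamma> * mpow \<kappa> l))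
        = (\<Sum>r\<in>UNIV. \<Sum>\<kappa>\<in>L. taylor (d i r \<kappa>) y \<gamma> * iter_der (twisted_der T l) \<kappa> (symbol K (a r j) l) y)"
        using lowest_term[OF ana_a ana_d comm star s\<gamma> vanish y, where l = l and i = i and j = j] by (simp add: symbol_def)
    qed (use order scalar max y n in auto)
    have "taylor (d i j \<kappa>) z \<gamma> = 0" if z: "z \<in> N" and nz: "(\<Sum>\<alpha> | \<alpha> \<in> K \<and> deg \<alpha> = n. b \<alpha> z * dir_deriv \<gamma> \<alpha> \<xi>) \<noteq> 0" for z
    proof (rule poly_factor_zero[where X = "{\<alpha>. \<alpha> \<in> K \<and> deg \<alpha> = n} \<times> UNIV" and L = "{\<kappa>. \<kappa> \<in> L \<and> weight T \<kappa> = \<omega>}"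
          and c = "\<lambda>(\<alpha>, \<nu>). b \<alpha> z * (of_nat (\<gamma> \<nu>) * of_nat (\<alpha> \<nu>))" and m = "\<lambda>(\<alpha>, \<nu>). \<alpha>(\<nu> := \<alpha> \<nu> - 1)" and \<zeta> = \<xi>
          and d = "\<lambda>\<kappa>. taylor (d i j \<kappa>) z \<gamma>"])
      have G: "(\<Sum>x\<in>{\<alpha>. \<alpha> \<in> K \<and> deg \<alpha> = n} \<times> UNIV. (case x of (\<alpha>, \<nu>) \<Rightarrow> b \<alpha> z * (of_nat (\<gamma> \<nu>) * of_nat (\<alpha> \<nu>))) * mpow (case x of (\<alpha>, \<nu>) \<Rightarrow> \<alpha>(\<nu> := \<alpha> \<nu> - 1)) \<xi>)
          = (\<Sum>\<alpha> | \<alpha> \<in> K \<and> deg \<alpha> = n. b \<alpha> z * dir_deriv \<gamma> \<alpha> \<xi>)" for \<xi>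
        by (simp add: sum.cartesian_product [symmetric] dir_deriv_def sum_distrib_left case_prod_unfold mult.assoc del: fun_upd_apply)
           (subst sum.cartesian_product, simp add: case_prod_unfold)
      show "(\<Sum>x\<in>{\<alpha>. \<alpha> \<in> K \<and> deg \<alpha> = n} \<times> UNIV. (case x of (\<alpha>, \<nu>) \<Rightarrow> b \<alpha> z * (of_nat (\<gamma> \<nu>) * of_nat (\<alpha> \<nu>))) * mpow (case x of (\<alpha>, \<nu>) \<Rightarrow> \<alpha>(\<nu> := \<alpha> \<nu> - 1)) \<xi>) \<noteq> 0"
        unfolding G by (rule nz)
      show "(\<Sum>x\<in>{\<alpha>. \<alpha> \<in> K \<and> deg \<alpha> = n} \<times> UNIV. (case x of (\<alpha>, \<nu>) \<Rightarrow> b \<alpha> z * (of_nat (\<gamma> \<nu>) * of_nat (\<alpha> \<nu>))) * mpow (case x of (\<alpha>, \<nu>) \<Rightarrow> \<alpha>(\<nu> := \<alpha> \<nu> - 1)) \<xi>)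
          * (\<Sum>\<kappa> | \<kappa> \<in> L \<and> weight T \<kappa> = \<omega>. taylor (d i j \<kappa>) z \<gamma> * mpow \<kappa> \<xi>) = 0" for \<xi>
        unfolding G by (rule lead[OF z])
    qed (use K L top in auto)
    moreover have "\<forall>\<^sub>F z in nhds x. z \<in> N \<longrightarrow> (\<Sum>\<alpha> | \<alpha> \<in> K \<and> deg \<alpha> = n. b \<alpha> z * dir_deriv \<gamma> \<alpha> \<xi>) \<noteq> 0"
    proof -
      have eq: "(\<Sum>\<alpha> | \<alpha> \<in> K \<and> deg \<alpha> = n. b \<alpha> z * dir_deriv \<gamma> \<alpha> \<xi>) = (\<Sum>\<alpha> | \<alpha> \<in> K \<and> deg \<alpha> = n. a i i \<alpha> z * dir_deriv \<gamma> \<alpha> \<xi>)"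
        if "z \<in> N" for z using scalar[OF that, of _ i i] by (intro sum.cong) auto
      have "\<forall>\<^sub>F z in nhds x. (\<Sum>\<alpha> | \<alpha> \<in> K \<and> deg \<alpha> = n. a i i \<alpha> z * dir_deriv \<gamma> \<alpha> \<xi>) \<noteq> 0"
        by (rule analytic_nonzero_near) (use nz eq[OF x] in \<open>auto intro!: analytic_sum analytic_mult ana_a x\<close>)
      then show ?thesis by (rule eventually_mono) (use eq in auto)
    qed
    ultimately have "\<forall>\<^sub>F z in nhds x. z \<in> N \<longrightarrow> taylor (d i j \<kappa>) z \<gamma> = 0" by (auto elim: eventually_mono)
    from identity_theorem[OF N analytic_taylor[OF ana_d] x this top(2)] top(3) show False by simp
  qed
  show ?thesis
  proof (rule near_eq_zero_if_taylor[OF ana_d[OF p]])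
    fix \<mu> :: "'i midx"
    let ?\<gamma> = "\<lambda>i. if i \<in> T then \<mu> i else 0" and ?\<beta> = "\<lambda>i. if i \<in> T then 0 else \<mu> i"
    have s: "supported T ?\<gamma>" "supported (- T) ?\<beta>" by (auto simp: supported_def)
    have "taylor (d i j \<kappa>) z ?\<gamma> = 0" if "z \<in> N" for z
      using no_bad[of ?\<gamma>] s that by (auto simp: bad_def)
    then have "\<forall>\<^sub>F z in nhds p. z \<in> N \<longrightarrow> taylor (d i j \<kappa>) z ?\<gamma> = 0" by simp
    then have "taylor (\<lambda>z. taylor (d i j \<kappa>) z ?\<gamma>) p ?\<beta> = 0"
      using zero_near_iff_taylor[OF p analytic_taylor[OF ana_d[OF p]]] s by blast
    moreover have "\<mu> = (\<lambda>i. ?\<gamma> i + ?\<beta> i)" by auto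
    ultimately show "taylor (d i j \<kappa>) p \<mu> = 0" using taylor_taylor[OF ana_d[OF p] s] by simp
  qed
qed

end

section \<open>Differential operators over a quotient of a function algebra\<close>

lemma coeff_family_superset: "coeff_family S I K c \<Longrightarrow> K \<subseteq> L \<Longrightarrow> finite L \<Longrightarrow> (\<And>\<kappa>. \<kappa> \<in> L \<Longrightarrow> supported I \<kappa>) \<Longrightarrow> coeff_family S I L c"
  by (auto simp: coeff_family_def)

text \<open>
  The algebra \<open>B\<close> is a quotient of the functions that are analytic at the points of \<open>S\<close>, with quotient map
  \<open>q\<close>, and its derivations \<open>\<delta> i\<close> for \<open>i \<in> I\<close> are induced by \<open>twisted_der T 0 i\<close>. The two instances are the
  germs along \<open>N\<close> and the functions on \<open>N\<close>; in the latter only the \<open>x\<close>-derivations exist. The last assumption makes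
  the coefficients of an operator unique.
\<close>

locale function_model =
  fixes S :: "(real ^ 'i::finite) set" and T I :: "'i set" and B :: "(complex, 'a) module"
    and q :: "((real ^ 'i) \<Rightarrow> complex) \<Rightarrow> 'a" and \<delta> :: "'i \<Rightarrow> 'a \<Rightarrow> 'a"
  assumes carrier: "carrier B = q ` {f. \<forall>p\<in>S. real_analytic_at f p}"
    and q_mult: "\<And>f g. q f \<otimes>\<^bsub>B\<^esub> q g = q (\<lambda>y. f y * g y)"
    and q_add: "\<And>f g. q f \<oplus>\<^bsub>B\<^esub> q g = q (\<lambda>y. f y + g y)"
    and q_smult: "\<And>k f. k \<odot>\<^bsub>B\<^esub> q f = q (\<lambda>y. k * f y)"
    and q_zero: "\<zero>\<^bsub>B\<^esub> = q (\<lambda>y. 0)"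
    and q_one: "\<one>\<^bsub>B\<^esub> = q (\<lambda>y. 1)"
    and q_der: "\<And>i f. i \<in> I \<Longrightarrow> \<delta> i (q f) = q (twisted_der T (\<lambda>_. 0) i f)"
    and q_near: "\<And>f g. (\<And>p. p \<in> S \<Longrightarrow> near_eq p f g) \<Longrightarrow> q f = q g"
    and q_coeffs: "\<And>K c \<kappa>. coeff_family S I K c \<Longrightarrow>
      (\<And>n. supported I n \<Longrightarrow> q (twisted_op T (\<lambda>_. 0) K c (eigenfun T n)) = q (\<lambda>y. 0)) \<Longrightarrow> q (c \<kappa>) = q (\<lambda>y. 0)"
begin

abbreviation regular :: "((real ^ 'i) \<Rightarrow> complex) \<Rightarrow> bool" where "regular f \<equiv> \<forall>p\<in>S. real_analytic_at f p"
abbreviation D where "D \<equiv> diff_alg B \<delta> I"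
abbreviation "op0 \<equiv> twisted_op T (\<lambda>_. 0)"

lemma q_closed: "regular f \<Longrightarrow> q f \<in> carrier B"
  by (auto simp: carrier)

lemma carrier_cases: "u \<in> carrier B \<Longrightarrow> (\<And>f. regular f \<Longrightarrow> u = q f \<Longrightarrow> thesis) \<Longrightarrow> thesis"
  by (auto simp: carrier)

lemma monoid_B: "abelian_monoid B"
  by (rule abelian_monoidI)
     (auto elim!: carrier_cases simp: q_add q_zero q_closed analytic_add add_ac)

sublocale B: abelian_monoid B by (rule monoid_B)

lemma q_finsum: "finite J \<Longrightarrow> (\<And>j. j \<in> J \<Longrightarrow> regular (f j)) \<Longrightarrow> finsum B (\<lambda>j. q (f j)) J = q (\<lambda>y. \<Sum>j\<in>J. f j y)"
proof (induction J rule: finite_induct)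
  case (insert j J)
  then have "finsum B (\<lambda>j. q (f j)) (insert j J) = q (f j) \<oplus>\<^bsub>B\<^esub> finsum B (\<lambda>j. q (f j)) J"
    by (intro B.finsum_insert) (auto intro!: q_closed)
  with insert show ?case by (simp add: q_add)
qed (simp add: q_zero)

lemma iter_q: "supported I \<kappa> \<Longrightarrow> iter_der \<delta> \<kappa> (q f) = q (iter_der (twisted_der T (\<lambda>_. 0)) \<kappa> f)"
  by (rule iter_der_rel[of "\<lambda>u v. u = q v"]) (auto simp: supported_def intro!: q_der)

definition is_op :: "('a \<Rightarrow> 'a) \<Rightarrow> 'i midx set \<Rightarrow> ('i midx \<Rightarrow> (real ^ 'i) \<Rightarrow> complex) \<Rightarrow> bool" where
  "is_op P K c \<longleftrightarrow> coeff_family S I K c \<and> P = diff_op B \<delta> (\<lambda>\<kappa>. q (c \<kappa>))"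

lemma regular_twisted_op: "coeff_family S I K c \<Longrightarrow> regular f \<Longrightarrow> regular (twisted_op T l K c f)"
  by (auto simp: coeff_family_def intro: analytic_twisted_op)

lemma is_op_apply:
  assumes "is_op P K c" "regular f" shows "P (q f) = q (op0 K c f)"
proof -
  have c: "coeff_family S I K c" and P: "P = diff_op B \<delta> (\<lambda>\<kappa>. q (c \<kappa>))" using assms by (auto simp: is_op_def)
  let ?h = "\<lambda>\<kappa>. q (\<lambda>y. c \<kappa> y * iter_der (twisted_der T (\<lambda>_. 0)) \<kappa> f y)"
  have sub: "{\<kappa>. q (c \<kappa>) \<noteq> \<zero>\<^bsub>B\<^esub>} \<subseteq> K" using c by (auto simp: coeff_family_def q_zero)
  have h: "q (c \<kappa>) \<otimes>\<^bsub>B\<^esub> iter_der \<delta> \<kappa> (q f) = ?h \<kappa>" if "\<kappa> \<in> K" for \<kappa>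
    using c that by (simp add: coeff_family_def iter_q q_mult)
  have "P (q f) = finsum B (\<lambda>\<kappa>. q (c \<kappa>) \<otimes>\<^bsub>B\<^esub> iter_der \<delta> \<kappa> (q f)) {\<kappa>. q (c \<kappa>) \<noteq> \<zero>\<^bsub>B\<^esub>}"
    unfolding P diff_op_def using assms by (simp add: q_closed)
  also have "\<dots> = finsum B ?h K"
  proof (rule B.add.finprod_mono_neutral_cong_left)
    show "finite K" using c by (simp add: coeff_family_def)
    show "?h \<in> K \<rightarrow> carrier B" using c assms(2) by (auto simp: coeff_family_def intro!: q_closed analytic_mult analytic_iter)
    fix \<kappa> assume "\<kappa> \<in> K - {\<kappa>. q (c \<kappa>) \<noteq> \<zero>\<^bsub>B\<^esub>}"
    then have z: "q (c \<kappa>) = q (\<lambda>y. 0)" by (simp add: q_zero)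
    have "?h \<kappa> = q (c \<kappa>) \<otimes>\<^bsub>B\<^esub> q (iter_der (twisted_der T (\<lambda>_. 0)) \<kappa> f)" by (simp add: q_mult)
    then show "?h \<kappa> = \<zero>\<^bsub>B\<^esub>" unfolding z by (simp add: q_mult q_zero)
  qed (use sub h in auto)
  also have "\<dots> = q (op0 K c f)" unfolding twisted_op_def
    using c assms(2) by (intro q_finsum) (auto simp: coeff_family_def intro!: analytic_mult analytic_iter)
  finally show ?thesis .
qed

lemma is_op_extensional: "is_op P K c \<Longrightarrow> P \<in> extensional (carrier B)"
  by (auto simp: is_op_def diff_op_def)

lemma is_op_closed: "is_op P K c \<Longrightarrow> u \<in> carrier B \<Longrightarrow> P u \<in> carrier B"
proof (erule carrier_cases)
  fix f assume P: "is_op P K c" and f: "regular f" "u = q f"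
  then have "regular (op0 K c f)" by (intro regular_twisted_op) (auto simp: is_op_def)
  then show "P u \<in> carrier B" using is_op_apply[OF P f(1)] f(2) by (simp add: q_closed)
qed

lemma extensional_eqI:
  assumes "P \<in> extensional (carrier B)" "Q \<in> extensional (carrier B)" "\<And>f. regular f \<Longrightarrow> P (q f) = Q (q f)"
  shows "P = Q"
  by (rule extensionalityI[OF assms(1,2)]) (auto elim!: carrier_cases intro: assms(3))

lemma is_opI:
  assumes "coeff_family S I K c" "P \<in> extensional (carrier B)" "\<And>f. regular f \<Longrightarrow> P (q f) = q (op0 K c f)"
  shows "is_op P K c"
proof -
  have "is_op (diff_op B \<delta> (\<lambda>\<kappa>. q (c \<kappa>))) K c" using assms(1) by (simp add: is_op_def)
  then have "P = diff_op B \<delta> (\<lambda>\<kappa>. q (c \<kappa>))"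
    by (intro extensional_eqI assms(2) is_op_extensional) (auto simp: assms(3) is_op_apply)
  with assms(1) show ?thesis by (simp add: is_op_def)
qed

lemma families_cases:
  assumes "c' \<in> families B I" obtains K c where "coeff_family S I K c" "c' = (\<lambda>\<kappa>. q (c \<kappa>))"
proof -
  have c': "c' \<kappa> \<in> carrier B" "finite {\<kappa>. c' \<kappa> \<noteq> \<zero>\<^bsub>B\<^esub>}" "c' \<kappa> \<noteq> \<zero>\<^bsub>B\<^esub> \<Longrightarrow> supported I \<kappa>" for \<kappa>
    using assms by (auto simp: families_def)
  have "\<exists>f. regular f \<and> c' \<kappa> = q f \<and> (c' \<kappa> = \<zero>\<^bsub>B\<^esub> \<longrightarrow> f = (\<lambda>_. 0))" for \<kappa>
  proof (cases "c' \<kappa> = \<zero>\<^bsub>B\<^esub>")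
    case True
    then show ?thesis by (intro exI[of _ "\<lambda>_. 0"]) (simp add: q_zero)
  next
    case False
    obtain f where "regular f" "c' \<kappa> = q f" by (rule carrier_cases[OF c'(1)])
    then show ?thesis using False by auto
  qed
  then obtain c where c: "\<And>\<kappa>. regular (c \<kappa>) \<and> c' \<kappa> = q (c \<kappa>) \<and> (c' \<kappa> = \<zero>\<^bsub>B\<^esub> \<longrightarrow> c \<kappa> = (\<lambda>_. 0))"
    by metis
  show ?thesis
  proof (rule that[of "{\<kappa>. c' \<kappa> \<noteq> \<zero>\<^bsub>B\<^esub>}" c])
    show "coeff_family S I {\<kappa>. c' \<kappa> \<noteq> \<zero>\<^bsub>B\<^esub>} c" using c c'(2,3) by (auto simp: coeff_family_def)
    show "c' = (\<lambda>\<kappa>. q (c \<kappa>))" using c by auto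
  qed
qed

lemma coeff_family_families: "coeff_family S I K c \<Longrightarrow> (\<lambda>\<kappa>. q (c \<kappa>)) \<in> families B I"
proof -
  assume c: "coeff_family S I K c"
  have sub: "{\<kappa>. q (c \<kappa>) \<noteq> \<zero>\<^bsub>B\<^esub>} \<subseteq> K" using c by (auto simp: coeff_family_def q_zero)
  then have "finite {\<kappa>. q (c \<kappa>) \<noteq> \<zero>\<^bsub>B\<^esub>}" using c finite_subset by (auto simp: coeff_family_def)
  then show ?thesis using c sub by (auto simp: families_def coeff_family_def intro!: q_closed)
qed

lemma carrier_D: "P \<in> carrier D \<longleftrightarrow> (\<exists>K c. is_op P K c)"
proof
  assume "P \<in> carrier D"
  then obtain c' where c': "c' \<in> families B I" "P = diff_op B \<delta> c'" by (auto simp: diff_alg_def)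
  from families_cases[OF c'(1)] obtain K c where "coeff_family S I K c" "c' = (\<lambda>\<kappa>. q (c \<kappa>))" .
  then show "\<exists>K c. is_op P K c" using c'(2) by (auto simp: is_op_def)
qed (auto simp: is_op_def diff_alg_def intro: coeff_family_families)

text \<open>
  The difference of the two families kills all eigenfunctions.
\<close>

lemma is_op_unique:
  assumes a: "is_op P K a" and b: "is_op P L b" shows "q (a \<kappa>) = q (b \<kappa>)"
proof -
  let ?b = "\<lambda>\<kappa> y. (- 1) * b \<kappa> y"
  have fa: "coeff_family S I K a" and fb: "coeff_family S I L b" and fb': "coeff_family S I L ?b"
    using a b coeff_family_cmult[of S I L b "- 1"] by (auto simp: is_op_def)
  let ?c = "\<lambda>\<kappa> y. a \<kappa> y + ?b \<kappa> y"
  have "q (op0 (K \<union> L) ?c (eigenfun T n)) = q (\<lambda>y. 0)" for n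
  proof -
    have e: "regular (eigenfun T n)" by (simp add: analytic_eigenfun)
    have 1: "op0 L ?b (eigenfun T n) = (\<lambda>y. (- 1) * op0 L b (eigenfun T n) y)"
      by (simp add: twisted_op_def sum_negf)
    have "q (op0 (K \<union> L) ?c (eigenfun T n)) = q (op0 K a (eigenfun T n)) \<oplus>\<^bsub>B\<^esub> (- 1) \<odot>\<^bsub>B\<^esub> q (op0 L b (eigenfun T n))"
      unfolding q_smult q_add twisted_op_add[OF fa fb'] 1 ..
    also have "q (op0 K a (eigenfun T n)) = q (op0 L b (eigenfun T n))"
      using is_op_apply[OF a e] is_op_apply[OF b e] by simp
    finally show ?thesis by (simp add: q_add q_smult)
  qed
  then have "q (?c \<kappa>) = q (\<lambda>y. 0)" by (intro q_coeffs[OF coeff_family_add[OF fa fb']])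
  then have "q (?c \<kappa>) \<oplus>\<^bsub>B\<^esub> q (b \<kappa>) = q (\<lambda>y. 0) \<oplus>\<^bsub>B\<^esub> q (b \<kappa>)" by simp
  then show ?thesis by (simp add: q_add)
qed

lemma is_op_coeffs: assumes "is_op P K c" shows "coeffs B \<delta> I P = (\<lambda>\<kappa>. q (c \<kappa>))"
  unfolding coeffs_def
proof (rule the_equality)
  show "(\<lambda>\<kappa>. q (c \<kappa>)) \<in> families B I \<and> P = diff_op B \<delta> (\<lambda>\<kappa>. q (c \<kappa>))"
    using assms by (auto simp: is_op_def intro: coeff_family_families)
  fix c' assume c': "c' \<in> families B I \<and> P = diff_op B \<delta> c'"
  then obtain L b where "coeff_family S I L b" and b: "c' = (\<lambda>\<kappa>. q (b \<kappa>))" using families_cases by blast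
  then have "is_op P L b" using c' by (simp add: is_op_def)
  from is_op_unique[OF this assms] show "c' = (\<lambda>\<kappa>. q (c \<kappa>))" unfolding b by simp
qed

lemma is_op_add:
  assumes "is_op P K a" "is_op Q L b" shows "is_op (P \<oplus>\<^bsub>D\<^esub> Q) (K \<union> L) (\<lambda>\<kappa> y. a \<kappa> y + b \<kappa> y)"
proof -
  have fa: "coeff_family S I K a" and fb: "coeff_family S I L b" using assms by (auto simp: is_op_def)
  show ?thesis
    by (rule is_opI[OF coeff_family_add[OF fa fb]])
       (auto simp: diff_alg_def q_closed is_op_apply[OF assms(1)] is_op_apply[OF assms(2)] q_add twisted_op_add[OF fa fb])
qed

lemma is_op_smult:
  assumes "is_op P K a" shows "is_op (k \<odot>\<^bsub>D\<^esub> P) K (\<lambda>\<kappa> y. k * a \<kappa> y)"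
proof -
  have fa: "coeff_family S I K a" using assms by (auto simp: is_op_def)
  show ?thesis
    by (rule is_opI[OF coeff_family_cmult[OF fa]])
       (auto simp: diff_alg_def q_closed is_op_apply[OF assms(1)] q_smult twisted_op_def sum_distrib_left mult.assoc)
qed

lemma is_op_zero: "is_op \<zero>\<^bsub>D\<^esub> {} (\<lambda>_ _. 0)"
  by (rule is_opI) (auto simp: coeff_family_def diff_alg_def q_closed q_zero twisted_op_def)

lemma is_op_one: "is_op \<one>\<^bsub>D\<^esub> {\<lambda>i. 0} (\<lambda>\<kappa> _. if \<kappa> = (\<lambda>i. 0) then 1 else 0)"
  by (rule is_opI) (auto simp: coeff_family_def diff_alg_def q_closed twisted_op_def supported_def)

lemma is_op_mult:
  assumes "is_op P K a" "is_op Q L b"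
  obtains M c where "is_op (P \<otimes>\<^bsub>D\<^esub> Q) M c"
    "\<And>l f p. p \<in> S \<Longrightarrow> real_analytic_at f p \<Longrightarrow> near_eq p (twisted_op T l M c f) (twisted_op T l K a (twisted_op T l L b f))"
proof -
  have fa: "coeff_family S I K a" and fb: "coeff_family S I L b" using assms by (auto simp: is_op_def)
  obtain M c where c: "coeff_family S I M c" and
    e: "\<And>l f p. p \<in> S \<Longrightarrow> real_analytic_at f p \<Longrightarrow> near_eq p (twisted_op T l K a (twisted_op T l L b f)) (twisted_op T l M c f)"
    using representable_compose[OF fa representable_twisted_op[OF fb, of T]] unfolding representable_def by blast
  have "is_op (P \<otimes>\<^bsub>D\<^esub> Q) M c"
  proof (rule is_opI[OF c])
    fix f assume f: "regular f"
    have "(P \<otimes>\<^bsub>D\<^esub> Q) (q f) = P (Q (q f))" by (simp add: diff_alg_def compose_def q_closed f)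
    also have "\<dots> = q (op0 K a (op0 L b f))"
      by (simp only: is_op_apply[OF assms(2) f] is_op_apply[OF assms(1) regular_twisted_op[OF fb f]])
    also have "\<dots> = q (op0 M c f)" by (rule q_near) (use e f in auto)
    finally show "(P \<otimes>\<^bsub>D\<^esub> Q) (q f) = q (op0 M c f)" .
  qed (auto simp: diff_alg_def)
  then show ?thesis using that e near_eq_sym by blast
qed

lemma monoid_D: "abelian_monoid D"
proof (rule abelian_monoidI)
  fix P Q assume "P \<in> carrier D" "Q \<in> carrier D"
  then show "P \<oplus>\<^bsub>D\<^esub> Q \<in> carrier D" using is_op_add unfolding carrier_D by blast
next
  show "\<zero>\<^bsub>D\<^esub> \<in> carrier D" using is_op_zero unfolding carrier_D by blast
next
  fix P Q R assume "P \<in> carrier D" "Q \<in> carrier D" "R \<in> carrier D"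
  then have "P u \<in> carrier B" "Q u \<in> carrier B" "R u \<in> carrier B" if "u \<in> carrier B" for u
    using is_op_closed that unfolding carrier_D by blast+
  then show "(P \<oplus>\<^bsub>D\<^esub> Q) \<oplus>\<^bsub>D\<^esub> R = P \<oplus>\<^bsub>D\<^esub> (Q \<oplus>\<^bsub>D\<^esub> R)"
    by (auto simp: diff_alg_def B.a_assoc intro!: restrict_ext)
next
  fix P assume "P \<in> carrier D"
  then obtain K c where P: "is_op P K c" unfolding carrier_D by blast
  show "\<zero>\<^bsub>D\<^esub> \<oplus>\<^bsub>D\<^esub> P = P"
    by (rule extensionalityI[OF _ is_op_extensional[OF P]]) (auto simp: diff_alg_def is_op_closed[OF P])
next
  fix P Q assume "P \<in> carrier D" "Q \<in> carrier D"
  then have "P u \<in> carrier B" "Q u \<in> carrier B" if "u \<in> carrier B" for u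
    using is_op_closed that unfolding carrier_D by blast+
  then show "P \<oplus>\<^bsub>D\<^esub> Q = Q \<oplus>\<^bsub>D\<^esub> P"
    by (auto simp: diff_alg_def B.a_comm intro!: restrict_ext)
qed

sublocale D: abelian_monoid D by (rule monoid_D)

lemma is_op_finsum:
  assumes "finite J" "\<And>j. j \<in> J \<Longrightarrow> is_op (P j) (K j) (c j)"
  shows "\<exists>L b. is_op (finsum D P J) L b \<and> (\<forall>l f y. twisted_op T l L b f y = (\<Sum>j\<in>J. twisted_op T l (K j) (c j) f y))"
  using assms
proof (induction J rule: finite_induct)
  case empty
  then show ?case by (intro exI[of _ "{}"] exI[of _ "\<lambda>_ _. 0"]) (auto simp: is_op_zero twisted_op_def)
next
  case (insert j J)
  then obtain L b where b: "is_op (finsum D P J) L b" "\<And>l f y. twisted_op T l L b f y = (\<Sum>j\<in>J. twisted_op T l (K j) (c j) f y)"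
    by auto
  have j: "is_op (P j) (K j) (c j)" using insert by simp
  have "P i \<in> carrier D" if "i \<in> insert j J" for i
    using insert.prems[OF that] unfolding carrier_D by blast
  then have "finsum D P (insert j J) = P j \<oplus>\<^bsub>D\<^esub> finsum D P J"
    using insert.hyps by (intro D.finsum_insert) auto
  then have "is_op (finsum D P (insert j J)) (K j \<union> L) (\<lambda>\<kappa> y. c j \<kappa> y + b \<kappa> y)"
    using is_op_add[OF j b(1)] by simp
  moreover have "twisted_op T l (K j \<union> L) (\<lambda>\<kappa> y. c j \<kappa> y + b \<kappa> y) f y = (\<Sum>j\<in>insert j J. twisted_op T l (K j) (c j) f y)" for l f y
    using j b(1) insert by (subst twisted_op_add) (auto simp: is_op_def b(2))
  ultimately show ?case by blast
qed

lemma matrix_cases: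
  fixes X :: "'m::finite \<Rightarrow> 'm \<Rightarrow> 'a \<Rightarrow> 'a"
  assumes "X \<in> carrier (mat_alg D)"
  obtains K a where "\<And>i j. is_op (X i j) K (a i j)"
proof -
  have "\<exists>K a. is_op (X i j) K a" for i j using assms by (simp add: mat_alg_def carrier_D)
  then obtain K a where a: "\<And>i j. is_op (X i j) (K i j) (a i j)" by metis
  have "is_op (X i j) (\<Union>i. \<Union>j. K i j) (a i j)" for i j
  proof -
    have f: "coeff_family S I (K i j) (a i j)" for i j using a by (simp add: is_op_def)
    then have "finite (\<Union>i. \<Union>j. K i j)" "\<And>\<kappa>. \<kappa> \<in> (\<Union>i. \<Union>j. K i j) \<Longrightarrow> supported I \<kappa>"
      by (auto simp: coeff_family_def)
    then have "coeff_family S I (\<Union>i. \<Union>j. K i j) (a i j)" using f[of i j] by (intro coeff_family_superset[OF f[of i j]]) auto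
    then show ?thesis using a[of i j] by (simp add: is_op_def)
  qed
  then show ?thesis by (rule that)
qed

lemma is_op_matrix_mult:
  fixes X Y :: "'m::finite \<Rightarrow> 'm \<Rightarrow> 'a \<Rightarrow> 'a"
  assumes X: "\<And>i j. is_op (X i j) K (a i j)" and Y: "\<And>i j. is_op (Y i j) L (b i j)"
  obtains M c where "is_op ((X \<otimes>\<^bsub>mat_alg D\<^esub> Y) i j) M c"
    "\<forall>l f. \<forall>p\<in>S. real_analytic_at f p \<longrightarrow>
      near_eq p (twisted_op T l M c f) (\<lambda>y. \<Sum>k\<in>UNIV. twisted_op T l K (a i k) (twisted_op T l L (b k j) f) y)"
proof -
  have "\<exists>M c. is_op (X i k \<otimes>\<^bsub>D\<^esub> Y k j) M c \<and> (\<forall>l f. \<forall>p\<in>S. real_analytic_at f p \<longrightarrow>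
      near_eq p (twisted_op T l M c f) (twisted_op T l K (a i k) (twisted_op T l L (b k j) f)))" for k
    using is_op_mult[OF X Y, of i k k j] by metis
  then obtain M c where Mc: "\<And>k. is_op (X i k \<otimes>\<^bsub>D\<^esub> Y k j) (M k) (c k)"
    "\<And>k l f p. p \<in> S \<Longrightarrow> real_analytic_at f p \<Longrightarrow> near_eq p (twisted_op T l (M k) (c k) f) (twisted_op T l K (a i k) (twisted_op T l L (b k j) f))"
    by metis
  obtain M' c' where M': "is_op (finsum D (\<lambda>k. X i k \<otimes>\<^bsub>D\<^esub> Y k j) UNIV) M' c'"
    "\<And>l f y. twisted_op T l M' c' f y = (\<Sum>k\<in>UNIV. twisted_op T l (M k) (c k) f y)"
    using is_op_finsum[of UNIV "\<lambda>k. X i k \<otimes>\<^bsub>D\<^esub> Y k j" M c] Mc(1) by auto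
  show ?thesis
  proof (rule that[of M' c'])
    show "is_op ((X \<otimes>\<^bsub>mat_alg D\<^esub> Y) i j) M' c'" using M'(1) by (simp add: mat_alg_def)
    show "\<forall>l f. \<forall>p\<in>S. real_analytic_at f p \<longrightarrow>
        near_eq p (twisted_op T l M' c' f) (\<lambda>y. \<Sum>k\<in>UNIV. twisted_op T l K (a i k) (twisted_op T l L (b k j) f) y)"
      unfolding M'(2)[abs_def] by (intro allI ballI impI near_eq_sum Mc(2))
  qed
qed

end

section \<open>The function algebras of the two manifolds\<close>

text \<open>
  A neighbourhood of \<open>N\<close> is a union of neighbourhoods of its points, so germs along \<open>N\<close> are
  governed by equality near each point of \<open>N\<close>.
\<close>

lemma mem_germ_iff: "g \<in> germ N f \<longleftrightarrow> (\<forall>p\<in>N. near_eq p g f)"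
proof
  assume *: "\<forall>p\<in>N. near_eq p g f"
  let ?U = "\<Union>{V. open V \<and> (\<forall>y\<in>V. g y = f y)}"
  have "N \<subseteq> ?U" using * unfolding near_eq_def eventually_nhds by blast
  moreover have "open ?U" by auto
  ultimately show "g \<in> germ N f" unfolding germ_def by blast
qed (auto simp: germ_def near_eq_def eventually_nhds)

lemma germ_eq_iff: "germ N f = germ N g \<longleftrightarrow> (\<forall>p\<in>N. near_eq p f g)"
proof
  assume *: "germ N f = germ N g"
  have "f \<in> germ N f" by (simp add: mem_germ_iff)
  then show "\<forall>p\<in>N. near_eq p f g" unfolding * by (simp add: mem_germ_iff)
next
  assume "\<forall>p\<in>N. near_eq p f g"
  then have "near_eq p h f \<longleftrightarrow> near_eq p h g" if "p \<in> N" for p h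
    using that by (meson near_eq_trans near_eq_sym)
  then show "germ N f = germ N g" by (auto simp: mem_germ_iff)
qed

lemma UN_germ: "(\<And>g. g \<in> germ N f \<Longrightarrow> H g = A) \<Longrightarrow> (\<Union>g\<in>germ N f. H g) = A"
proof -
  assume *: "\<And>g. g \<in> germ N f \<Longrightarrow> H g = A"
  have "f \<in> germ N f" by (simp add: mem_germ_iff)
  with * show ?thesis by blast
qed

lemma real_analytic_on_analytic: assumes "open U" "real_analytic_on f U" "p \<in> U" shows "real_analytic_at f p"
proof -
  have "\<exists>c. has_power_series f c q" if q: "q \<in> U" for q
  proof -
    from assms(2) q obtain r c where r: "r > 0" "\<forall>y\<in>U \<inter> ball q r.
      ((\<lambda>\<kappa>. c \<kappa> * of_real (\<Prod>i\<in>UNIV. (y $ i - q $ i) ^ \<kappa> i)) has_sum f y) UNIV"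
      unfolding real_analytic_on_def by blast
    have "\<forall>\<^sub>F y in nhds q. y \<in> U \<inter> ball q r"
      using assms(1) q r(1) by (intro eventually_nhds_in_open) auto
    then have "has_power_series f c q" unfolding has_power_series_def
      by (rule eventually_mono) (use r(2) in \<open>auto simp: mpow_def\<close>)
    then show ?thesis by blast
  qed
  moreover have "\<forall>\<^sub>F q in nhds p. q \<in> U" using assms by (intro eventually_nhds_in_open)
  ultimately show ?thesis unfolding real_analytic_at_def by (auto elim: eventually_mono)
qed

lemma real_analytic_onI:
  assumes "\<And>p. p \<in> S \<Longrightarrow> \<exists>c. has_power_series f c p" "\<And>y. y \<in> S \<Longrightarrow> g y = f y" shows "real_analytic_on g S"
  unfolding real_analytic_on_def
proof
  fix p assume "p \<in> S"
  then obtain c where "has_power_series f c p" using assms by blast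
  then obtain r where "r > 0" "\<forall>y. dist y p < r \<longrightarrow> ((\<lambda>\<kappa>. c \<kappa> * mpow \<kappa> (\<lambda>i. of_real (y $ i - p $ i))) has_sum f y) UNIV"
    unfolding has_power_series_def eventually_nhds_metric by auto
  then show "\<exists>r>0. \<exists>c. \<forall>y\<in>S \<inter> ball p r.
      ((\<lambda>\<kappa>. c \<kappa> * of_real (\<Prod>i\<in>UNIV. (y $ i - p $ i) ^ \<kappa> i)) has_sum g y) UNIV"
    by (intro exI[of _ r] conjI exI[of _ c]) (auto simp: mpow_def assms(2) dist_commute)
qed

lemma carrier_A_M: "carrier (A_M N) = germ N ` {f. \<forall>p\<in>N. real_analytic_at f p}"
proof -
  have "\<exists>U. open U \<and> N \<subseteq> U \<and> real_analytic_on f U" if "\<forall>p\<in>N. real_analytic_at f p" for f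
  proof -
    let ?U = "\<Union>{V. open V \<and> (\<forall>y\<in>V. \<exists>c. has_power_series f c y)}"
    have "N \<subseteq> ?U" using that unfolding real_analytic_at_def eventually_nhds by blast
    moreover have "open ?U" by auto
    moreover have "real_analytic_on f ?U" by (rule real_analytic_onI) auto
    ultimately show ?thesis by blast
  qed
  moreover have "\<forall>p\<in>N. real_analytic_at f p" if "open U" "N \<subseteq> U" "real_analytic_on f U" for f U
    using that by (auto intro: real_analytic_on_analytic)
  ultimately show ?thesis unfolding A_M_def by (auto intro!: imageI)
qed

lemma function_model_M: "function_model N T UNIV (A_M N) (germ N) (der_M N T)"
proof
  show "carrier (A_M N) = germ N ` {f. \<forall>p\<in>N. real_analytic_at f p}" by (rule carrier_A_M)
next
  fix f g k
  show "germ N f \<otimes>\<^bsub>A_M N\<^esub> germ N g = germ N (\<lambda>y. f y * g y)"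
    "germ N f \<oplus>\<^bsub>A_M N\<^esub> germ N g = germ N (\<lambda>y. f y + g y)"
    "k \<odot>\<^bsub>A_M N\<^esub> germ N f = germ N (\<lambda>y. k * f y)"
    unfolding A_M_def by (simp, (rule UN_germ)+, simp add: mem_germ_iff germ_eq_iff near_eq_mult near_eq_add)+
next
  fix i f
  have *: "(\<lambda>y. if i \<in> T then complex_of_real (y $ i) * partial i g y else partial i g y) = twisted_der T (\<lambda>_. 0) i g" for g
    by (auto simp: twisted_der_def)
  show "der_M N T i (germ N f) = germ N (twisted_der T (\<lambda>_. 0) i f)"
    unfolding der_M_def * by (rule UN_germ) (simp add: mem_germ_iff germ_eq_iff twisted_cong)
next
  fix K c \<kappa>
  assume c: "coeff_family N UNIV K c" and z: "\<And>n. supported UNIV n \<Longrightarrow> germ N (twisted_op T (\<lambda>_. 0) K c (eigenfun T n)) = germ N (\<lambda>y. 0)"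
  have "near_eq p (c \<kappa>) (\<lambda>y. 0)" if "p \<in> N" for p
  proof (cases "\<kappa> \<in> K")
    case True
    then show ?thesis
      by (intro twisted_op_zero_coeffs[of K c p T]) (use c z that in \<open>auto simp: coeff_family_def germ_eq_iff supported_def\<close>)
  qed (use c in \<open>simp add: coeff_family_def\<close>)
  then show "germ N (c \<kappa>) = germ N (\<lambda>y. 0)" by (simp add: germ_eq_iff)
qed (auto simp: germ_eq_iff A_M_def)

context crossing
begin

text \<open>
  A function on \<open>N\<close> extends to a neighbourhood as a function that does not depend on \<open>t\<close>.
\<close>

lemma proj_analytic:
  assumes g: "real_analytic_on g N" and p: "p \<in> N"
  shows "real_analytic_at (\<lambda>y. g (\<chi> i. if i \<in> T then 0 else y $ i)) p"
proof -
  let ?r = "\<lambda>y::real ^ 'i. (\<chi> i. if i \<in> T then 0 else y $ i) :: real ^ 'i"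
  have lim: "(?r \<longlongrightarrow> ?r z) (nhds z)" for z
  proof (rule vec_tendstoI)
    fix i
    have "((\<lambda>y. y $ i) \<longlongrightarrow> z $ i) (nhds z)" by (intro tendsto_vec_nth filterlim_ident)
    then show "((\<lambda>y. ?r y $ i) \<longlongrightarrow> ?r z $ i) (nhds z)" by (cases "i \<in> T") auto
  qed
  have near: "\<forall>\<^sub>F y in nhds z. ?r y \<in> N" if "?r z \<in> N" for z
  proof -
    have "\<forall>\<^sub>F y in nhds z. (\<forall>i\<in>T. ?r y $ i = 0) \<longrightarrow> ?r y \<in> N"
      using lim[of z] N_open[OF that] unfolding filterlim_iff by blast
    then show ?thesis by simp
  qed
  have "\<exists>c. has_power_series (\<lambda>y. g (?r y)) c z" if z: "?r z \<in> N" for z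
  proof -
    from g z obtain \<rho> c where \<rho>: "\<rho> > 0" "\<forall>y\<in>N \<inter> ball (?r z) \<rho>.
      ((\<lambda>\<kappa>. c \<kappa> * of_real (\<Prod>i\<in>UNIV. (y $ i - ?r z $ i) ^ \<kappa> i)) has_sum g y) UNIV"
      unfolding real_analytic_on_def by blast
    let ?c = "\<lambda>\<kappa>. if supported (- T) \<kappa> then c \<kappa> else 0"
    have "\<forall>\<^sub>F y in nhds (?r z). y \<in> ball (?r z) \<rho>" using \<rho>(1) by (intro eventually_nhds_in_open) auto
    then have "\<forall>\<^sub>F y in nhds z. ?r y \<in> ball (?r z) \<rho>"
      using lim[of z] unfolding filterlim_iff by blast
    with near[OF z] have "has_power_series (\<lambda>y. g (?r y)) ?c z" unfolding has_power_series_def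
    proof eventually_elim
      case (elim y)
      have "c \<kappa> * of_real (\<Prod>i\<in>UNIV. (?r y $ i - ?r z $ i) ^ \<kappa> i) = ?c \<kappa> * mpow \<kappa> (\<lambda>i. of_real (y $ i - z $ i))" for \<kappa>
      proof (cases "supported (- T) \<kappa>")
        case True
        then have "(\<Prod>i\<in>UNIV. (?r y $ i - ?r z $ i) ^ \<kappa> i) = (\<Prod>i\<in>UNIV. (y $ i - z $ i) ^ \<kappa> i)"
          by (intro prod.cong) (auto simp: supported_def)
        then show ?thesis using True by (simp add: mpow_def)
      next
        case False
        then obtain i where "i \<in> T" "\<kappa> i \<noteq> 0" by (auto simp: supported_def)
        then have "(\<Prod>i\<in>UNIV. (?r y $ i - ?r z $ i) ^ \<kappa> i) = 0"
          by (intro prod_zero bexI[of _ i]) auto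
        then show ?thesis using False by simp
      qed
      then have e: "(\<lambda>\<kappa>. c \<kappa> * of_real (\<Prod>i\<in>UNIV. (?r y $ i - ?r z $ i) ^ \<kappa> i))
          = (\<lambda>\<kappa>. ?c \<kappa> * mpow \<kappa> (\<lambda>i. of_real (y $ i - z $ i)))" by (rule ext)
      have "?r y \<in> N \<inter> ball (?r z) \<rho>" using elim by blast
      from \<rho>(2)[rule_format, OF this] show ?case unfolding e .
    qed
    then show ?thesis by blast
  qed
  moreover have "?r p = p" using N_T[OF p] by (simp add: vec_eq_iff)
  ultimately show ?thesis unfolding real_analytic_at_def using near[of p] p by (auto elim: eventually_mono)
qed

lemma carrier_A_N: "carrier (A_N N) = (\<lambda>f. restrict f N) ` {f. \<forall>p\<in>N. real_analytic_at f p}"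
proof -
  have "g \<in> (\<lambda>f. restrict f N) ` {f. \<forall>p\<in>N. real_analytic_at f p}" if g: "g \<in> extensional N" "real_analytic_on g N" for g
  proof (rule image_eqI)
    have "(\<chi> i. if i \<in> T then 0 else y $ i) = y" if "y \<in> N" for y
      using N_T[OF that] by (simp add: vec_eq_iff)
    then show "g = restrict (\<lambda>y. g (\<chi> i. if i \<in> T then 0 else y $ i)) N"
      using g(1) by (auto simp: fun_eq_iff extensional_def)
  qed (use proj_analytic[OF g(2)] in auto)
  moreover have "real_analytic_on (restrict f N) N" if "\<forall>p\<in>N. real_analytic_at f p" for f
    by (rule real_analytic_onI[of N f]) (use that analytic_power_series in \<open>auto, metis\<close>)
  ultimately show ?thesis by (auto simp: A_N_def)
qed

text \<open>
  On \<open>N\<close> the eigenfunctions with exponents off \<open>T\<close> have no zeros, so the uniqueness of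
  coefficients is a pointwise polynomial identity.
\<close>

lemma function_model_N: "function_model N T (- T) (A_N N) (\<lambda>f. restrict f N) (der_N N)"
proof
  show "carrier (A_N N) = (\<lambda>f. restrict f N) ` {f. \<forall>p\<in>N. real_analytic_at f p}" by (rule carrier_A_N)
next
  fix i f assume i: "i \<in> - T"
  have "partial i (restrict f N) y = partial i f y" if "y \<in> N" for y
    by (rule partial_N_cong[OF that]) (use i in auto)
  then show "der_N N i (restrict f N) = restrict (twisted_der T (\<lambda>_. 0) i f) N"
    using i by (auto simp: der_N_def twisted_der_def intro!: restrict_ext)
next
  fix f g assume "\<And>p. p \<in> N \<Longrightarrow> near_eq p f g"
  then show "restrict f N = restrict g N" by (auto intro!: restrict_ext near_eq_at)
next
  fix K c \<kappa>
  assume c: "coeff_family N (- T) K c"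
    and z: "\<And>n. supported (- T) n \<Longrightarrow> restrict (twisted_op T (\<lambda>_. 0) K c (eigenfun T n)) N = restrict (\<lambda>y. 0) N"
  have "c \<kappa> y = 0" if y: "y \<in> N" for y
  proof (cases "\<kappa> \<in> K")
    case True
    show ?thesis
    proof (rule poly_coeffs_zero[OF _ _ True])
      show "finite K" using c by (simp add: coeff_family_def)
      fix n :: "'i \<Rightarrow> nat"
      let ?n = "\<lambda>i. if i \<in> T then 0 else n i"
      have "twisted_op T (\<lambda>_. 0) K c (eigenfun T ?n) y = 0"
        using fun_cong[OF z[of ?n], of y] y by (auto simp: supported_def)
      moreover have "eigenfun T ?n y \<noteq> 0" unfolding eigenfun_def by (subst prod_zero_iff) auto
      ultimately have "(\<Sum>\<kappa>\<in>K. c \<kappa> y * mpow \<kappa> (\<lambda>i. of_nat (?n i))) = 0" by (simp add: twisted_op_eigenfun)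
      also have "(\<Sum>\<kappa>\<in>K. c \<kappa> y * mpow \<kappa> (\<lambda>i. of_nat (?n i))) = (\<Sum>\<kappa>\<in>K. c \<kappa> y * mpow \<kappa> (\<lambda>i. of_nat (n i)))"
        using c by (intro sum.cong refl arg_cong2[of _ _ _ _ "(*)"] mpow_cong[of "- T"]) (auto simp: coeff_family_def)
      finally show "(\<Sum>\<kappa>\<in>K. c \<kappa> y * mpow \<kappa> (\<lambda>i. of_nat (n i))) = 0" .
    qed
  qed (use c in \<open>simp add: coeff_family_def\<close>)
  then show "restrict (c \<kappa>) N = restrict (\<lambda>y. 0) N" by (auto intro!: restrict_ext)
qed (auto simp: A_N_def intro!: restrict_ext)

end

section \<open>Coefficients of the symbol map\<close>

text \<open>
  The multi-index \<open>\<kappa> = (\<alpha>, \<beta>)\<close> has \<open>\<alpha> = restr_index T \<kappa>\<close> and \<open>\<beta> = restr_index (- T) \<kappa>\<close>.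
\<close>

definition restr_index :: "'i set \<Rightarrow> 'i midx \<Rightarrow> 'i midx" where "restr_index T \<kappa> i = (if i \<in> T then \<kappa> i else 0)"

text \<open>
  On \<open>N\<close> these are the coefficients of the operator that stands at \<open>\<xi>\<^sup>\<alpha>\<close> in \<open>\<sigma>\<^sub>*\<close> of the operator
  with coefficients \<open>a\<close>.
\<close>

definition slice :: "'i set \<Rightarrow> 'i midx \<Rightarrow> ('i midx \<Rightarrow> (real ^ 'i::finite) \<Rightarrow> complex) \<Rightarrow> 'i midx \<Rightarrow> (real ^ 'i) \<Rightarrow> complex" where
  "slice T \<alpha> a \<beta> = (if supported T \<alpha> \<and> supported (- T) \<beta> then a (\<lambda>i. \<alpha> i + \<beta> i) else (\<lambda>_. 0))"

lemma supported_restr_index [simp]: "supported T (restr_index T \<kappa>)"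
  by (simp add: supported_def restr_index_def)

lemma restr_index_add: "supported T \<alpha> \<Longrightarrow> supported (- T) \<beta> \<Longrightarrow> restr_index T (\<lambda>i. \<alpha> i + \<beta> i) = \<alpha>"
  by (auto simp: restr_index_def supported_def)

lemma restr_index_compl_add: "supported T \<alpha> \<Longrightarrow> supported (- T) \<beta> \<Longrightarrow> restr_index (- T) (\<lambda>i. \<alpha> i + \<beta> i) = \<beta>"
  by (auto simp: restr_index_def supported_def)

lemma restr_index_split: "(\<lambda>i. restr_index T \<kappa> i + restr_index (- T) \<kappa> i) = \<kappa>"
  by (auto simp: restr_index_def)

lemma slice_parts: "slice T (restr_index T \<kappa>) a (restr_index (- T) \<kappa>) = a \<kappa>"
  by (simp add: slice_def restr_index_split)

lemma coeff_family_slice: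
  assumes "coeff_family S UNIV K a" shows "coeff_family S (- T) (restr_index (- T) ` K) (slice T \<alpha> a)"
proof -
  have "slice T \<alpha> a \<beta> = (\<lambda>_. 0)" if "\<beta> \<notin> restr_index (- T) ` K" for \<beta>
  proof (cases "supported T \<alpha> \<and> supported (- T) \<beta>")
    case True
    then have "(\<lambda>i. \<alpha> i + \<beta> i) \<notin> K" using that restr_index_compl_add[of T \<alpha> \<beta>] by (metis image_eqI)
    then show ?thesis using assms by (simp add: slice_def coeff_family_def)
  qed (auto simp: slice_def)
  then show ?thesis using assms by (auto simp: coeff_family_def slice_def)
qed

lemma slice_outside:
  assumes "coeff_family S UNIV K a" "\<alpha> \<notin> restr_index T ` K" shows "slice T \<alpha> a = (\<lambda>_ _. 0)"
proof
  fix \<beta>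
  show "slice T \<alpha> a \<beta> = (\<lambda>_. 0)"
  proof (cases "supported T \<alpha> \<and> supported (- T) \<beta>")
    case True
    then have "(\<lambda>i. \<alpha> i + \<beta> i) \<notin> K" using assms(2) restr_index_add[of T \<alpha> \<beta>] by (metis image_eqI)
    then show ?thesis using assms by (simp add: slice_def coeff_family_def)
  qed (auto simp: slice_def)
qed

lemma at_N_germ: "at_N N (germ N f) = restrict f N"
proof -
  have "restrict g N = restrict f N" if "g \<in> germ N f" for g
    using that by (auto simp: mem_germ_iff intro!: restrict_ext near_eq_at)
  then have 1: "(\<lambda>f. restrict f N) ` germ N f \<subseteq> {restrict f N}" by (intro image_subsetI) simp
  have 2: "restrict f N \<in> (\<lambda>f. restrict f N) ` germ N f" by (rule imageI) (simp add: mem_germ_iff)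
  have "(\<lambda>f. restrict f N) ` germ N f = {restrict f N}"
    by (rule subset_antisym[OF 1]) (simp only: insert_subset 2 empty_subsetI simp_thms)
  then show ?thesis by (simp add: at_N_def)
qed

lemma sum_convolution:
  fixes F :: "'i::finite midx \<Rightarrow> 'i midx \<Rightarrow> complex"
  assumes A: "finite A" "finite A1" "finite A2" "\<And>\<mu> \<nu>. \<mu> \<in> A1 \<Longrightarrow> \<nu> \<in> A2 \<Longrightarrow> (\<lambda>i. \<mu> i + \<nu> i) \<in> A"
    and 0: "\<And>\<mu> \<nu>. \<mu> \<notin> A1 \<or> \<nu> \<notin> A2 \<Longrightarrow> F \<mu> \<nu> = 0"
  shows "(\<Sum>\<alpha>\<in>A. \<Sum>\<mu> | \<forall>i. \<mu> i \<le> \<alpha> i. F \<mu> (\<lambda>i. \<alpha> i - \<mu> i)) = (\<Sum>\<mu>\<in>A1. \<Sum>\<nu>\<in>A2. F \<mu> \<nu>)"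
proof -
  let ?S = "SIGMA \<alpha>:A. {\<mu>. \<forall>i. \<mu> i \<le> \<alpha> i}"
  let ?S' = "{(\<alpha>, \<mu>). (\<alpha>, \<mu>) \<in> ?S \<and> \<mu> \<in> A1 \<and> (\<lambda>i. \<alpha> i - \<mu> i) \<in> A2}"
  have "(\<Sum>\<alpha>\<in>A. \<Sum>\<mu> | \<forall>i. \<mu> i \<le> \<alpha> i. F \<mu> (\<lambda>i. \<alpha> i - \<mu> i)) = (\<Sum>(\<alpha>, \<mu>)\<in>?S. F \<mu> (\<lambda>i. \<alpha> i - \<mu> i))"
    by (rule sum.Sigma) (use A finite_box in auto)
  also have "\<dots> = (\<Sum>(\<alpha>, \<mu>)\<in>?S'. F \<mu> (\<lambda>i. \<alpha> i - \<mu> i))"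
    by (rule sum.mono_neutral_right) (use A(1) finite_box 0 in \<open>auto intro!: finite_SigmaI\<close>)
  also have "\<dots> = (\<Sum>(\<mu>, \<nu>)\<in>A1 \<times> A2. F \<mu> \<nu>)"
    by (rule sum.reindex_bij_witness[where i = "\<lambda>(\<mu>, \<nu>). (\<lambda>i. \<mu> i + \<nu> i, \<mu>)" and j = "\<lambda>(\<alpha>, \<mu>). (\<mu>, \<lambda>i. \<alpha> i - \<mu> i)"])
       (use A(4) in auto)
  also have "\<dots> = (\<Sum>\<mu>\<in>A1. \<Sum>\<nu>\<in>A2. F \<mu> \<nu>)" by (rule sum.cartesian_product [symmetric])
  finally show ?thesis .
qed

lemma twisted_op_zero_fun: "twisted_op T l K a (\<lambda>_. 0) = (\<lambda>_. 0)"
proof -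
  have "iter_der (twisted_der T l) \<kappa> (\<lambda>_. 0) = (\<lambda>_. 0)" for \<kappa>
    by (rule iter_der_induct[of "\<lambda>u. u = (\<lambda>_. 0)"]) (auto simp: twisted_der_def)
  then show ?thesis by (simp add: twisted_op_def)
qed

lemma twisted_op_diff:
  assumes "real_analytic_at f p" "real_analytic_at g p"
  shows "near_eq p (twisted_op T l K c (\<lambda>y. f y - g y)) (\<lambda>y. twisted_op T l K c f y - twisted_op T l K c g y)"
  using twisted_op_lin[of UNIV "\<lambda>b. if b then f else g" p T l K c "\<lambda>b. if b then 1 else - 1"] assms
  by (simp add: UNIV_bool)

section \<open>Polynomial algebras\<close>

lemma poly_monoid:
  fixes G :: "('k, 'a) module" (structure)
  assumes "abelian_monoid G" shows "abelian_monoid (poly_alg G I)"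
proof (rule abelian_monoidI)
  interpret abelian_monoid G by (rule assms)
  fix f g assume fg: "f \<in> carrier (poly_alg G I)" "g \<in> carrier (poly_alg G I)"
  have "finite ({\<kappa>. f \<kappa> \<noteq> \<zero>} \<union> {\<kappa>. g \<kappa> \<noteq> \<zero>})" using fg by (simp add: poly_alg_def families_def)
  then have "finite {\<kappa>. f \<kappa> \<oplus> g \<kappa> \<noteq> \<zero>}" by (rule rev_finite_subset) auto
  moreover have "supported I \<kappa>" if "f \<kappa> \<oplus> g \<kappa> \<noteq> \<zero>" for \<kappa>
    using that fg by (cases "f \<kappa> = \<zero>") (auto simp: poly_alg_def families_def)
  ultimately show "f \<oplus>\<^bsub>poly_alg G I\<^esub> g \<in> carrier (poly_alg G I)"
    using fg by (auto simp: poly_alg_def families_def)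
qed (auto simp: poly_alg_def families_def abelian_monoid.a_assoc[OF assms] abelian_monoid.a_comm[OF assms]
    abelian_monoid.zero_closed[OF assms] abelian_monoid.l_zero[OF assms] abelian_monoid.r_zero[OF assms])

lemma finsum_poly:
  fixes G :: "('k, 'a) module" (structure)
  assumes G: "abelian_monoid G" and "finite J" "\<And>j. j \<in> J \<Longrightarrow> F j \<in> carrier (poly_alg G I)"
  shows "finsum (poly_alg G I) F J \<alpha> = finsum G (\<lambda>j. F j \<alpha>) J"
  using assms(2,3)
proof (induction J rule: finite_induct)
  case empty
  show ?case
    by (simp add: abelian_monoid.finsum_empty[OF G] abelian_monoid.finsum_empty[OF poly_monoid[OF G]])
      (simp add: poly_alg_def)
next
  case (insert j J)
  interpret abelian_monoid G by (rule G)
  interpret P: abelian_monoid "poly_alg G I" by (rule poly_monoid[OF G])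
  have c: "F i \<alpha> \<in> carrier G" if "i \<in> insert j J" for i
    using insert.prems[OF that] by (simp add: poly_alg_def families_def)
  have "finsum (poly_alg G I) F (insert j J) = F j \<oplus>\<^bsub>poly_alg G I\<^esub> finsum (poly_alg G I) F J"
    using insert by (intro P.finsum_insert) auto
  then show ?case using insert c by (simp add: poly_alg_def Pi_def)
qed

context crossing
begin

sublocale GM: function_model N T UNIV "A_M N" "germ N" "der_M N T" by (rule function_model_M)
sublocale GN: function_model N T "- T" "A_N N" "\<lambda>f. restrict f N" "der_N N" by (rule function_model_N)

lemma D_tilde_eq: "D_tilde N T = GM.D" by (simp add: D_tilde_def)
lemma D_N_eq: "D_N N T = GN.D" by (simp add: D_N_def)

section \<open>Multiplicativity of the symbol map\<close>

lemma coeffs_M_op: "GM.is_op P K a \<Longrightarrow> coeffs_M N T P = (\<lambda>\<kappa>. germ N (a \<kappa>))"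
  unfolding coeffs_M_def by (rule GM.is_op_coeffs)

lemma subst_star_germ:
  "subst_star N T (\<lambda>\<kappa>. germ N (a \<kappa>)) \<alpha> = diff_op (A_N N) (der_N N) (\<lambda>\<beta>. restrict (slice T \<alpha> a \<beta>) N)"
  unfolding subst_star_def
  by (intro arg_cong[of _ _ "diff_op (A_N N) (der_N N)"] ext) (auto simp: at_N_germ slice_def A_N_def)

lemma is_op_subst_star:
  "coeff_family N UNIV K a \<Longrightarrow> GN.is_op (subst_star N T (\<lambda>\<kappa>. germ N (a \<kappa>)) \<alpha>) (restr_index (- T) ` K) (slice T \<alpha> a)"
  unfolding GN.is_op_def by (simp add: coeff_family_slice subst_star_germ)

lemma GN_zero: "GN.is_op P K (\<lambda>_ _. 0) \<Longrightarrow> P = \<zero>\<^bsub>GN.D\<^esub>"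
  using GN.is_op_zero by (auto simp: GN.is_op_def)

lemma subst_star_carrier:
  assumes a: "coeff_family N UNIV K a"
  shows "subst_star N T (\<lambda>\<kappa>. germ N (a \<kappa>)) \<in> carrier (poly_alg GN.D T)"
proof -
  let ?s = "subst_star N T (\<lambda>\<kappa>. germ N (a \<kappa>))"
  have z: "?s \<alpha> = \<zero>\<^bsub>GN.D\<^esub>" if "\<alpha> \<notin> restr_index T ` K" for \<alpha>
    using is_op_subst_star[OF a, of \<alpha>] unfolding slice_outside[OF a that] by (rule GN_zero)
  then have sub: "{\<alpha>. ?s \<alpha> \<noteq> \<zero>\<^bsub>GN.D\<^esub>} \<subseteq> restr_index T ` K" by auto
  have "finite {\<alpha>. ?s \<alpha> \<noteq> \<zero>\<^bsub>GN.D\<^esub>}" by (rule finite_subset[OF sub]) (use a in \<open>simp add: coeff_family_def\<close>)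
  moreover have "supported T \<alpha>" if "?s \<alpha> \<noteq> \<zero>\<^bsub>GN.D\<^esub>" for \<alpha>
  proof -
    have "\<alpha> \<in> restr_index T ` K" using that sub by blast
    then show ?thesis by auto
  qed
  moreover have "?s \<alpha> \<in> carrier GN.D" for \<alpha> using is_op_subst_star[OF a] GN.carrier_D by blast
  ultimately show ?thesis by (auto simp: poly_alg_def families_def)
qed

lemma twisted_op_N_cong:
  assumes "\<And>z. z \<in> N \<Longrightarrow> f z = g z" "y \<in> N" shows "twisted_op T l K a f y = twisted_op T l K a g y"
  unfolding twisted_op_def using iter_N_cong[of f g y, OF assms] by simp

lemma iter_cong_index: "(\<And>i. \<kappa> i \<noteq> 0 \<Longrightarrow> \<delta> i = \<delta>' i) \<Longrightarrow> iter_der \<delta> \<kappa> u = iter_der \<delta>' \<kappa> u"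
  by (rule iter_der_rel[of "(=)"]) auto

text \<open>
  The value of the polynomial \<open>\<sigma>\<^sub>*\<close> at \<open>\<xi> = l\<close> is the twist of the operator by \<open>t\<^sup>l\<close>, restricted to
  \<open>N\<close>.
\<close>

lemma sum_slice:
  assumes a: "coeff_family N UNIV K a" and A: "finite A" "restr_index T ` K \<subseteq> A"
    and f: "\<And>p. p \<in> N \<Longrightarrow> real_analytic_at f p" and y: "y \<in> N"
  shows "(\<Sum>\<alpha>\<in>A. mpow \<alpha> l * twisted_op T (\<lambda>_. 0) (restr_index (- T) ` K) (slice T \<alpha> a) f y)
    = twisted_op T (\<lambda>i. if i \<in> T then l i else 0) K a f y"
proof -
  let ?it = "\<lambda>\<beta>. iter_der (twisted_der T (\<lambda>_. 0)) \<beta> f y" and ?l = "\<lambda>i. if i \<in> T then l i else 0"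
  let ?h = "\<lambda>\<kappa>. (restr_index T \<kappa>, restr_index (- T) \<kappa>)"
  have K: "finite K" using a by (simp add: coeff_family_def)
  have inj: "inj_on ?h K"
  proof (rule inj_onI)
    fix \<kappa> \<mu> assume "?h \<kappa> = ?h \<mu>"
    then have "(\<lambda>i. restr_index T \<kappa> i + restr_index (- T) \<kappa> i) = (\<lambda>i. restr_index T \<mu> i + restr_index (- T) \<mu> i)" by simp
    then show "\<kappa> = \<mu>" unfolding restr_index_split .
  qed
  have 0: "slice T \<alpha> a \<beta> = (\<lambda>_. 0)" if "(\<alpha>, \<beta>) \<notin> ?h ` K" for \<alpha> \<beta>
  proof (cases "supported T \<alpha> \<and> supported (- T) \<beta>")
    case True
    then have "(\<alpha>, \<beta>) = ?h (\<lambda>i. \<alpha> i + \<beta> i)" by (simp add: restr_index_add restr_index_compl_add)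
    then have "(\<lambda>i. \<alpha> i + \<beta> i) \<notin> K" using that imageI[of "\<lambda>i. \<alpha> i + \<beta> i" K ?h] by auto
    then show ?thesis using a by (simp add: slice_def coeff_family_def)
  qed (auto simp: slice_def)
  have "twisted_op T ?l K a f y = (\<Sum>\<kappa>\<in>K. mpow (restr_index T \<kappa>) l * (a \<kappa> y * ?it (restr_index (- T) \<kappa>)))"
    unfolding twisted_op_def
  proof (rule sum.cong[OF refl])
    fix \<kappa>
    have split: "iter_der (twisted_der T ?l) \<kappa> f y
        = (\<Prod>i\<in>T. ?l i ^ \<kappa> i) * iter_der (twisted_der T ?l) (\<lambda>i. if i \<in> T then 0 else \<kappa> i) f y"
      by (rule iter_N_split[OF f y])
    have "mpow (restr_index T \<kappa>) l = (\<Prod>i\<in>T. l i ^ \<kappa> i)"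
      unfolding mpow_def by (rule prod.mono_neutral_cong_right) (auto simp: restr_index_def)
    moreover have "(\<Prod>i\<in>T. ?l i ^ \<kappa> i) = (\<Prod>i\<in>T. l i ^ \<kappa> i)" by (rule prod.cong) auto
    moreover have "(\<lambda>i. if i \<in> T then 0 else \<kappa> i) = restr_index (- T) \<kappa>" by (auto simp: restr_index_def)
    moreover have "iter_der (twisted_der T ?l) (restr_index (- T) \<kappa>) f = iter_der (twisted_der T (\<lambda>_. 0)) (restr_index (- T) \<kappa>) f"
      by (rule iter_cong_index) (auto simp: restr_index_def twisted_der_def split: if_splits)
    ultimately show "a \<kappa> y * iter_der (twisted_der T ?l) \<kappa> f y = mpow (restr_index T \<kappa>) l * (a \<kappa> y * ?it (restr_index (- T) \<kappa>))"
      unfolding split by simp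
  qed
  also have "\<dots> = (\<Sum>(\<alpha>, \<beta>)\<in>?h ` K. mpow \<alpha> l * (slice T \<alpha> a \<beta> y * ?it \<beta>))"
    by (subst sum.reindex[OF inj]) (simp add: slice_parts)
  also have "\<dots> = (\<Sum>(\<alpha>, \<beta>)\<in>A \<times> restr_index (- T) ` K. mpow \<alpha> l * (slice T \<alpha> a \<beta> y * ?it \<beta>))"
    by (rule sum.mono_neutral_left) (use A K 0 in auto)
  finally show ?thesis by (simp add: sum.cartesian_product twisted_op_def sum_distrib_left)
qed

text \<open>
  Both sides are coefficients of polynomials in \<open>\<xi>\<close>, namely of \<open>\<sigma>\<^sub>*\<close> of a product and of a product
  of values of \<open>\<sigma>\<^sub>*\<close>. By \<open>sum_slice\<close> they agree at every \<open>\<xi> = l\<close>, where they become the compositions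
  of twisted operators in the hypothesis on \<open>c\<close>.
\<close>

lemma slice_compose:
  fixes a b :: "'m::finite \<Rightarrow> 'i midx \<Rightarrow> (real ^ 'i) \<Rightarrow> complex"
  assumes a: "\<And>k. coeff_family N UNIV K (a k)" and b: "\<And>k. coeff_family N UNIV L (b k)" and c: "coeff_family N UNIV M c"
    and comp: "\<And>l f p. p \<in> N \<Longrightarrow> real_analytic_at f p \<Longrightarrow>
      near_eq p (twisted_op T l M c f) (\<lambda>y. \<Sum>k\<in>UNIV. twisted_op T l K (a k) (twisted_op T l L (b k) f) y)"
    and f: "\<And>p. p \<in> N \<Longrightarrow> real_analytic_at f p" and y: "y \<in> N"
  shows "twisted_op T (\<lambda>_. 0) (restr_index (- T) ` M) (slice T \<alpha> c) f y
    = (\<Sum>k\<in>UNIV. \<Sum>\<mu> | \<forall>i. \<mu> i \<le> \<alpha> i. twisted_op T (\<lambda>_. 0) (restr_index (- T) ` K) (slice T \<mu> (a k))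
        (twisted_op T (\<lambda>_. 0) (restr_index (- T) ` L) (slice T (\<lambda>i. \<alpha> i - \<mu> i) (b k)) f) y)" (is "?U \<alpha> = ?V \<alpha>")
proof -
  let ?A1 = "restr_index T ` K" and ?A2 = "restr_index T ` L"
  let ?A = "restr_index T ` M \<union> (\<lambda>(\<mu>, \<nu>). (\<lambda>i. \<mu> i + \<nu> i)) ` (?A1 \<times> ?A2)"
  let ?b = "\<lambda>\<nu> k. twisted_op T (\<lambda>_. 0) (restr_index (- T) ` L) (slice T \<nu> (b k)) f"
  let ?F = "\<lambda>k \<mu> \<nu>. twisted_op T (\<lambda>_. 0) (restr_index (- T) ` K) (slice T \<mu> (a k)) (?b \<nu> k) y"
  have fin: "finite K" "finite L" "finite M" using a b c by (auto simp: coeff_family_def)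
  have supA: "supported T \<alpha>" if "\<alpha> \<in> ?A" for \<alpha> using that by (auto simp: supported_def restr_index_def)
  have F0: "?F k \<mu> \<nu> = 0" if "\<mu> \<notin> ?A1 \<or> \<nu> \<notin> ?A2" for k \<mu> \<nu>
  proof (cases "\<mu> \<notin> ?A1")
    case True
    then show ?thesis by (simp add: slice_outside[OF a] twisted_op_def)
  next
    case False
    then have "slice T \<nu> (b k) = (\<lambda>_ _. 0)" using that by (intro slice_outside[OF b]) auto
    then have "?b \<nu> k = (\<lambda>_. 0)" by (simp add: twisted_op_def)
    then show ?thesis by (simp only: twisted_op_zero_fun)
  qed
  have anab: "real_analytic_at (?b \<nu> k) p" if "p \<in> N" for \<nu> k p
    using coeff_family_slice[OF b, of T \<nu>] f that by (auto simp: coeff_family_def intro!: analytic_twisted_op)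
  have outside: "?U \<alpha> = 0" "?V \<alpha> = 0" if "\<alpha> \<notin> ?A" for \<alpha>
  proof -
    show "?U \<alpha> = 0" using that by (simp add: slice_outside[OF c] twisted_op_def)
    have "\<mu> \<notin> ?A1 \<or> (\<lambda>i. \<alpha> i - \<mu> i) \<notin> ?A2" if "\<forall>i. \<mu> i \<le> \<alpha> i" for \<mu>
    proof (rule ccontr)
      assume "\<not> ?thesis"
      then have "(\<lambda>i. \<mu> i + (\<alpha> i - \<mu> i)) \<in> ?A" by (intro UnI2 image_eqI[of _ _ "(\<mu>, \<lambda>i. \<alpha> i - \<mu> i)"]) auto
      moreover have "(\<lambda>i. \<mu> i + (\<alpha> i - \<mu> i)) = \<alpha>" using that by auto
      ultimately show False using \<open>\<alpha> \<notin> ?A\<close> by simp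
    qed
    then show "?V \<alpha> = 0" by (intro sum.neutral ballI F0) simp
  qed
  have eval: "(\<Sum>\<alpha>\<in>?A. (?U \<alpha> - ?V \<alpha>) * mpow \<alpha> l) = 0" for l
  proof -
    let ?l = "\<lambda>i. if i \<in> T then l i else 0"
    have 1: "(\<Sum>\<alpha>\<in>?A. mpow \<alpha> l * ?U \<alpha>) = (\<Sum>k\<in>UNIV. twisted_op T ?l K (a k) (twisted_op T ?l L (b k) f) y)"
      using sum_slice[OF c, of ?A f y l] fin f y near_eq_at[OF comp[OF y f[OF y], of ?l]] by simp
    have "(\<Sum>\<alpha>\<in>?A. mpow \<alpha> l * ?V \<alpha>) = (\<Sum>k\<in>UNIV. \<Sum>\<alpha>\<in>?A. \<Sum>\<mu> | \<forall>i. \<mu> i \<le> \<alpha> i. mpow \<mu> l * mpow (\<lambda>i. \<alpha> i - \<mu> i) l * ?F k \<mu> (\<lambda>i. \<alpha> i - \<mu> i))"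
    proof -
      have "mpow \<alpha> l = mpow \<mu> l * mpow (\<lambda>i. \<alpha> i - \<mu> i) l" if "\<forall>i. \<mu> i \<le> \<alpha> i" for \<alpha> \<mu> :: "'i midx"
        using that by (subst mpow_add [symmetric]) simp
      then have "mpow \<alpha> l * ?V \<alpha> = (\<Sum>k\<in>UNIV. \<Sum>\<mu> | \<forall>i. \<mu> i \<le> \<alpha> i. mpow \<mu> l * mpow (\<lambda>i. \<alpha> i - \<mu> i) l * ?F k \<mu> (\<lambda>i. \<alpha> i - \<mu> i))" for \<alpha>
        unfolding sum_distrib_left by (intro sum.cong refl) simp
      then show ?thesis by (simp only: sum.swap[of _ UNIV])
    qed
    also have "\<dots> = (\<Sum>k\<in>UNIV. \<Sum>\<mu>\<in>?A1. \<Sum>\<nu>\<in>?A2. mpow \<mu> l * mpow \<nu> l * ?F k \<mu> \<nu>)"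
      by (intro sum.cong refl sum_convolution) (use fin F0 in auto)
    also have "\<dots> = (\<Sum>k\<in>UNIV. twisted_op T ?l K (a k) (twisted_op T ?l L (b k) f) y)"
    proof (rule sum.cong[OF refl])
      fix k
      have "(\<Sum>\<nu>\<in>?A2. mpow \<nu> l * ?F k \<mu> \<nu>) = twisted_op T (\<lambda>_. 0) (restr_index (- T) ` K) (slice T \<mu> (a k)) (twisted_op T ?l L (b k) f) y" for \<mu>
      proof -
        have "(\<Sum>\<nu>\<in>?A2. mpow \<nu> l * ?F k \<mu> \<nu>) = twisted_op T (\<lambda>_. 0) (restr_index (- T) ` K) (slice T \<mu> (a k)) (\<lambda>y. \<Sum>\<nu>\<in>?A2. mpow \<nu> l * ?b \<nu> k y) y"
          by (rule near_eq_at[OF twisted_op_lin, symmetric]) (rule anab[OF y])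
        also have "\<dots> = twisted_op T (\<lambda>_. 0) (restr_index (- T) ` K) (slice T \<mu> (a k)) (twisted_op T ?l L (b k) f) y"
          by (rule twisted_op_N_cong[OF _ y]) (rule sum_slice[OF b], use fin f in auto)
        finally show ?thesis .
      qed
      then have "(\<Sum>\<mu>\<in>?A1. \<Sum>\<nu>\<in>?A2. mpow \<mu> l * mpow \<nu> l * ?F k \<mu> \<nu>)
          = (\<Sum>\<mu>\<in>?A1. mpow \<mu> l * twisted_op T (\<lambda>_. 0) (restr_index (- T) ` K) (slice T \<mu> (a k)) (twisted_op T ?l L (b k) f) y)"
        by (simp only: mult.assoc sum_distrib_left [symmetric])
      also have "\<dots> = twisted_op T ?l K (a k) (twisted_op T ?l L (b k) f) y"
        by (rule sum_slice[OF a _ _ _ y]) (use fin b f in \<open>auto simp: coeff_family_def intro!: analytic_twisted_op\<close>)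
      finally show "(\<Sum>\<mu>\<in>?A1. \<Sum>\<nu>\<in>?A2. mpow \<mu> l * mpow \<nu> l * ?F k \<mu> \<nu>) = twisted_op T ?l K (a k) (twisted_op T ?l L (b k) f) y" .
    qed
    finally have 2: "(\<Sum>\<alpha>\<in>?A. mpow \<alpha> l * ?V \<alpha>) = (\<Sum>k\<in>UNIV. twisted_op T ?l K (a k) (twisted_op T ?l L (b k) f) y)" .
    have "(\<Sum>\<alpha>\<in>?A. (?U \<alpha> - ?V \<alpha>) * mpow \<alpha> l) = (\<Sum>\<alpha>\<in>?A. mpow \<alpha> l * ?U \<alpha>) - (\<Sum>\<alpha>\<in>?A. mpow \<alpha> l * ?V \<alpha>)"
      by (simp only: sum_subtractf [symmetric] right_diff_distrib mult.commute[of _ "mpow _ l"])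
    then show ?thesis unfolding 1 2 by simp
  qed
  show ?thesis
  proof (cases "\<alpha> \<in> ?A")
    case True
    have "?U \<alpha> - ?V \<alpha> = 0"
      by (rule poly_coeffs_zero[OF _ _ True]) (use fin eval in auto)
    then show ?thesis by simp
  qed (use outside in simp)
qed

lemma poly_mult_op:
  assumes f: "\<And>\<alpha>. GN.is_op (f \<alpha>) K (a \<alpha>)" and g: "\<And>\<alpha>. GN.is_op (g \<alpha>) L (b \<alpha>)"
  shows "\<exists>M c. GN.is_op ((f \<otimes>\<^bsub>poly_alg GN.D T\<^esub> g) \<alpha>) M c \<and>
    (\<forall>u. GN.regular u \<longrightarrow> (\<forall>y\<in>N. GN.op0 M c u y
      = (\<Sum>\<mu> | \<forall>i. \<mu> i \<le> \<alpha> i. GN.op0 K (a \<mu>) (GN.op0 L (b (\<lambda>i. \<alpha> i - \<mu> i)) u) y)))"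
proof -
  let ?P = "\<lambda>\<mu>. f \<mu> \<otimes>\<^bsub>GN.D\<^esub> g (\<lambda>i. \<alpha> i - \<mu> i)"
  define Q where "Q \<mu> M c \<longleftrightarrow> GN.is_op (?P \<mu>) M c \<and> (\<forall>u. GN.regular u \<longrightarrow> (\<forall>y\<in>N. GN.op0 M c u y
      = GN.op0 K (a \<mu>) (GN.op0 L (b (\<lambda>i. \<alpha> i - \<mu> i)) u) y))" for \<mu> M c
  have "\<exists>M c. Q \<mu> M c" for \<mu>
  proof -
    obtain M c where "GN.is_op (?P \<mu>) M c" "\<And>l u p. p \<in> N \<Longrightarrow> real_analytic_at u p \<Longrightarrow>
        near_eq p (twisted_op T l M c u) (twisted_op T l K (a \<mu>) (twisted_op T l L (b (\<lambda>i. \<alpha> i - \<mu> i)) u))"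
      using GN.is_op_mult[OF f[of \<mu>] g[of "\<lambda>i. \<alpha> i - \<mu> i"]] by blast
    then show ?thesis unfolding Q_def by (intro exI conjI allI impI ballI) (auto intro: near_eq_at)
  qed
  then obtain M c where "\<And>\<mu>. Q \<mu> (M \<mu>) (c \<mu>)" by metis
  then have Mc: "\<And>\<mu>. GN.is_op (?P \<mu>) (M \<mu>) (c \<mu>)" "\<And>\<mu> u y. GN.regular u \<Longrightarrow> y \<in> N \<Longrightarrow>
      GN.op0 (M \<mu>) (c \<mu>) u y = GN.op0 K (a \<mu>) (GN.op0 L (b (\<lambda>i. \<alpha> i - \<mu> i)) u) y"
    by (simp_all add: Q_def)
  obtain M' c' where M': "GN.is_op (finsum GN.D ?P {\<mu>. \<forall>i. \<mu> i \<le> \<alpha> i}) M' c'"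
    "\<And>l u y. twisted_op T l M' c' u y = (\<Sum>\<mu> | \<forall>i. \<mu> i \<le> \<alpha> i. twisted_op T l (M \<mu>) (c \<mu>) u y)"
    using GN.is_op_finsum[OF finite_box[of \<alpha>], of ?P M c, OF Mc(1)] by (elim exE conjE) (rule that, assumption, (drule spec)+, assumption)
  show ?thesis
    using M'(1) by (intro exI[of _ M'] exI[of _ c']) (auto simp: poly_alg_def M'(2) Mc(2))
qed

lemma GN_mult_zero:
  assumes "GN.is_op P K a" "GN.is_op Q L b" "P = \<zero>\<^bsub>GN.D\<^esub> \<or> Q = \<zero>\<^bsub>GN.D\<^esub>" shows "P \<otimes>\<^bsub>GN.D\<^esub> Q = \<zero>\<^bsub>GN.D\<^esub>"
proof (rule GN.extensional_eqI)
  fix f assume f: "GN.regular f"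
  have z: "\<zero>\<^bsub>GN.D\<^esub> u = restrict (\<lambda>_. 0) N" if "u \<in> carrier (A_N N)" for u
    using that by (simp add: diff_alg_def GN.q_zero)
  have Q: "Q (restrict f N) \<in> carrier (A_N N)" by (rule GN.is_op_closed[OF assms(2) GN.q_closed[OF f]])
  have "P (restrict (\<lambda>_. 0) N) = restrict (\<lambda>_. 0) N"
    using GN.is_op_apply[OF assms(1), of "\<lambda>_. 0"] by (simp add: twisted_op_zero_fun)
  then have "P (Q (restrict f N)) = restrict (\<lambda>_. 0) N"
    using assms(3) z[OF Q] z[OF GN.q_closed[OF f]] by auto
  then show "(P \<otimes>\<^bsub>GN.D\<^esub> Q) (restrict f N) = \<zero>\<^bsub>GN.D\<^esub> (restrict f N)"
    using z[OF GN.q_closed[OF f]] GN.q_closed[OF f] by (simp add: diff_alg_def compose_def)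
qed (auto simp: diff_alg_def)

lemma poly_mult_closed:
  assumes f: "\<And>\<alpha>. GN.is_op (f \<alpha>) K (a \<alpha>)" "f \<in> carrier (poly_alg GN.D T)"
    and g: "\<And>\<alpha>. GN.is_op (g \<alpha>) L (b \<alpha>)" "g \<in> carrier (poly_alg GN.D T)"
  shows "f \<otimes>\<^bsub>poly_alg GN.D T\<^esub> g \<in> carrier (poly_alg GN.D T)"
proof -
  let ?h = "f \<otimes>\<^bsub>poly_alg GN.D T\<^esub> g"
  let ?A = "{\<alpha>. f \<alpha> \<noteq> \<zero>\<^bsub>GN.D\<^esub>}" and ?B = "{\<alpha>. g \<alpha> \<noteq> \<zero>\<^bsub>GN.D\<^esub>}"
  let ?C = "(\<lambda>(\<mu>, \<nu>). (\<lambda>i. \<mu> i + \<nu> i)) ` (?A \<times> ?B)"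
  have fin: "finite ?A" "finite ?B" and sup: "\<And>\<alpha>. \<alpha> \<in> ?A \<Longrightarrow> supported T \<alpha>" "\<And>\<alpha>. \<alpha> \<in> ?B \<Longrightarrow> supported T \<alpha>"
    using f(2) g(2) by (auto simp: poly_alg_def families_def)
  have z: "?h \<alpha> = \<zero>\<^bsub>GN.D\<^esub>" if "\<alpha> \<notin> ?C" for \<alpha>
  proof -
    have "f \<mu> \<otimes>\<^bsub>GN.D\<^esub> g (\<lambda>i. \<alpha> i - \<mu> i) = \<zero>\<^bsub>GN.D\<^esub>" if \<mu>: "\<forall>i. \<mu> i \<le> \<alpha> i" for \<mu>
    proof (rule GN_mult_zero[OF f(1) g(1)], rule ccontr)
      assume "\<not> (f \<mu> = \<zero>\<^bsub>GN.D\<^esub> \<or> g (\<lambda>i. \<alpha> i - \<mu> i) = \<zero>\<^bsub>GN.D\<^esub>)"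
      then have "(\<lambda>i. \<mu> i + (\<alpha> i - \<mu> i)) \<in> ?C" by (intro image_eqI[of _ _ "(\<mu>, \<lambda>i. \<alpha> i - \<mu> i)"]) auto
      moreover have "(\<lambda>i. \<mu> i + (\<alpha> i - \<mu> i)) = \<alpha>" using \<mu> by auto
      ultimately show False using \<open>\<alpha> \<notin> ?C\<close> by simp
    qed
    then have "finsum GN.D (\<lambda>\<mu>. f \<mu> \<otimes>\<^bsub>GN.D\<^esub> g (\<lambda>i. \<alpha> i - \<mu> i)) {\<mu>. \<forall>i. \<mu> i \<le> \<alpha> i} = finsum GN.D (\<lambda>\<mu>. \<zero>\<^bsub>GN.D\<^esub>) {\<mu>. \<forall>i. \<mu> i \<le> \<alpha> i}"
      by (intro GN.D.finsum_cong') auto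
    then show ?thesis by (simp add: poly_alg_def GN.D.finsum_zero)
  qed
  have C: "{\<alpha>. ?h \<alpha> \<noteq> \<zero>\<^bsub>GN.D\<^esub>} \<subseteq> ?C" using z by blast
  have "finite {\<alpha>. ?h \<alpha> \<noteq> \<zero>\<^bsub>GN.D\<^esub>}" by (rule finite_subset[OF C]) (use fin in auto)
  moreover have "supported T \<alpha>" if "?h \<alpha> \<noteq> \<zero>\<^bsub>GN.D\<^esub>" for \<alpha>
  proof -
    have "\<alpha> \<in> ?C" using that C by blast
    then obtain \<mu> \<nu> where "\<mu> \<in> ?A" "\<nu> \<in> ?B" "\<alpha> = (\<lambda>i. \<mu> i + \<nu> i)" by auto
    then show ?thesis using sup(1)[of \<mu>] sup(2)[of \<nu>] by (simp add: supported_def)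
  qed
  moreover have "?h \<alpha> \<in> carrier GN.D" for \<alpha>
    using poly_mult_op[of f K a g L b \<alpha>, OF f(1) g(1)] GN.carrier_D by blast
  ultimately show ?thesis by (auto simp: poly_alg_def[of GN.D] families_def)
qed

abbreviation "\<sigma> \<equiv> sigma_star N T"

lemma sigma_star_op: "GM.is_op (X i j) K a \<Longrightarrow> \<sigma> X i j = subst_star N T (\<lambda>\<kappa>. germ N (a \<kappa>))"
  by (simp add: sigma_star_def coeffs_M_op)

lemma sigma_star_is_op:
  assumes "GM.is_op (X i j) K a"
  shows "GN.is_op (\<sigma> X i j \<alpha>) (restr_index (- T) ` K) (slice T \<alpha> a)"
  using assms unfolding sigma_star_op[of X i j, OF assms] by (intro is_op_subst_star) (simp add: GM.is_op_def)

lemma sigma_star_carrier: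
  assumes "GM.is_op (X i j) K a" shows "\<sigma> X i j \<in> carrier (poly_alg GN.D T)"
proof -
  have "coeff_family N UNIV K a" using assms by (simp add: GM.is_op_def)
  then show ?thesis unfolding sigma_star_op[of X i j, OF assms] by (rule subst_star_carrier)
qed

lemma sigma_star_mult:
  fixes X Y :: "'m::finite \<Rightarrow> 'm \<Rightarrow> 'i op_M"
  assumes X: "X \<in> carrier (mat_alg GM.D)" and Y: "Y \<in> carrier (mat_alg GM.D)"
  shows "\<sigma> (X \<otimes>\<^bsub>mat_alg GM.D\<^esub> Y) = \<sigma> X \<otimes>\<^bsub>mat_alg (poly_alg GN.D T)\<^esub> \<sigma> Y"
proof (rule ext, rule ext, rule ext)
  fix i j \<alpha>
  obtain K a where a: "\<And>i j. GM.is_op (X i j) K (a i j)" by (rule GM.matrix_cases[OF X]) blast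
  obtain L b where b: "\<And>i j. GM.is_op (Y i j) L (b i j)" by (rule GM.matrix_cases[OF Y]) blast
  obtain M c where c: "GM.is_op ((X \<otimes>\<^bsub>mat_alg GM.D\<^esub> Y) i j) M c"
    "\<forall>l f. \<forall>p\<in>N. real_analytic_at f p \<longrightarrow> near_eq p (twisted_op T l M c f) (\<lambda>y. \<Sum>k\<in>UNIV. twisted_op T l K (a i k) (twisted_op T l L (b k j) f) y)"
    by (rule GM.is_op_matrix_mult[of X K a Y L b i j, OF a b])
  have fa: "\<And>i j. coeff_family N UNIV K (a i j)" and fb: "\<And>i j. coeff_family N UNIV L (b i j)" and fc: "coeff_family N UNIV M c"
    using a b c by (auto simp: GM.is_op_def)
  let ?F = "\<lambda>k. \<sigma> X i k \<otimes>\<^bsub>poly_alg GN.D T\<^esub> \<sigma> Y k j"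
  define Q where "Q k M c \<longleftrightarrow> GN.is_op (?F k \<alpha>) M c \<and> (\<forall>u. GN.regular u \<longrightarrow> (\<forall>y\<in>N. GN.op0 M c u y
      = (\<Sum>\<mu> | \<forall>i. \<mu> i \<le> \<alpha> i. GN.op0 (restr_index (- T) ` K) (slice T \<mu> (a i k))
          (GN.op0 (restr_index (- T) ` L) (slice T (\<lambda>i. \<alpha> i - \<mu> i) (b k j)) u) y)))" for k M c
  have "\<exists>M c. Q k M c" for k
    unfolding Q_def by (intro poly_mult_op sigma_star_is_op a b)
  then obtain M1 c1 where "\<And>k. Q k (M1 k) (c1 k)" by metis
  then have M1: "\<And>k. GN.is_op (?F k \<alpha>) (M1 k) (c1 k)"
    "\<And>k u y. GN.regular u \<Longrightarrow> y \<in> N \<Longrightarrow> GN.op0 (M1 k) (c1 k) u y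
      = (\<Sum>\<mu> | \<forall>i. \<mu> i \<le> \<alpha> i. GN.op0 (restr_index (- T) ` K) (slice T \<mu> (a i k))
          (GN.op0 (restr_index (- T) ` L) (slice T (\<lambda>i. \<alpha> i - \<mu> i) (b k j)) u) y)"
    by (simp_all add: Q_def)
  obtain M2 c2 where M2: "GN.is_op (finsum GN.D (\<lambda>k. ?F k \<alpha>) UNIV) M2 c2"
    "\<And>l u y. twisted_op T l M2 c2 u y = (\<Sum>k\<in>UNIV. twisted_op T l (M1 k) (c1 k) u y)"
    using GN.is_op_finsum[OF finite_class.finite_UNIV, of "\<lambda>k. ?F k \<alpha>" M1 c1, OF M1(1)] by (elim exE conjE) (rule that, assumption, (drule spec)+, assumption)
  have cl: "?F k \<in> carrier (poly_alg GN.D T)" for k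
    by (rule poly_mult_closed[of "\<sigma> X i k" _ _ "\<sigma> Y k j"])
       (rule sigma_star_is_op sigma_star_carrier, rule a b)+
  have R: "(\<sigma> X \<otimes>\<^bsub>mat_alg (poly_alg GN.D T)\<^esub> \<sigma> Y) i j \<alpha> = finsum GN.D (\<lambda>k. ?F k \<alpha>) UNIV"
    using finsum_poly[OF GN.monoid_D, of UNIV ?F T \<alpha>] cl by (simp add: mat_alg_def)
  have L: "GN.is_op (\<sigma> (X \<otimes>\<^bsub>mat_alg GM.D\<^esub> Y) i j \<alpha>) (restr_index (- T) ` M) (slice T \<alpha> c)"
    unfolding sigma_star_def coeffs_M_op[OF c(1)] by (rule is_op_subst_star[OF fc])
  show "\<sigma> (X \<otimes>\<^bsub>mat_alg GM.D\<^esub> Y) i j \<alpha> = (\<sigma> X \<otimes>\<^bsub>mat_alg (poly_alg GN.D T)\<^esub> \<sigma> Y) i j \<alpha>"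
    unfolding R
  proof (rule GN.extensional_eqI[OF GN.is_op_extensional[OF L] GN.is_op_extensional[OF M2(1)]])
    fix f assume f: "GN.regular f"
    have "GN.op0 (restr_index (- T) ` M) (slice T \<alpha> c) f y = GN.op0 M2 c2 f y" if "y \<in> N" for y
      unfolding M2(2) M1(2)[OF f that]
      by (rule slice_compose[of K "\<lambda>k. a i k" L "\<lambda>k. b k j" M c f y, OF fa fb fc c(2)[rule_format] _ that]) (use f in auto)
    then show "\<sigma> (X \<otimes>\<^bsub>mat_alg GM.D\<^esub> Y) i j \<alpha> (restrict f N) = finsum GN.D (\<lambda>k. ?F k \<alpha>) UNIV (restrict f N)"
      unfolding GN.is_op_apply[OF L f] GN.is_op_apply[OF M2(1) f] by (intro restrict_ext)
  qed
qed

lemma GN_is_op_eq: "GN.is_op P K c \<Longrightarrow> GN.is_op Q L c \<Longrightarrow> P = Q"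
  by (simp add: GN.is_op_def)

lemma sigma_star_add:
  fixes X Y :: "'m::finite \<Rightarrow> 'm \<Rightarrow> 'i op_M"
  assumes X: "X \<in> carrier (mat_alg GM.D)" and Y: "Y \<in> carrier (mat_alg GM.D)"
  shows "\<sigma> (X \<oplus>\<^bsub>mat_alg GM.D\<^esub> Y) = \<sigma> X \<oplus>\<^bsub>mat_alg (poly_alg GN.D T)\<^esub> \<sigma> Y"
proof (rule ext, rule ext, rule ext)
  fix i j \<alpha>
  obtain K a where a: "\<And>i j. GM.is_op (X i j) K (a i j)" by (rule GM.matrix_cases[OF X]) blast
  obtain L b where b: "\<And>i j. GM.is_op (Y i j) L (b i j)" by (rule GM.matrix_cases[OF Y]) blast
  have "GM.is_op ((X \<oplus>\<^bsub>mat_alg GM.D\<^esub> Y) i j) (K \<union> L) (\<lambda>\<kappa> y. a i j \<kappa> y + b i j \<kappa> y)" for i j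
    using GM.is_op_add[OF a b] by (simp add: mat_alg_def)
  from sigma_star_is_op[of "X \<oplus>\<^bsub>mat_alg GM.D\<^esub> Y" i j, OF this]
  have 1: "GN.is_op (\<sigma> (X \<oplus>\<^bsub>mat_alg GM.D\<^esub> Y) i j \<alpha>) (restr_index (- T) ` (K \<union> L)) (slice T \<alpha> (\<lambda>\<kappa> y. a i j \<kappa> y + b i j \<kappa> y))" .
  have 2: "GN.is_op (\<sigma> X i j \<alpha> \<oplus>\<^bsub>GN.D\<^esub> \<sigma> Y i j \<alpha>) (restr_index (- T) ` K \<union> restr_index (- T) ` L)
      (\<lambda>\<beta> y. slice T \<alpha> (a i j) \<beta> y + slice T \<alpha> (b i j) \<beta> y)"
    by (intro GN.is_op_add sigma_star_is_op a b)
  have "slice T \<alpha> (\<lambda>\<kappa> y. a i j \<kappa> y + b i j \<kappa> y) = (\<lambda>\<beta> y. slice T \<alpha> (a i j) \<beta> y + slice T \<alpha> (b i j) \<beta> y)"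
    by (auto simp: slice_def)
  with 1 2 show "\<sigma> (X \<oplus>\<^bsub>mat_alg GM.D\<^esub> Y) i j \<alpha> = (\<sigma> X \<oplus>\<^bsub>mat_alg (poly_alg GN.D T)\<^esub> \<sigma> Y) i j \<alpha>"
    by (simp add: mat_alg_def poly_alg_def GN_is_op_eq)
qed

lemma sigma_star_smult:
  fixes X :: "'m::finite \<Rightarrow> 'm \<Rightarrow> 'i op_M"
  assumes X: "X \<in> carrier (mat_alg GM.D)"
  shows "\<sigma> (z \<odot>\<^bsub>mat_alg GM.D\<^esub> X) = z \<odot>\<^bsub>mat_alg (poly_alg GN.D T)\<^esub> \<sigma> X"
proof (rule ext, rule ext, rule ext)
  fix i j \<alpha>
  obtain K a where a: "\<And>i j. GM.is_op (X i j) K (a i j)" by (rule GM.matrix_cases[OF X]) blast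
  have "GM.is_op ((z \<odot>\<^bsub>mat_alg GM.D\<^esub> X) i j) K (\<lambda>\<kappa> y. z * a i j \<kappa> y)" for i j
    using GM.is_op_smult[OF a] by (simp add: mat_alg_def)
  from sigma_star_is_op[of "z \<odot>\<^bsub>mat_alg GM.D\<^esub> X" i j, OF this]
  have 1: "GN.is_op (\<sigma> (z \<odot>\<^bsub>mat_alg GM.D\<^esub> X) i j \<alpha>) (restr_index (- T) ` K) (slice T \<alpha> (\<lambda>\<kappa> y. z * a i j \<kappa> y))" .
  have 2: "GN.is_op (z \<odot>\<^bsub>GN.D\<^esub> \<sigma> X i j \<alpha>) (restr_index (- T) ` K) (\<lambda>\<beta> y. z * slice T \<alpha> (a i j) \<beta> y)"
    by (intro GN.is_op_smult sigma_star_is_op a)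
  have "slice T \<alpha> (\<lambda>\<kappa> y. z * a i j \<kappa> y) = (\<lambda>\<beta> y. z * slice T \<alpha> (a i j) \<beta> y)"
    by (auto simp: slice_def)
  with 1 2 show "\<sigma> (z \<odot>\<^bsub>mat_alg GM.D\<^esub> X) i j \<alpha> = (z \<odot>\<^bsub>mat_alg (poly_alg GN.D T)\<^esub> \<sigma> X) i j \<alpha>"
    by (simp add: mat_alg_def poly_alg_def GN_is_op_eq)
qed

lemma sigma_star_one:
  "\<sigma> \<one>\<^bsub>mat_alg GM.D\<^esub> = (\<one>\<^bsub>mat_alg (poly_alg GN.D T)\<^esub> :: 'm::finite \<Rightarrow> 'm \<Rightarrow> 'i midx \<Rightarrow> 'i op_N)"
proof (rule ext, rule ext, rule ext)
  fix i j :: 'm and \<alpha>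
  let ?e = "\<lambda>\<kappa> (_::real ^ 'i). if \<kappa> = (\<lambda>i. 0) then (1::complex) else 0"
  let ?a = "\<lambda>i j. if i = (j::'m) then ?e else (\<lambda>_ _. 0)"
  have "GM.is_op \<zero>\<^bsub>GM.D\<^esub> {\<lambda>i. 0} (\<lambda>_ _. 0)"
    using GM.is_op_zero by (simp add: GM.is_op_def coeff_family_def supported_def)
  then have "GM.is_op (\<one>\<^bsub>mat_alg GM.D\<^esub> i j) {\<lambda>i. 0} (?a i j)" for i j :: 'm
    using GM.is_op_one by (simp add: mat_alg_def)
  from sigma_star_is_op[of "\<one>\<^bsub>mat_alg GM.D\<^esub>" i j, OF this]
  have 1: "GN.is_op (\<sigma> \<one>\<^bsub>mat_alg GM.D\<^esub> i j \<alpha>) (restr_index (- T) ` {\<lambda>i. 0}) (slice T \<alpha> (?a i j))" .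
  have "slice T \<alpha> (?a i j) = (if i = j \<and> \<alpha> = (\<lambda>i. 0) then ?e else (\<lambda>_ _. 0))"
  proof (cases "i = j")
    case True
    have "supported T \<alpha> \<Longrightarrow> supported (- T) \<beta> \<Longrightarrow> (\<lambda>i. \<alpha> i + \<beta> i) = (\<lambda>i. 0) \<longleftrightarrow> \<alpha> = (\<lambda>i. 0) \<and> \<beta> = (\<lambda>i. 0)" for \<beta>
      by (auto simp: fun_eq_iff)
    then show ?thesis using True by (auto simp: slice_def fun_eq_iff supported_def)
  qed (auto simp: slice_def)
  with 1 GN.is_op_one GN.is_op_zero
  show "\<sigma> \<one>\<^bsub>mat_alg GM.D\<^esub> i j \<alpha> = \<one>\<^bsub>mat_alg (poly_alg GN.D T)\<^esub> i j \<alpha>"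
    by (auto simp: mat_alg_def poly_alg_def GN.is_op_def)
qed

end

lemma mat_mult_single:
  fixes A :: "('k, 'a) module" and X Y :: "'m::finite \<Rightarrow> 'm \<Rightarrow> 'a"
  assumes A: "abelian_monoid A" and m: "UNIV = {k::'m}" and c: "X i k \<otimes>\<^bsub>A\<^esub> Y k j \<in> carrier A"
  shows "(X \<otimes>\<^bsub>mat_alg A\<^esub> Y) i j = X i k \<otimes>\<^bsub>A\<^esub> Y k j"
proof -
  interpret A: abelian_monoid A by (rule A)
  have "finsum A (\<lambda>k. X i k \<otimes>\<^bsub>A\<^esub> Y k j) {k} = X i k \<otimes>\<^bsub>A\<^esub> Y k j"
    using c by (subst A.finsum_insert) auto
  then show ?thesis by (simp add: mat_alg_def m)
qed

context crossing
begin

section \<open>Injectivity of the symbol map\<close>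

lemma GM_twisted_op_eq:
  assumes a: "GM.is_op P K a" and b: "GM.is_op P L b" and p: "p \<in> N"
  shows "near_eq p (twisted_op T l K a f) (twisted_op T l L b f)"
proof -
  have "near_eq p (a \<kappa>) (b \<kappa>)" for \<kappa>
    using GM.is_op_unique[OF a b, of \<kappa>] p by (simp add: germ_eq_iff)
  then have "near_eq p (twisted_op T l (K \<union> L) a f) (twisted_op T l (K \<union> L) b f)"
    unfolding twisted_op_def by (intro near_eq_sum near_eq_mult near_eq_refl)
  moreover have "twisted_op T l K a f = twisted_op T l (K \<union> L) a f" "twisted_op T l L b f = twisted_op T l (K \<union> L) b f"
    using a b by (auto simp: GM.is_op_def coeff_family_def intro!: twisted_op_superset)
  ultimately show ?thesis by simp
qed

lemma commute_symbols:
  fixes P X :: "'m::finite \<Rightarrow> 'm \<Rightarrow> 'i op_M"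
  assumes P: "\<And>i j. GM.is_op (P i j) K (a i j)" and X: "\<And>i j. GM.is_op (X i j) L (b i j)"
    and comm: "P \<otimes>\<^bsub>mat_alg GM.D\<^esub> X = X \<otimes>\<^bsub>mat_alg GM.D\<^esub> P" and p: "p \<in> N"
  shows "near_eq p (\<lambda>y. \<Sum>k\<in>UNIV. twisted_op T l K (a i k) (symbol L (b k j) l) y)
    (\<lambda>y. \<Sum>k\<in>UNIV. twisted_op T l L (b i k) (symbol K (a k j) l) y)"
proof -
  obtain M c where c: "GM.is_op ((P \<otimes>\<^bsub>mat_alg GM.D\<^esub> X) i j) M c"
    "\<forall>l f. \<forall>p\<in>N. real_analytic_at f p \<longrightarrow> near_eq p (twisted_op T l M c f) (\<lambda>y. \<Sum>k\<in>UNIV. twisted_op T l K (a i k) (twisted_op T l L (b k j) f) y)"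
    by (rule GM.is_op_matrix_mult[of P K a X L b i j, OF P X])
  obtain M' c' where c': "GM.is_op ((X \<otimes>\<^bsub>mat_alg GM.D\<^esub> P) i j) M' c'"
    "\<forall>l f. \<forall>p\<in>N. real_analytic_at f p \<longrightarrow> near_eq p (twisted_op T l M' c' f) (\<lambda>y. \<Sum>k\<in>UNIV. twisted_op T l L (b i k) (twisted_op T l K (a k j) f) y)"
    by (rule GM.is_op_matrix_mult[of X L b P K a i j, OF X P])
  have 1: "near_eq p (twisted_op T l M c (\<lambda>_. 1)) (twisted_op T l M' c' (\<lambda>_. 1))"
    by (rule GM_twisted_op_eq[OF c(1) _ p]) (use c'(1) comm in simp)
  have 2: "near_eq p (twisted_op T l M c (\<lambda>_. 1)) (\<lambda>y. \<Sum>k\<in>UNIV. twisted_op T l K (a i k) (symbol L (b k j) l) y)"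
    using c(2) p unfolding twisted_op_one [where T = T, symmetric] by simp
  have 3: "near_eq p (twisted_op T l M' c' (\<lambda>_. 1)) (\<lambda>y. \<Sum>k\<in>UNIV. twisted_op T l L (b i k) (symbol K (a k j) l) y)"
    using c'(2) p unfolding twisted_op_one [where T = T, symmetric] by simp
  show ?thesis by (rule near_eq_trans[OF near_eq_sym[OF 2] near_eq_trans[OF 1 3]])
qed

lemma twisted_op_minus:
  assumes "coeff_family N UNIV K a" "coeff_family N UNIV L b"
  shows "twisted_op T l (K \<union> L) (\<lambda>\<kappa> y. a \<kappa> y + (- 1) * b \<kappa> y) f = (\<lambda>y. twisted_op T l K a f y - twisted_op T l L b f y)"
  using twisted_op_add[OF assms(1) coeff_family_cmult[OF assms(2), of "- 1"], of T l f]
  by (simp add: twisted_op_def sum_negf)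

text \<open>
  If \<open>\<sigma>\<^sub>*(X) = \<sigma>\<^sub>*(Y)\<close>, then the coefficients of \<open>X - Y\<close> vanish on \<open>N\<close>, so that \<open>commuting_zero\<close>
  applies to them.
\<close>

lemma sigma_star_inj:
  fixes P X Y :: "'m::finite \<Rightarrow> 'm \<Rightarrow> 'i op_M"
  assumes N: "connected N"
    and P: "\<And>i j. GM.is_op (P i j) K (a i j)"
    and star: "\<And>i j \<kappa> y. y \<in> N \<Longrightarrow> \<not> supported T \<kappa> \<Longrightarrow> a i j \<kappa> y = 0"
    and order: "\<And>i j \<kappa> y. y \<in> N \<Longrightarrow> deg \<kappa> > n \<Longrightarrow> a i j \<kappa> y = 0"
    and scalar: "\<And>i j \<kappa> y. y \<in> N \<Longrightarrow> Suc (deg \<kappa>) \<ge> n \<Longrightarrow> a i j \<kappa> y = (if i = j then b \<kappa> y else 0)"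
    and nondeg: "\<And>\<gamma>. supported T \<gamma> \<Longrightarrow> \<gamma> \<noteq> (\<lambda>i. 0) \<Longrightarrow>
      \<exists>x\<in>N. \<exists>\<xi>. (\<Sum>\<alpha> | \<alpha> \<in> K \<and> deg \<alpha> = n. b \<alpha> x * dir_deriv \<gamma> \<alpha> \<xi>) \<noteq> 0"
    and X: "X \<in> carrier (mat_alg GM.D)" "P \<otimes>\<^bsub>mat_alg GM.D\<^esub> X = X \<otimes>\<^bsub>mat_alg GM.D\<^esub> P"
    and Y: "Y \<in> carrier (mat_alg GM.D)" "P \<otimes>\<^bsub>mat_alg GM.D\<^esub> Y = Y \<otimes>\<^bsub>mat_alg GM.D\<^esub> P"
    and eq: "\<sigma> X = \<sigma> Y"
  shows "X = Y"
proof -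
  obtain L1 c where c: "\<And>i j. GM.is_op (X i j) L1 (c i j)" by (rule GM.matrix_cases[OF X(1)]) blast
  obtain L2 e where e: "\<And>i j. GM.is_op (Y i j) L2 (e i j)" by (rule GM.matrix_cases[OF Y(1)]) blast
  have fa: "\<And>i j. coeff_family N UNIV K (a i j)" and fc: "\<And>i j. coeff_family N UNIV L1 (c i j)" and fe: "\<And>i j. coeff_family N UNIV L2 (e i j)"
    using P c e by (auto simp: GM.is_op_def)
  define d where "d i j = (\<lambda>\<kappa> y. c i j \<kappa> y + (- 1) * e i j \<kappa> y)" for i j
  have fd: "coeff_family N UNIV (L1 \<union> L2) (d i j)" for i j
    unfolding d_def by (intro coeff_family_add coeff_family_cmult fc fe)
  have dop_d: "twisted_op T l (L1 \<union> L2) (d i j) f = (\<lambda>y. twisted_op T l L1 (c i j) f y - twisted_op T l L2 (e i j) f y)" for l i j f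
    unfolding d_def by (rule twisted_op_minus[OF fc fe])
  have symb_d: "symbol (L1 \<union> L2) (d i j) l = (\<lambda>y. symbol L1 (c i j) l y - symbol L2 (e i j) l y)" for l i j
    using dop_d[of l i j "\<lambda>_. 1"] by (simp only: twisted_op_one)
  have comm: "near_eq p (\<lambda>y. \<Sum>k\<in>UNIV. twisted_op T l K (a i k) (symbol (L1 \<union> L2) (d k j) l) y)
        (\<lambda>y. \<Sum>k\<in>UNIV. twisted_op T l (L1 \<union> L2) (d i k) (symbol K (a k j) l) y)" if p: "p \<in> N" for l i j p
  proof -
    have "near_eq p (\<lambda>y. \<Sum>k\<in>UNIV. twisted_op T l K (a i k) (symbol (L1 \<union> L2) (d k j) l) y)
        (\<lambda>y. \<Sum>k\<in>UNIV. twisted_op T l K (a i k) (symbol L1 (c k j) l) y - twisted_op T l K (a i k) (symbol L2 (e k j) l) y)"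
      unfolding symb_d using p fc fe by (intro near_eq_sum twisted_op_diff analytic_symbol) (auto simp: coeff_family_def)
    also have "near_eq p (\<lambda>y. \<Sum>k\<in>UNIV. twisted_op T l K (a i k) (symbol L1 (c k j) l) y - twisted_op T l K (a i k) (symbol L2 (e k j) l) y)
        (\<lambda>y. \<Sum>k\<in>UNIV. twisted_op T l L1 (c i k) (symbol K (a k j) l) y - twisted_op T l L2 (e i k) (symbol K (a k j) l) y)"
      using commute_symbols[OF P c X(2) p, of l i j] commute_symbols[OF P e Y(2) p, of l i j]
      unfolding sum_subtractf near_eq_def by (rule eventually_elim2) simp
    finally show ?thesis unfolding dop_d .
  qed
  have d0: "d i j \<kappa> y = 0" if y: "y \<in> N" for i j \<kappa> y
  proof -
    have 1: "GN.is_op (\<sigma> X i j (restr_index T \<kappa>)) (restr_index (- T) ` L1) (slice T (restr_index T \<kappa>) (c i j))"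
      by (intro sigma_star_is_op c)
    have 2: "GN.is_op (\<sigma> X i j (restr_index T \<kappa>)) (restr_index (- T) ` L2) (slice T (restr_index T \<kappa>) (e i j))"
      unfolding eq by (intro sigma_star_is_op e)
    have "restrict (c i j \<kappa>) N = restrict (e i j \<kappa>) N"
      using GN.is_op_unique[OF 1 2, of "restr_index (- T) \<kappa>"] by (simp add: slice_parts)
    from fun_cong[OF this, of y] show ?thesis using y by (simp add: d_def)
  qed
  have zero: "near_eq p (d i j \<kappa>) (\<lambda>_. 0)" if "p \<in> N" for i j \<kappa> p
    by (rule commuting_zero[OF N fa fd comm star order scalar nondeg d0 that])
  have "germ N (c i j \<kappa>) = germ N (e i j \<kappa>)" for i j \<kappa>
    unfolding germ_eq_iff
  proof
    fix p assume "p \<in> N"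
    from zero[OF this, of i j \<kappa>] show "near_eq p (c i j \<kappa>) (e i j \<kappa>)"
      unfolding near_eq_def by (rule eventually_mono) (simp add: d_def)
  qed
  then have "X i j = Y i j" for i j using c[of i j] e[of i j] by (simp add: GM.is_op_def)
  then show ?thesis by blast
qed

section \<open>Operators whose restriction is free of derivatives\<close>

lemma D_star_iff:
  assumes "GM.is_op P K a"
  shows "P \<in> carrier (D_star N T) \<longleftrightarrow> (\<forall>\<kappa>. \<not> supported T \<kappa> \<longrightarrow> (\<forall>y\<in>N. a \<kappa> y = 0))"
proof -
  have "P \<in> carrier GM.D" using assms GM.carrier_D by blast
  moreover have "restrict f N = \<zero>\<^bsub>A_N N\<^esub> \<longleftrightarrow> (\<forall>y\<in>N. f y = 0)" for f
    by (auto simp: A_N_def fun_eq_iff restrict_def)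
  ultimately show ?thesis by (simp add: D_star_def D_tilde_eq coeffs_M_op[OF assms] at_N_germ)
qed

lemma D_star_sub: "P \<in> carrier (D_star N T) \<Longrightarrow> P \<in> carrier GM.D"
  by (simp add: D_star_def D_tilde_eq)

text \<open>
  On \<open>N\<close> only powers of the \<open>t\<close>-derivations contribute, and these act as scalars.
\<close>

lemma star_twisted_op:
  assumes star: "\<And>\<kappa>. \<not> supported T \<kappa> \<Longrightarrow> a \<kappa> y = 0"
    and f: "\<And>p. p \<in> N \<Longrightarrow> real_analytic_at f p" and y: "y \<in> N"
  shows "twisted_op T l K a f y = symbol K a l y * f y"
proof -
  have "a \<kappa> y * iter_der (twisted_der T l) \<kappa> f y = a \<kappa> y * mpow \<kappa> l * f y" for \<kappa>
  proof (cases "supported T \<kappa>")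
    case True
    then have 0: "(\<lambda>i. if i \<in> T then 0 else \<kappa> i) = (\<lambda>i. 0)" by (auto simp: supported_def)
    have "mpow \<kappa> l = (\<Prod>i\<in>T. l i ^ \<kappa> i)"
      unfolding mpow_def using True by (intro prod.mono_neutral_right) (auto simp: supported_def)
    then show ?thesis using iter_N_split[OF f y, of l \<kappa>] by (simp add: 0)
  qed (simp add: star)
  then show ?thesis unfolding twisted_op_def symbol_def sum_distrib_right by (intro sum.cong refl)
qed

lemma symbol_unique:
  assumes c: "coeff_family N UNIV K c" and d: "coeff_family N UNIV L d" and eq: "\<And>l. symbol K c l y = symbol L d l y"
  shows "c \<kappa> y = d \<kappa> y"
proof (cases "\<kappa> \<in> K \<union> L")
  case True
  have s: "symbol K c l y = symbol (K \<union> L) c l y" "symbol L d l y = symbol (K \<union> L) d l y" for l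
    using c d unfolding symbol_def coeff_family_def by (auto intro!: sum.mono_neutral_left)
  have "c \<kappa> y - d \<kappa> y = 0"
  proof (rule poly_coeffs_zero[OF _ _ True])
    show "(\<Sum>\<kappa>\<in>K \<union> L. (c \<kappa> y - d \<kappa> y) * mpow \<kappa> (\<lambda>i. of_nat (n i))) = 0" for n
      using eq[of "\<lambda>i. of_nat (n i)"] unfolding s by (simp add: symbol_def left_diff_distrib sum_subtractf)
  qed (use c d in \<open>simp add: coeff_family_def\<close>)
  then show ?thesis by simp
qed (use c d in \<open>simp add: coeff_family_def\<close>)

text \<open>
  On \<open>N\<close> the full symbols of elements of \<open>\<D>\<^sub>*\<close> multiply as functions. In particular the symbol of the
  product depends only on the \<open>t\<close>-part of \<open>l\<close>, which puts the product into \<open>\<D>\<^sub>*\<close>.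
\<close>

lemma star_mult:
  assumes P: "GM.is_op P K a" "P \<in> carrier (D_star N T)" and Q: "GM.is_op Q L b" "Q \<in> carrier (D_star N T)"
  obtains M c where "GM.is_op (P \<otimes>\<^bsub>GM.D\<^esub> Q) M c" "P \<otimes>\<^bsub>GM.D\<^esub> Q \<in> carrier (D_star N T)"
    "\<forall>l. \<forall>y\<in>N. symbol M c l y = symbol K a l y * symbol L b l y"
proof -
  obtain M c where c: "GM.is_op (P \<otimes>\<^bsub>GM.D\<^esub> Q) M c" and
    comp: "\<And>l f p. p \<in> N \<Longrightarrow> real_analytic_at f p \<Longrightarrow> near_eq p (twisted_op T l M c f) (twisted_op T l K a (twisted_op T l L b f))"
    using GM.is_op_mult[OF P(1) Q(1)] by blast
  have sa: "a \<kappa> y = 0" and sb: "b \<kappa> y = 0" if "\<not> supported T \<kappa>" "y \<in> N" for \<kappa> y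
    using P Q that D_star_iff by blast+
  have fa: "coeff_family N UNIV K a" and fb: "coeff_family N UNIV L b" and fc: "coeff_family N UNIV M c"
    using P Q c by (auto simp: GM.is_op_def)
  have prod: "symbol M c l y = symbol K a l y * symbol L b l y" if y: "y \<in> N" for l y
  proof -
    have "symbol M c l y = twisted_op T l K a (symbol L b l) y"
      using near_eq_at[OF comp[OF y, of "\<lambda>_. 1" l]] by (simp add: twisted_op_one)
    also have "\<dots> = symbol K a l y * symbol L b l y"
      by (rule star_twisted_op[OF sa _ y]) (use y fb in \<open>auto simp: coeff_family_def intro!: analytic_symbol\<close>)
    finally show ?thesis .
  qed
  have "c \<kappa> y = 0" if \<kappa>: "\<not> supported T \<kappa>" and y: "y \<in> N" for \<kappa> y
  proof -
    let ?c = "\<lambda>\<kappa>. if supported T \<kappa> then c \<kappa> else (\<lambda>_. 0)" and ?l = "\<lambda>l i. if i \<in> T then l i else (0::complex)"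
    have ml: "mpow \<kappa> (?l l) = (if supported T \<kappa> then mpow \<kappa> l else 0)" for \<kappa> l
    proof (cases "supported T \<kappa>")
      case True
      then show ?thesis using mpow_cong[OF True, of "?l l" l] by simp
    next
      case False
      then obtain i where "i \<notin> T" "\<kappa> i \<noteq> 0" by (auto simp: supported_def)
      then have "(\<Prod>i\<in>UNIV. ?l l i ^ \<kappa> i) = 0" by (intro prod_zero bexI[of _ i]) auto
      then show ?thesis using False by (simp add: mpow_def)
    qed
    have loc: "symbol K' d (?l l) y = symbol K' d l y" if "\<And>\<kappa>. \<not> supported T \<kappa> \<Longrightarrow> d \<kappa> y = 0" for K' d l
      unfolding symbol_def by (intro sum.cong refl) (use that in \<open>auto simp: ml\<close>)
    have "symbol M c l y = symbol M ?c l y" for l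
    proof -
      have "symbol M c l y = symbol M c (?l l) y"
        using prod[OF y] loc[of a K l] loc[of b L l] sa sb y by simp
      also have "\<dots> = symbol M ?c l y"
        unfolding symbol_def by (intro sum.cong refl) (simp add: ml)
      finally show ?thesis .
    qed
    moreover have "coeff_family N UNIV M ?c" using fc by (auto simp: coeff_family_def)
    ultimately have "c \<kappa> y = ?c \<kappa> y" by (intro symbol_unique[OF fc])
    then show ?thesis using \<kappa> by simp
  qed
  then have "P \<otimes>\<^bsub>GM.D\<^esub> Q \<in> carrier (D_star N T)" using D_star_iff[OF c] by blast
  with c prod show ?thesis using that by blast
qed

lemma monoid_D_star: "abelian_monoid (D_star N T)"
proof (rule abelian_monoidI)
  fix P Q assume *: "P \<in> carrier (D_star N T)" "Q \<in> carrier (D_star N T)"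
  then obtain K a L b where a: "GM.is_op P K a" and b: "GM.is_op Q L b"
    using D_star_sub GM.carrier_D by metis
  have "P \<oplus>\<^bsub>GM.D\<^esub> Q \<in> carrier (D_star N T)"
    using * unfolding D_star_iff[OF a] D_star_iff[OF b] D_star_iff[OF GM.is_op_add[OF a b]] by simp
  then show "P \<oplus>\<^bsub>D_star N T\<^esub> Q \<in> carrier (D_star N T)" by (simp add: D_star_def D_tilde_eq)
next
  have "\<zero>\<^bsub>GM.D\<^esub> \<in> carrier (D_star N T)" unfolding D_star_iff[OF GM.is_op_zero] by simp
  then show "\<zero>\<^bsub>D_star N T\<^esub> \<in> carrier (D_star N T)" by (simp add: D_star_def D_tilde_eq)
qed (auto simp: D_star_def D_tilde_eq GM.D.a_ac)

lemma sigma_star_cong: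
  assumes a: "GM.is_op (X i j) K a" and b: "GM.is_op (Y i j) L b" and eq: "\<And>\<kappa> y. y \<in> N \<Longrightarrow> a \<kappa> y = b \<kappa> y"
  shows "\<sigma> X i j = \<sigma> Y i j"
proof (rule ext)
  fix \<alpha>
  have "restrict (slice T \<alpha> a \<beta>) N = restrict (slice T \<alpha> b \<beta>) N" for \<beta>
    using eq by (auto simp: slice_def intro!: restrict_ext)
  then show "\<sigma> X i j \<alpha> = \<sigma> Y i j \<alpha>"
    unfolding sigma_star_op[of X i j, OF a] sigma_star_op[of Y i j, OF b] subst_star_germ by simp
qed

section \<open>The restricted principal symbol as a polynomial function\<close>

text \<open>
  Applying the coefficient of \<open>\<xi>\<^sup>\<alpha>\<close> to the constant function 1 leaves its term of order 0 in
  \<open>\<partial>\<^sub>x\<close>.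
\<close>

lemma xi_value_subst_star:
  assumes a: "coeff_family N UNIV K a" and star: "\<And>\<kappa>. \<not> supported T \<kappa> \<Longrightarrow> a \<kappa> x = 0" and x: "x \<in> N"
  shows "xi_value N T (subst_star N T (\<lambda>\<kappa>. germ N (a \<kappa>))) x \<xi> = symbol K a \<xi> x"
proof -
  let ?f = "subst_star N T (\<lambda>\<kappa>. germ N (a \<kappa>))"
  let ?g = "\<lambda>\<alpha>. a \<alpha> x * mpow \<alpha> \<xi>"
  have K: "finite K" using a by (simp add: coeff_family_def)
  have val: "?f \<alpha> \<one>\<^bsub>A_N N\<^esub> x * (\<Prod>i\<in>T. \<xi> i ^ \<alpha> i) = ?g \<alpha>" if s: "supported T \<alpha>" for \<alpha>
  proof -
    have fs: "coeff_family N (- T) (restr_index (- T) ` K) (slice T \<alpha> a)" by (rule coeff_family_slice[OF a])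
    have "?f \<alpha> \<one>\<^bsub>A_N N\<^esub> x = symbol (restr_index (- T) ` K) (slice T \<alpha> a) (\<lambda>_. 0) x"
      unfolding GN.q_one using GN.is_op_apply[OF is_op_subst_star[OF a, of \<alpha>], of "\<lambda>_. 1"] x by (simp add: twisted_op_one)
    also have "\<dots> = (\<Sum>\<beta>\<in>restr_index (- T) ` K. if \<beta> = (\<lambda>i. 0) then slice T \<alpha> a (\<lambda>i. 0) x else 0)"
      unfolding symbol_def by (intro sum.cong) (auto simp: mpow_zero_arg)
    also have "\<dots> = slice T \<alpha> a (\<lambda>i. 0) x"
      using K fs by (auto simp: coeff_family_def)
    also have "\<dots> = a \<alpha> x" using s by (simp add: slice_def supported_def)
    finally have "?f \<alpha> \<one>\<^bsub>A_N N\<^esub> x = a \<alpha> x" .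
    moreover have "(\<Prod>i\<in>T. \<xi> i ^ \<alpha> i) = mpow \<alpha> \<xi>"
      unfolding mpow_def using s by (intro prod.mono_neutral_left) (auto simp: supported_def)
    ultimately show ?thesis by simp
  qed
  let ?S = "{\<alpha>. ?f \<alpha> \<noteq> \<zero>\<^bsub>GN.D\<^esub>}"
  have S: "finite ?S" "\<And>\<alpha>. \<alpha> \<in> ?S \<Longrightarrow> supported T \<alpha>"
    using subst_star_carrier[OF a] by (auto simp: poly_alg_def families_def)
  have zero: "?g \<alpha> = 0" if "\<alpha> \<notin> ?S" for \<alpha>
  proof (cases "supported T \<alpha>")
    case True
    have "?f \<alpha> = \<zero>\<^bsub>GN.D\<^esub>" using that by simp
    then have "?f \<alpha> \<one>\<^bsub>A_N N\<^esub> x = 0" using x GN.q_closed[of "\<lambda>_. 1"] by (simp add: diff_alg_def GN.q_one GN.q_zero)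
    then show ?thesis using val[OF True] by simp
  qed (simp add: star)
  have "xi_value N T ?f x \<xi> = (\<Sum>\<alpha>\<in>?S. ?g \<alpha>)"
    unfolding xi_value_def D_N_eq by (rule sum.cong) (use S val in auto)
  also have "\<dots> = (\<Sum>\<alpha>\<in>?S \<union> K. ?g \<alpha>)"
    by (rule sum.mono_neutral_left) (use S K zero in auto)
  also have "\<dots> = (\<Sum>\<alpha>\<in>K. ?g \<alpha>)"
    by (rule sum.mono_neutral_right) (use S K a in \<open>auto simp: coeff_family_def\<close>)
  finally show ?thesis by (simp add: symbol_def)
qed

lemma xi_deriv_subst_star:
  assumes a: "coeff_family N UNIV K a" and star: "\<And>\<kappa>. \<not> supported T \<kappa> \<Longrightarrow> a \<kappa> x = 0" and x: "x \<in> N"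
  shows "xi_deriv N T \<nu> (subst_star N T (\<lambda>\<kappa>. germ N (a \<kappa>))) x \<xi>
    = (\<Sum>\<kappa>\<in>K. a \<kappa> x * (of_nat (\<kappa> \<nu>) * mpow (\<kappa>(\<nu> := \<kappa> \<nu> - 1)) \<xi>))"
proof -
  have v: "xi_value N T (subst_star N T (\<lambda>\<kappa>. germ N (a \<kappa>))) x \<zeta> = symbol K a \<zeta> x" for \<zeta>
    by (rule xi_value_subst_star[OF a _ x]) (rule star)
  show ?thesis
    unfolding xi_deriv_def v symbol_def mpow_fun_upd_arg mpow_fun_upd_exponent
    by (rule DERIV_imp_deriv) (auto intro!: derivative_eq_intros sum.cong simp: mult_ac)
qed

lemma gradient_subst_star:
  assumes a: "coeff_family N UNIV K a" and star: "\<And>\<kappa>. \<not> supported T \<kappa> \<Longrightarrow> a \<kappa> x = 0" and x: "x \<in> N" and \<gamma>: "supported T \<gamma>"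
  shows "(\<Sum>\<nu>\<in>T. of_nat (\<gamma> \<nu>) * xi_deriv N T \<nu> (subst_star N T (\<lambda>\<kappa>. germ N (a \<kappa>))) x \<xi>) = (\<Sum>\<kappa>\<in>K. a \<kappa> x * dir_deriv \<gamma> \<kappa> \<xi>)"
proof -
  have "(\<Sum>\<nu>\<in>T. of_nat (\<gamma> \<nu>) * xi_deriv N T \<nu> (subst_star N T (\<lambda>\<kappa>. germ N (a \<kappa>))) x \<xi>)
      = (\<Sum>\<nu>\<in>UNIV. of_nat (\<gamma> \<nu>) * (\<Sum>\<kappa>\<in>K. a \<kappa> x * (of_nat (\<kappa> \<nu>) * mpow (\<kappa>(\<nu> := \<kappa> \<nu> - 1)) \<xi>)))"
  proof (rule sum.mono_neutral_cong_left)
    fix \<nu>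
    show "of_nat (\<gamma> \<nu>) * xi_deriv N T \<nu> (subst_star N T (\<lambda>\<kappa>. germ N (a \<kappa>))) x \<xi>
        = of_nat (\<gamma> \<nu>) * (\<Sum>\<kappa>\<in>K. a \<kappa> x * (of_nat (\<kappa> \<nu>) * mpow (\<kappa>(\<nu> := \<kappa> \<nu> - 1)) \<xi>))"
      by (rule arg_cong[OF xi_deriv_subst_star[OF a _ x]]) (rule star)
  qed (use \<gamma> in \<open>auto simp: supported_def\<close>)
  also have "\<dots> = (\<Sum>\<kappa>\<in>K. a \<kappa> x * dir_deriv \<gamma> \<kappa> \<xi>)"
    unfolding dir_deriv_def sum_distrib_left by (subst sum.swap) (simp add: mult_ac)
  finally show ?thesis .
qed

end

section \<open>Centralizers\<close>

theorem corollary2p3: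
  fixes M N :: "(real ^ 'i::finite) set" and T :: "'i set"
    and P :: "'m::finite \<Rightarrow> 'm \<Rightarrow> 'i op_M"
  assumes "open M" and "connected M"
    and "N = {y \<in> M. \<forall>i\<in>T. y $ i = 0}" and "connected N"
    and "P \<in> carrier (mat_alg (D_star N T))"
    and "scalar_matrix \<zero>\<^bsub>poly_alg (A_M N) UNIV\<^esub> (principal_symbol N T P)"
    and "scalar_matrix \<zero>\<^bsub>poly_alg (A_M N) UNIV\<^esub> (sigma_k N T (int (ord_mat N T P) - 1) P)"
    and "\<forall>\<gamma>. supported T \<gamma> \<and> \<gamma> \<noteq> (\<lambda>i. 0) \<longrightarrow>
      (\<exists>i j. \<exists>x\<in>N. \<exists>\<xi>. (\<Sum>\<nu>\<in>T. of_nat (\<gamma> \<nu>) * xi_deriv N T \<nu> (sigma_bar N T P i j) x \<xi>) \<noteq> 0)"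
  shows "sigma_star N T \<in> alg_hom (centralizer (mat_alg (D_tilde N T)) P) (mat_alg (D_N_xi N T))
    \<and> inj_on (sigma_star N T) (carrier (centralizer (mat_alg (D_tilde N T)) P))
    \<and> (CARD('m) = 1 \<longrightarrow>
        (\<forall>Q \<in> carrier (centralizer (mat_alg (D_star N T)) P).
         \<forall>Q' \<in> carrier (centralizer (mat_alg (D_star N T)) P).
           Q \<otimes>\<^bsub>mat_alg (D_star N T)\<^esub> Q' = Q' \<otimes>\<^bsub>mat_alg (D_star N T)\<^esub> Q))"
proof -
  interpret crossing N T
  proof
    fix y assume y: "y \<in> N"
    then have "\<forall>\<^sub>F z in nhds y. z \<in> M" using assms(1,3) by (intro eventually_nhds_in_open) auto
    then show "\<forall>\<^sub>F z in nhds y. (\<forall>i\<in>T. z $ i = 0) \<longrightarrow> z \<in> N"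
      by (rule eventually_mono) (use assms(3) in auto)
  qed (use assms(3) in auto)
  let ?n = "ord_mat N T P"
  have Pstar: "P i j \<in> carrier (D_star N T)" for i j using assms(5) by (simp add: mat_alg_def)
  then have PD: "P \<in> carrier (mat_alg GM.D)" by (auto simp: mat_alg_def intro: D_star_sub)
  obtain K a where a: "\<And>i j. GM.is_op (P i j) K (a i j)" by (rule GM.matrix_cases[OF PD]) blast
  have fa: "coeff_family N UNIV K (a i j)" for i j using a by (simp add: GM.is_op_def)
  have coef: "coeffs_M N T (P i j) = (\<lambda>\<kappa>. germ N (a i j \<kappa>))" for i j by (rule coeffs_M_op[OF a])
  have star: "a i j \<kappa> y = 0" if "y \<in> N" "\<not> supported T \<kappa>" for i j \<kappa> y
    using Pstar[of i j] D_star_iff[OF a] that by blast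
  have zero: "\<zero>\<^bsub>poly_alg (A_M N) UNIV\<^esub> = (\<lambda>\<kappa>::'i midx. germ N (\<lambda>_. 0))"
    by (simp add: poly_alg_def GM.q_zero)
  have on_N: "f y = g y" if "germ N f = germ N g" "y \<in> N" for f g y
    using that by (auto simp: germ_eq_iff intro: near_eq_at)
  have order: "a i j \<kappa> y = 0" if y: "y \<in> N" and \<kappa>: "deg \<kappa> > ?n" for i j \<kappa> y
  proof (rule ccontr)
    assume nz: "a i j \<kappa> y \<noteq> 0"
    let ?S = "{k. \<exists>i j. sigma_k N T (int k) P i j \<noteq> \<zero>\<^bsub>poly_alg (A_M N) UNIV\<^esub>}"
    have "?S \<subseteq> deg ` K"
    proof
      fix k assume "k \<in> ?S"
      then obtain i j where "sigma_k N T (int k) P i j \<noteq> (\<lambda>\<kappa>. germ N (\<lambda>_. 0))" unfolding zero by blast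
      then obtain \<mu> where \<mu>: "sigma_k N T (int k) P i j \<mu> \<noteq> germ N (\<lambda>_. 0)" by (meson ext)
      then have "deg \<mu> = k" "germ N (a i j \<mu>) \<noteq> germ N (\<lambda>_. 0)"
        by (auto simp: sigma_k_def coef GM.q_zero split: if_splits)
      moreover from this have "\<mu> \<in> K" using fa[of i j] by (auto simp: coeff_family_def)
      ultimately show "k \<in> deg ` K" by auto
    qed
    then have fin: "finite ?S" by (rule finite_subset) (use fa in \<open>simp add: coeff_family_def\<close>)
    have "sigma_k N T (int (deg \<kappa>)) P i j \<kappa> \<noteq> germ N (\<lambda>_. 0)"
      using on_N[of "a i j \<kappa>" "\<lambda>_. 0" y] nz y by (auto simp: sigma_k_def coef)
    then have "sigma_k N T (int (deg \<kappa>)) P i j \<noteq> (\<lambda>\<kappa>. germ N (\<lambda>_. 0))" by metis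
    then have "deg \<kappa> \<in> ?S" unfolding zero by blast
    then have "deg \<kappa> \<le> Sup ?S" using fin by (intro cSup_upper bdd_above_finite)
    then show False using \<kappa> by (simp add: ord_mat_def)
  qed
  \<comment> \<open>an arbitrary index; the diagonal entry at \<open>r\<close> provides the scalar\<close>
  define r :: 'm where "r = undefined"
  have scal: "a i j \<kappa> y = (if i = j then a r r \<kappa> y else 0)"
    if s: "scalar_matrix \<zero>\<^bsub>poly_alg (A_M N) UNIV\<^esub> (sigma_k N T k P)" and k: "int (deg \<kappa>) = k" and y: "y \<in> N" for i j \<kappa> y k
  proof -
    obtain s where s: "\<And>i j. sigma_k N T k P i j = (if i = j then s else (\<lambda>\<kappa>. germ N (\<lambda>_. 0)))"
      using s unfolding scalar_matrix_def zero by blast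
    have g: "germ N (a i j \<kappa>) = (if i = j then s \<kappa> else germ N (\<lambda>_. 0))" for i j
      using fun_cong[OF s[of i j], of \<kappa>] k by (simp add: sigma_k_def coef split: if_splits)
    show ?thesis
    proof (cases "i = j")
      case True
      then show ?thesis using on_N[OF _ y, of "a i j \<kappa>" "a r r \<kappa>"] g[of i j] g[of r r] by simp
    next
      case False
      then show ?thesis using on_N[OF _ y, of "a i j \<kappa>" "\<lambda>_. 0"] g[of i j] by simp
    qed
  qed
  have scalar: "a i j \<kappa> y = (if i = j then a r r \<kappa> y else 0)" if y: "y \<in> N" and \<kappa>: "Suc (deg \<kappa>) \<ge> ?n" for i j \<kappa> y
  proof -
    consider "deg \<kappa> > ?n" | "int (deg \<kappa>) = int ?n" | "int (deg \<kappa>) = int ?n - 1" using \<kappa> by linarith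
    then show ?thesis
    proof cases
      case 1
      then show ?thesis using order[OF y] by simp
    next
      case 2
      then show ?thesis using scal assms(6) y unfolding principal_symbol_def by blast
    next
      case 3
      then show ?thesis using scal assms(7) y by blast
    qed
  qed
  have nondeg: "\<exists>x\<in>N. \<exists>\<xi>. (\<Sum>\<alpha> | \<alpha> \<in> K \<and> deg \<alpha> = ?n. a r r \<alpha> x * dir_deriv \<gamma> \<alpha> \<xi>) \<noteq> 0"
    if \<gamma>: "supported T \<gamma>" "\<gamma> \<noteq> (\<lambda>i. 0)" for \<gamma>
  proof -
    \<comment> \<open>off the diagonal the principal symbol vanishes on \<open>N\<close>, so \<open>i = j\<close> and the entry equals the one at \<open>r\<close>\<close>
    obtain i j x \<xi> where x: "x \<in> N" and nz: "(\<Sum>\<nu>\<in>T. of_nat (\<gamma> \<nu>) * xi_deriv N T \<nu> (sigma_bar N T P i j) x \<xi>) \<noteq> 0"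
      using assms(8) \<gamma> by blast
    let ?p = "\<lambda>\<kappa>. if deg \<kappa> = ?n then a i j \<kappa> else (\<lambda>_. 0)"
    have fp: "coeff_family N UNIV K ?p" using fa[of i j] by (auto simp: coeff_family_def)
    have "principal_symbol N T P i j = (\<lambda>\<kappa>. germ N (?p \<kappa>))"
      unfolding principal_symbol_def sigma_k_def coef GM.q_zero by (intro ext) simp
    then have "sigma_bar N T P i j = subst_star N T (\<lambda>\<kappa>. germ N (?p \<kappa>))" by (simp add: sigma_bar_def)
    then have "(\<Sum>\<nu>\<in>T. of_nat (\<gamma> \<nu>) * xi_deriv N T \<nu> (sigma_bar N T P i j) x \<xi>) = (\<Sum>\<kappa>\<in>K. ?p \<kappa> x * dir_deriv \<gamma> \<kappa> \<xi>)"
      using gradient_subst_star[OF fp _ x \<gamma>(1)] star[OF x] by simp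
    also have "\<dots> = (\<Sum>\<kappa> | \<kappa> \<in> K \<and> deg \<kappa> = ?n. a i j \<kappa> x * dir_deriv \<gamma> \<kappa> \<xi>)"
      using fa[of i j] by (intro sum.mono_neutral_cong_right) (auto simp: coeff_family_def)
    also have "\<dots> = (if i = j then (\<Sum>\<kappa> | \<kappa> \<in> K \<and> deg \<kappa> = ?n. a r r \<kappa> x * dir_deriv \<gamma> \<kappa> \<xi>) else 0)"
      using scalar[OF x, of _ i j] by (auto intro!: sum.cong sum.neutral)
    finally show ?thesis using nz x by (metis (no_types, lifting))
  qed
  have inj: "X = Y" if "X \<in> carrier (mat_alg GM.D)" "P \<otimes>\<^bsub>mat_alg GM.D\<^esub> X = X \<otimes>\<^bsub>mat_alg GM.D\<^esub> P"
    "Y \<in> carrier (mat_alg GM.D)" "P \<otimes>\<^bsub>mat_alg GM.D\<^esub> Y = Y \<otimes>\<^bsub>mat_alg GM.D\<^esub> P" "\<sigma> X = \<sigma> Y" for X Y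
    by (rule sigma_star_inj[OF assms(4) a star order scalar nondeg that])
  have hom: "\<sigma> \<in> alg_hom (centralizer (mat_alg GM.D) P) (mat_alg (poly_alg GN.D T))"
  proof -
    have "\<sigma> X \<in> carrier (mat_alg (poly_alg GN.D T))" if X: "X \<in> carrier (mat_alg GM.D)" for X :: "'m \<Rightarrow> 'm \<Rightarrow> 'i op_M"
    proof -
      obtain L b where b: "\<And>i j. GM.is_op (X i j) L (b i j)" by (rule GM.matrix_cases[OF X]) blast
      have "\<sigma> X i j \<in> carrier (poly_alg GN.D T)" for i j by (rule sigma_star_carrier[of X i j, OF b])
      then show ?thesis by (simp add: mat_alg_def)
    qed
    then show ?thesis
      unfolding alg_hom_def ring_hom_def centralizer_def
      by (auto simp: sigma_star_mult sigma_star_add sigma_star_smult sigma_star_one)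
  qed
  have comm: "Q \<otimes>\<^bsub>mat_alg (D_star N T)\<^esub> Q' = Q' \<otimes>\<^bsub>mat_alg (D_star N T)\<^esub> Q"
    if m: "CARD('m) = 1" and Q: "Q \<in> carrier (centralizer (mat_alg (D_star N T)) P)"
      and Q': "Q' \<in> carrier (centralizer (mat_alg (D_star N T)) P)" for Q Q'
  proof -
    have UN: "UNIV = {r}" using m by (metis (full_types) UNIV_I card_1_singletonE singletonD)
    then have ij: "i = r" for i :: 'm by blast
    have mult_eq: "monoid.mult (D_star N T) = monoid.mult GM.D" by (simp add: D_star_def D_tilde_eq)
    have closed: "x \<otimes>\<^bsub>GM.D\<^esub> y \<in> carrier (D_star N T)" if x: "x \<in> carrier (D_star N T)" and y: "y \<in> carrier (D_star N T)" for x y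
    proof -
      obtain K1 a1 where "GM.is_op x K1 a1" using D_star_sub[OF x] GM.carrier_D by blast
      moreover obtain K2 a2 where "GM.is_op y K2 a2" using D_star_sub[OF y] GM.carrier_D by blast
      ultimately show ?thesis using star_mult x y by metis
    qed
    have mat: "(X \<otimes>\<^bsub>mat_alg (D_star N T)\<^esub> Y) = (\<lambda>i j. X i r \<otimes>\<^bsub>GM.D\<^esub> Y r j)"
      "(X \<otimes>\<^bsub>mat_alg GM.D\<^esub> Y) = (\<lambda>i j. X i r \<otimes>\<^bsub>GM.D\<^esub> Y r j)"
      if "\<And>i j. X i j \<in> carrier (D_star N T)" "\<And>i j. Y i j \<in> carrier (D_star N T)" for X Y
    proof -
      have c: "X i r \<otimes>\<^bsub>GM.D\<^esub> Y r j \<in> carrier (D_star N T)" for i j by (intro closed that)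
      show "(X \<otimes>\<^bsub>mat_alg (D_star N T)\<^esub> Y) = (\<lambda>i j. X i r \<otimes>\<^bsub>GM.D\<^esub> Y r j)"
        using mat_mult_single[OF monoid_D_star UN, of X _ Y] c unfolding mult_eq by (intro ext) simp
      show "(X \<otimes>\<^bsub>mat_alg GM.D\<^esub> Y) = (\<lambda>i j. X i r \<otimes>\<^bsub>GM.D\<^esub> Y r j)"
        using mat_mult_single[OF GM.monoid_D UN, of X _ Y] D_star_sub[OF c] by (intro ext) simp
    qed
    have Qs: "Q i j \<in> carrier (D_star N T)" "Q' i j \<in> carrier (D_star N T)" for i j
      using Q Q' by (auto simp: centralizer_def mat_alg_def)
    have PQ: "P r r \<otimes>\<^bsub>GM.D\<^esub> Q r r = Q r r \<otimes>\<^bsub>GM.D\<^esub> P r r" "P r r \<otimes>\<^bsub>GM.D\<^esub> Q' r r = Q' r r \<otimes>\<^bsub>GM.D\<^esub> P r r"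
      using Q Q' mat(1)[OF Pstar Qs(1)] mat(1)[OF Qs(1) Pstar] mat(1)[OF Pstar Qs(2)] mat(1)[OF Qs(2) Pstar]
      by (auto simp: centralizer_def dest: fun_cong)
    have assoc: "x \<otimes>\<^bsub>GM.D\<^esub> (y \<otimes>\<^bsub>GM.D\<^esub> z) = (x \<otimes>\<^bsub>GM.D\<^esub> y) \<otimes>\<^bsub>GM.D\<^esub> z" if z: "z \<in> carrier (D_star N T)" for x y z
    proof -
      obtain L b where "GM.is_op z L b" using D_star_sub[OF z] GM.carrier_D by blast
      then have "z \<in> carrier (A_M N) \<rightarrow> carrier (A_M N)" using GM.is_op_closed by blast
      then show ?thesis by (simp add: diff_alg_def compose_assoc)
    qed
    let ?X = "\<lambda>i j. Q i r \<otimes>\<^bsub>GM.D\<^esub> Q' r j" and ?Y = "\<lambda>i j. Q' i r \<otimes>\<^bsub>GM.D\<^esub> Q r j"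
    have XY: "?X i j \<in> carrier (D_star N T)" "?Y i j \<in> carrier (D_star N T)" for i j by (intro closed Qs)+
    have "?X = ?Y"
    proof (rule inj)
      show "?X \<in> carrier (mat_alg GM.D)" "?Y \<in> carrier (mat_alg GM.D)"
        using XY D_star_sub by (auto simp: mat_alg_def)
      show "P \<otimes>\<^bsub>mat_alg GM.D\<^esub> ?X = ?X \<otimes>\<^bsub>mat_alg GM.D\<^esub> P"
        unfolding mat(2)[OF Pstar XY(1)] mat(2)[OF XY(1) Pstar]
      proof (rule ext, rule ext)
        fix i j
        show "P i r \<otimes>\<^bsub>GM.D\<^esub> (Q r r \<otimes>\<^bsub>GM.D\<^esub> Q' r j) = (Q i r \<otimes>\<^bsub>GM.D\<^esub> Q' r r) \<otimes>\<^bsub>GM.D\<^esub> P r j"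
          unfolding ij[of i] ij[of j] by (metis assoc Qs Pstar PQ)
      qed
      show "P \<otimes>\<^bsub>mat_alg GM.D\<^esub> ?Y = ?Y \<otimes>\<^bsub>mat_alg GM.D\<^esub> P"
        unfolding mat(2)[OF Pstar XY(2)] mat(2)[OF XY(2) Pstar]
      proof (rule ext, rule ext)
        fix i j
        show "P i r \<otimes>\<^bsub>GM.D\<^esub> (Q' r r \<otimes>\<^bsub>GM.D\<^esub> Q r j) = (Q' i r \<otimes>\<^bsub>GM.D\<^esub> Q r r) \<otimes>\<^bsub>GM.D\<^esub> P r j"
          unfolding ij[of i] ij[of j] by (metis assoc Qs Pstar PQ)
      qed
      show "\<sigma> ?X = \<sigma> ?Y"
      proof (rule ext, rule ext)
        fix i j
        obtain L b where b: "GM.is_op (Q r r) L b" using D_star_sub[OF Qs(1)] GM.carrier_D by blast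
        obtain L' b' where b': "GM.is_op (Q' r r) L' b'" using D_star_sub[OF Qs(2)] GM.carrier_D by blast
        obtain M c where c: "GM.is_op (Q r r \<otimes>\<^bsub>GM.D\<^esub> Q' r r) M c" "\<forall>l. \<forall>y\<in>N. symbol M c l y = symbol L b l y * symbol L' b' l y"
          by (rule star_mult[OF b Qs(1) b' Qs(2)])
        obtain M' c' where c': "GM.is_op (Q' r r \<otimes>\<^bsub>GM.D\<^esub> Q r r) M' c'" "\<forall>l. \<forall>y\<in>N. symbol M' c' l y = symbol L' b' l y * symbol L b l y"
          by (rule star_mult[OF b' Qs(2) b Qs(1)])
        show "\<sigma> ?X i j = \<sigma> ?Y i j"
          unfolding ij[of i] ij[of j]
        proof (rule sigma_star_cong[of ?X r r M c ?Y M' c', OF c(1) c'(1)])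
          fix \<kappa> y assume "y \<in> N"
          then show "c \<kappa> y = c' \<kappa> y"
            using c c' by (intro symbol_unique[of M c M' c']) (auto simp: GM.is_op_def)
        qed
      qed
    qed
    then show ?thesis unfolding mat(1)[OF Qs] mat(1)[OF Qs(2) Qs(1)] .
  qed
  have "inj_on \<sigma> (carrier (centralizer (mat_alg GM.D) P))"
    by (rule inj_onI) (auto simp: centralizer_def intro: inj)
  then show ?thesis using hom comm unfolding D_tilde_eq D_N_eq by blast
qed

end
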